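(* Let $\Sigma$ be a complete immersed self-expander hypersurface in $\mathbb{R}^{n+1}$. If the scalar curvature of $\Sigma$ satisfies $$Scal_\Sigma\ge-\frac{n+1}{2},$$ then $\Sigma$ is $L$-stable.
   Context: $x$ denotes the position vector. For an immersed hypersurface $\Sigma$ with induced metric and volume form $d\sigma$, the second fundamental form is $A(X,Y)=(\overline\nabla_XY)^\perp$ ($\overline\nabla$ the Euclidean connection), the mean curvature vector $\mathbf{H}$ is its trace, and $\Sigma$ is a self-expander if $\mathbf{H}=\frac12x^\perp$ ($x^\perp$ the normal component of $x$). The mean curvature $H$ is defined by $\mathbf{H}=-H\mathbf{n}$, $\mathbf{n}$ the unit normal, and $Scal_\Sigma=H^2-|A|^2$ is the scalar curvature. A self-expander $\Sigma$ is $L$-stable, where $L=\Delta+\frac12\langle x,\nabla\cdot\rangle+|A|^2-\frac12$, if for all $\varphi\in C_0^\infty(\Sigma)$ $$-\int_\Sigma\varphi(L\varphi)e^{\frac{|x|^2}{4}}d\sigma=\int_\Sigma\left(|\nabla\varphi|^2-\big(|A|^2-\tfrac12\big)\varphi^2\right)e^{\frac{|x|^2}{4}}d\sigma\ge0.$$ *)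

theory Defs
  imports "HOL-Analysis.Analysis"
begin

section \<open>Smooth maps\<close>

primrec Ck_on :: "nat \<Rightarrow> ('a::real_normed_vector \<Rightarrow> 'b::real_normed_vector) \<Rightarrow> 'a set \<Rightarrow> bool" where
  "Ck_on 0 f S \<longleftrightarrow> continuous_on S f"
| "Ck_on (Suc k) f S \<longleftrightarrow>
     (\<forall>x\<in>S. f differentiable (at x)) \<and> (\<forall>v. Ck_on k (\<lambda>x. frechet_derivative f (at x) v) S)"

text \<open>Only meant for open sets, since the derivatives are taken at \<open>at x\<close>.\<close>

definition smooth_on :: "'a set \<Rightarrow> ('a::real_normed_vector \<Rightarrow> 'b::real_normed_vector) \<Rightarrow> bool" where
  "smooth_on S f \<longleftrightarrow> (\<forall>k. Ck_on k f S)"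


section \<open>Local geometry of a parametrized hypersurface\<close>

text \<open>
  In this section \<open>X\<close> is a local parametrization, an immersion of an open subset of
  \<open>real ^ 'n\<close> into \<open>real ^ 'k\<close>, and \<open>u\<close> is a point of its domain. Vectors tangent or normal to the
  hypersurface are vectors of the ambient space \<open>real ^ 'k\<close>, and functions and vector fields on the
  hypersurface are given in the coordinates \<open>u\<close>.
\<close>

definition partial :: "'n::finite \<Rightarrow> (real ^ 'n \<Rightarrow> 'b::real_normed_vector) \<Rightarrow> real ^ 'n \<Rightarrow> 'b" where
  "partial i f u = frechet_derivative f (at u) (axis i 1)"

definition metric :: "(real ^ 'n::finite \<Rightarrow> real ^ 'k::finite) \<Rightarrow> real ^ 'n \<Rightarrow> real ^ 'n ^ 'n" where
  "metric X u = (\<chi> i j. partial i X u \<bullet> partial j X u)"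

definition ginv :: "(real ^ 'n::finite \<Rightarrow> real ^ 'k::finite) \<Rightarrow> real ^ 'n \<Rightarrow> 'n \<Rightarrow> 'n \<Rightarrow> real" where
  "ginv X u i j = matrix_inv (metric X u) $ i $ j"

definition normal_component ::
    "(real ^ 'n::finite \<Rightarrow> real ^ 'k::finite) \<Rightarrow> real ^ 'n \<Rightarrow> real ^ 'k \<Rightarrow> real ^ 'k" where
  "normal_component X u v =
     v - (\<Sum>i\<in>UNIV. \<Sum>j\<in>UNIV. (ginv X u i j * (v \<bullet> partial j X u)) *\<^sub>R partial i X u)"

text \<open>
  The components \<open>A(\<partial>\<^sub>i X, \<partial>\<^sub>j X)\<close> of the (normal-valued) second fundamental form: the Euclidean
  derivative of the coordinate field \<open>\<partial>\<^sub>j X\<close> in the direction \<open>\<partial>\<^sub>i X\<close> is \<open>\<partial>\<^sub>i \<partial>\<^sub>j X\<close>.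
\<close>

definition second_ff ::
    "(real ^ 'n::finite \<Rightarrow> real ^ 'k::finite) \<Rightarrow> real ^ 'n \<Rightarrow> 'n \<Rightarrow> 'n \<Rightarrow> real ^ 'k" where
  "second_ff X u i j = normal_component X u (partial i (partial j X) u)"

definition mean_curv_vec ::
    "(real ^ 'n::finite \<Rightarrow> real ^ 'k::finite) \<Rightarrow> real ^ 'n \<Rightarrow> real ^ 'k" where
  "mean_curv_vec X u = (\<Sum>i\<in>UNIV. \<Sum>j\<in>UNIV. ginv X u i j *\<^sub>R second_ff X u i j)"

definition second_ff_norm2 :: "(real ^ 'n::finite \<Rightarrow> real ^ 'k::finite) \<Rightarrow> real ^ 'n \<Rightarrow> real" where
  "second_ff_norm2 X u =
     (\<Sum>i\<in>UNIV. \<Sum>j\<in>UNIV. \<Sum>k\<in>UNIV. \<Sum>l\<in>UNIV.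
        ginv X u i k * ginv X u j l * (second_ff X u i j \<bullet> second_ff X u k l))"

text \<open>
  In codimension one the unit normal is unique up to sign. Its choice affects only the sign of the
  mean curvature, hence not the scalar curvature; in particular no orientation is needed.
\<close>

definition unit_normal :: "(real ^ 'n::finite \<Rightarrow> real ^ 'k::finite) \<Rightarrow> real ^ 'n \<Rightarrow> real ^ 'k" where
  "unit_normal X u = (SOME \<nu>. norm \<nu> = 1 \<and> (\<forall>i. \<nu> \<bullet> partial i X u = 0))"

definition mean_curv :: "(real ^ 'n::finite \<Rightarrow> real ^ 'k::finite) \<Rightarrow> real ^ 'n \<Rightarrow> real" where
  "mean_curv X u = (THE H. mean_curv_vec X u = - (H *\<^sub>R unit_normal X u))"

definition scal_curv :: "(real ^ 'n::finite \<Rightarrow> real ^ 'k::finite) \<Rightarrow> real ^ 'n \<Rightarrow> real" where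
  "scal_curv X u = (mean_curv X u)\<^sup>2 - second_ff_norm2 X u"

definition gradient ::
    "(real ^ 'n::finite \<Rightarrow> real ^ 'k::finite) \<Rightarrow> (real ^ 'n \<Rightarrow> real) \<Rightarrow> real ^ 'n \<Rightarrow> real ^ 'k" where
  "gradient X f u = (\<Sum>i\<in>UNIV. \<Sum>j\<in>UNIV. (ginv X u i j * partial j f u) *\<^sub>R partial i X u)"

text \<open>
  The Levi-Civita connection of the induced metric is the tangential part of the Euclidean one, so
  for tangent fields \<open>V\<close> the following is the intrinsic divergence, the trace of \<open>Y \<mapsto> \<nabla>\<^sub>Y V\<close>.
\<close>

definition divergence ::
    "(real ^ 'n::finite \<Rightarrow> real ^ 'k::finite) \<Rightarrow> (real ^ 'n \<Rightarrow> real ^ 'k) \<Rightarrow> real ^ 'n \<Rightarrow> real" where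
  "divergence X V u = (\<Sum>i\<in>UNIV. \<Sum>j\<in>UNIV. ginv X u i j * (partial i V u \<bullet> partial j X u))"

definition laplacian ::
    "(real ^ 'n::finite \<Rightarrow> real ^ 'k::finite) \<Rightarrow> (real ^ 'n \<Rightarrow> real) \<Rightarrow> real ^ 'n \<Rightarrow> real" where
  "laplacian X f u = divergence X (gradient X f) u"


section \<open>Immersed hypersurfaces\<close>

text \<open>
  The underlying manifold is the whole of a type \<open>'m\<close>, which is required to be Hausdorff and second
  countable by its sort; it need be neither connected nor orientable. A chart is
  given by its inverse, a local parametrization \<open>c\<close> together with its open domain \<open>U\<close>.
\<close>

type_synonym ('n, 'm) chart = "(real ^ 'n) set \<times> (real ^ 'n \<Rightarrow> 'm)"

definition smooth_atlas ::
    "('n::finite, 'm::{second_countable_topology, t2_space}) chart set \<Rightarrow> bool" where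
  "smooth_atlas \<A> \<longleftrightarrow>
     (\<forall>(U, c)\<in>\<A>. open U \<and> open (c ` U) \<and> homeomorphism U (c ` U) c (inv_into U c)) \<and>
     (\<Union>(U, c)\<in>\<A>. c ` U) = UNIV \<and>
     (\<forall>(U, c)\<in>\<A>. \<forall>(V, d)\<in>\<A>. smooth_on (U \<inter> c -` (d ` V)) (inv_into V d \<circ> c))"

definition smooth_map ::
    "('n::finite, 'm::topological_space) chart set \<Rightarrow> ('m \<Rightarrow> 'b::real_normed_vector) \<Rightarrow> bool" where
  "smooth_map \<A> f \<longleftrightarrow> (\<forall>(U, c)\<in>\<A>. smooth_on U (f \<circ> c))"

definition immersed_hypersurface ::
    "('n::finite, 'm::{second_countable_topology, t2_space}) chart set \<Rightarrow>
     ('m \<Rightarrow> real ^ 'k::finite) \<Rightarrow> bool" where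
  "immersed_hypersurface \<A> F \<longleftrightarrow>
     CARD('k) = CARD('n) + 1 \<and> smooth_atlas \<A> \<and> smooth_map \<A> F \<and>
     (\<forall>(U, c)\<in>\<A>. \<forall>u\<in>U. inj (frechet_derivative (F \<circ> c) (at u)))"

text \<open>
  The distance of the induced metric (\<open>\<infinity>\<close> between different components). As \<open>F\<close> is an immersion,
  a continuous curve \<open>\<gamma>\<close> is piecewise \<open>C\<^sup>1\<close> iff \<open>F \<circ> \<gamma>\<close> is, and its length in the induced metric
  is the Euclidean length of \<open>F \<circ> \<gamma>\<close>.
\<close>

definition induced_dist ::
    "('m::topological_space \<Rightarrow> real ^ 'k::finite) \<Rightarrow> 'm \<Rightarrow> 'm \<Rightarrow> ennreal" where
  "induced_dist F p q =
     (INF \<gamma> \<in> {\<gamma>. path \<gamma> \<and> valid_path (F \<circ> \<gamma>) \<and> pathstart \<gamma> = p \<and> pathfinish \<gamma> = q}.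
        \<integral>\<^sup>+t\<in>{0..1}. ennreal (norm (vector_derivative (F \<circ> \<gamma>) (at t))) \<partial>lborel)"

definition complete_hypersurface :: "('m::topological_space \<Rightarrow> real ^ 'k::finite) \<Rightarrow> bool" where
  "complete_hypersurface F \<longleftrightarrow>
     (\<forall>s :: nat \<Rightarrow> 'm.
        (\<forall>e>0. \<exists>N. \<forall>i\<ge>N. \<forall>j\<ge>N. induced_dist F (s i) (s j) < e) \<longrightarrow>
        (\<exists>p. (\<lambda>i. induced_dist F (s i) p) \<longlonglongrightarrow> 0))"

text \<open>The volume measure \<open>d\<sigma> = sqrt (det g) du\<close> of the induced metric.\<close>

definition volume_measure ::
    "('n::finite, 'm::topological_space) chart set \<Rightarrow> ('m \<Rightarrow> real ^ 'k::finite) \<Rightarrow> 'm measure" where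
  "volume_measure \<A> F =
     (THE \<sigma>. sets \<sigma> = sets borel \<and>
        (\<forall>(U, c)\<in>\<A>. \<forall>E\<in>sets borel. E \<subseteq> U \<longrightarrow>
           emeasure \<sigma> (c ` E) = (\<integral>\<^sup>+u\<in>E. ennreal (sqrt (det (metric (F \<circ> c) u))) \<partial>lborel)))"

text \<open>
  The geometric quantities at a point \<open>p\<close> do not depend on the chart around \<open>p\<close> in which they are
  computed, so an arbitrary one is used.
\<close>

definition param_at :: "('n::finite, 'm) chart set \<Rightarrow> 'm \<Rightarrow> real ^ 'n \<Rightarrow> 'm" where
  "param_at \<A> p = snd (SOME C. C \<in> \<A> \<and> p \<in> snd C ` fst C)"

definition coord_at :: "('n::finite, 'm) chart set \<Rightarrow> 'm \<Rightarrow> real ^ 'n" where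
  "coord_at \<A> p = (case SOME C. C \<in> \<A> \<and> p \<in> snd C ` fst C of (U, c) \<Rightarrow> inv_into U c p)"

definition H_vec :: "('n::finite, 'm) chart set \<Rightarrow> ('m \<Rightarrow> real ^ 'k::finite) \<Rightarrow> 'm \<Rightarrow> real ^ 'k" where
  "H_vec \<A> F p = mean_curv_vec (F \<circ> param_at \<A> p) (coord_at \<A> p)"

definition position_normal ::
    "('n::finite, 'm) chart set \<Rightarrow> ('m \<Rightarrow> real ^ 'k::finite) \<Rightarrow> 'm \<Rightarrow> real ^ 'k" where
  "position_normal \<A> F p = normal_component (F \<circ> param_at \<A> p) (coord_at \<A> p) (F p)"

definition A_norm2 :: "('n::finite, 'm) chart set \<Rightarrow> ('m \<Rightarrow> real ^ 'k::finite) \<Rightarrow> 'm \<Rightarrow> real" where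
  "A_norm2 \<A> F p = second_ff_norm2 (F \<circ> param_at \<A> p) (coord_at \<A> p)"

definition Scal :: "('n::finite, 'm) chart set \<Rightarrow> ('m \<Rightarrow> real ^ 'k::finite) \<Rightarrow> 'm \<Rightarrow> real" where
  "Scal \<A> F p = scal_curv (F \<circ> param_at \<A> p) (coord_at \<A> p)"

definition grad ::
    "('n::finite, 'm) chart set \<Rightarrow> ('m \<Rightarrow> real ^ 'k::finite) \<Rightarrow> ('m \<Rightarrow> real) \<Rightarrow> 'm \<Rightarrow> real ^ 'k" where
  "grad \<A> F \<phi> p = gradient (F \<circ> param_at \<A> p) (\<phi> \<circ> param_at \<A> p) (coord_at \<A> p)"

definition Laplace ::
    "('n::finite, 'm) chart set \<Rightarrow> ('m \<Rightarrow> real ^ 'k::finite) \<Rightarrow> ('m \<Rightarrow> real) \<Rightarrow> 'm \<Rightarrow> real" where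
  "Laplace \<A> F \<phi> p = laplacian (F \<circ> param_at \<A> p) (\<phi> \<circ> param_at \<A> p) (coord_at \<A> p)"


section \<open>Self-expanders and stability\<close>

definition self_expander :: "('n::finite, 'm) chart set \<Rightarrow> ('m \<Rightarrow> real ^ 'k::finite) \<Rightarrow> bool" where
  "self_expander \<A> F \<longleftrightarrow> (\<forall>p. H_vec \<A> F p = (1/2) *\<^sub>R position_normal \<A> F p)"

definition L_op ::
    "('n::finite, 'm) chart set \<Rightarrow> ('m \<Rightarrow> real ^ 'k::finite) \<Rightarrow> ('m \<Rightarrow> real) \<Rightarrow> 'm \<Rightarrow> real" where
  "L_op \<A> F \<phi> p =
     Laplace \<A> F \<phi> p + 1/2 * (F p \<bullet> grad \<A> F \<phi> p) + A_norm2 \<A> F p * \<phi> p - 1/2 * \<phi> p"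

definition smooth_compact_support ::
    "('n::finite, 'm::topological_space) chart set \<Rightarrow> ('m \<Rightarrow> real) \<Rightarrow> bool" where
  "smooth_compact_support \<A> \<phi> \<longleftrightarrow> smooth_map \<A> \<phi> \<and> compact (closure {p. \<phi> p \<noteq> 0})"

definition stability_form ::
    "('n::finite, 'm::topological_space) chart set \<Rightarrow> ('m \<Rightarrow> real ^ 'k::finite) \<Rightarrow>
     ('m \<Rightarrow> real) \<Rightarrow> real" where
  "stability_form \<A> F \<phi> =
     (LINT p|volume_measure \<A> F.
        ((norm (grad \<A> F \<phi> p))\<^sup>2 - (A_norm2 \<A> F p - 1/2) * (\<phi> p)\<^sup>2) * exp ((norm (F p))\<^sup>2 / 4))"

definition L_stable ::
    "('n::finite, 'm::topological_space) chart set \<Rightarrow> ('m \<Rightarrow> real ^ 'k::finite) \<Rightarrow> bool" where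
  "L_stable \<A> F \<longleftrightarrow>
     (\<forall>\<phi>. smooth_compact_support \<A> \<phi> \<longrightarrow>
        - (LINT p|volume_measure \<A> F. \<phi> p * L_op \<A> F \<phi> p * exp ((norm (F p))\<^sup>2 / 4))
          = stability_form \<A> F \<phi> \<and>
        0 \<le> stability_form \<A> F \<phi>)"

end

theory Submission
  imports Defs
begin

text \<open>
  Write \<open>h = |x|\<^sup>2 / 4\<close>, so that all integrals are taken against the weight \<open>e\<^sup>h\<close>. The reason for
  stability is that \<open>e\<^sup>-\<^sup>h\<close> is a positive supersolution of \<open>L\<close>. Indeed the tangential gradient of \<open>h\<close>
  is half the tangential part of \<open>x\<close>, and on an \<open>n\<close>-dimensional self-expander
  \<open>\<Delta>h = n/2 + \<langle>x\<^sup>\<bottom>, H\<rangle>/2 = n/2 + |x\<^sup>\<bottom>|\<^sup>2/4\<close>. Since the squared mean curvature is \<open>|x\<^sup>\<bottom>|\<^sup>2/4\<close>, the bound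
  on the scalar curvature says exactly that \<open>|A|\<^sup>2 - 1/2 \<le> \<Delta>h\<close>.

  This is used without dividing by the supersolution, through Green's formula
  \<open>\<integral> (a \<Delta>b + \<langle>\<nabla>a, \<nabla>b\<rangle>) d\<sigma> = 0\<close> for compactly supported \<open>a\<close> (lemma \<open>green_formula\<close>). With
  \<open>a = \<phi> e\<^sup>h\<close> and \<open>b = \<phi>\<close> the integrand is \<open>\<phi> L\<phi> e\<^sup>h\<close> plus the integrand of the stability form, which
  gives the integration by parts (lemma \<open>green_drift_laplacian\<close>). With \<open>a = \<phi>\<^sup>2 e\<^sup>h\<close> and \<open>b = h\<close> it is
  \<open>(\<phi>\<^sup>2 \<Delta>h + 2 \<phi> \<langle>\<nabla>\<phi>, \<nabla>h\<rangle> + \<phi>\<^sup>2 |\<nabla>h|\<^sup>2) e\<^sup>h\<close>; adding this function of integral zero to the integrand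
  of the stability form leaves at least \<open>|\<nabla>\<phi> + \<phi> \<nabla>h|\<^sup>2 e\<^sup>h \<ge> 0\<close> (lemma \<open>stability_integrand_bound\<close>).

  Most of the work is Green's formula for quantities that are computed at each point in an arbitrarily
  chosen chart. In one chart, \<open>a \<Delta>b + \<langle>\<nabla>a, \<nabla>b\<rangle>\<close> times the density \<open>sqrt (det g)\<close> is a coordinate
  divergence (lemma \<open>green_density_divergence_form\<close>, from the derivative of the determinant and the
  symmetry of second derivatives), and the integral of a partial derivative of a compactly supported
  function vanishes by translation invariance (lemma \<open>integral_partial_eq_0\<close>). The integrand is
  independent of the chart (lemma \<open>green_density_change\<close>), the change-of-variables formula shows that
  the volume measure exists and is given by \<open>sqrt (det g)\<close> in each chart
  (lemma \<open>ex1_volume_measure\<close>), and \<open>a\<close> is cut into pieces supported in single charts.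
\<close>

section \<open>Continuously differentiable maps\<close>
abbreviation C1_on :: "('a::real_normed_vector \<Rightarrow> 'b::real_normed_vector) \<Rightarrow> 'a set \<Rightarrow> bool" where
  "C1_on f S \<equiv> Ck_on (Suc 0) f S"

lemma C1_onI:
  assumes "\<And>x. x \<in> S \<Longrightarrow> (f has_derivative f' x) (at x)"
    and "\<And>v. continuous_on S (\<lambda>x. f' x v)"
  shows "C1_on f S"
proof -
  have "frechet_derivative f (at x) = f' x" if "x \<in> S" for x
    using frechet_derivative_at[OF assms(1)[OF that]] by simp
  then have "continuous_on S (\<lambda>x. frechet_derivative f (at x) v)" for v
    using assms(2)[of v] by (simp cong: continuous_on_cong)
  then show ?thesis
    using assms(1) by (auto simp: differentiable_def)
qed

lemma C1_on_has_derivative: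
  "C1_on f S \<Longrightarrow> x \<in> S \<Longrightarrow> (f has_derivative frechet_derivative f (at x)) (at x)"
  by (simp add: frechet_derivative_works[symmetric])

lemma C1_on_continuous_derivative:
  "C1_on f S \<Longrightarrow> continuous_on S (\<lambda>x. frechet_derivative f (at x) v)"
  by simp

lemma C1_on_continuous: "C1_on f S \<Longrightarrow> continuous_on S f"
  by (meson C1_on_has_derivative continuous_at_imp_continuous_on has_derivative_continuous)

lemma Ck_on_subset: "Ck_on k f S \<Longrightarrow> T \<subseteq> S \<Longrightarrow> Ck_on k f T"
  by (induction k arbitrary: f) (auto intro: continuous_on_subset)

lemma frechet_derivative_cong_open:
  assumes "open S" "x \<in> S" "\<And>y. y \<in> S \<Longrightarrow> f y = g y"
  shows "frechet_derivative f (at x) = frechet_derivative g (at x)"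
proof -
  have "(f has_derivative D) (at x) \<longleftrightarrow> (g has_derivative D) (at x)" for D
    using assms has_derivative_transform_within_open[of _ D x UNIV S]
    by metis
  then show ?thesis by (simp add: frechet_derivative_def)
qed

lemma C1_on_cong:
  assumes "open S" "\<And>y. y \<in> S \<Longrightarrow> f y = g y" "C1_on f S"
  shows "C1_on g S"
proof (rule C1_onI)
  show "(g has_derivative frechet_derivative f (at x)) (at x)" if "x \<in> S" for x
    using has_derivative_transform_within_open[OF C1_on_has_derivative[OF assms(3) that] assms(1) that] assms(2)
    by auto
qed (rule C1_on_continuous_derivative[OF assms(3)])

lemma C1_on_const: "C1_on (\<lambda>x. c) S"
  by (rule C1_onI[where f'="\<lambda>x v. 0"]) auto

text \<open>
  The product rule for every bilinear operation at once; the instances needed are multiplication,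
  scaling and the inner product.
\<close>
lemma C1_on_bounded_bilinear:
  assumes "bounded_bilinear bil" "C1_on f S" "C1_on g S"
  shows "C1_on (\<lambda>x. bil (f x) (g x)) S"
proof (rule C1_onI)
  interpret bounded_bilinear bil by fact
  show "((\<lambda>x. bil (f x) (g x)) has_derivative
      (\<lambda>v. bil (f x) (frechet_derivative g (at x) v) + bil (frechet_derivative f (at x) v) (g x))) (at x)"
    if "x \<in> S" for x
    by (intro FDERIV C1_on_has_derivative[OF assms(2) that] C1_on_has_derivative[OF assms(3) that])
  show "continuous_on S (\<lambda>x. bil (f x) (frechet_derivative g (at x) v) + bil (frechet_derivative f (at x) v) (g x))" for v
    by (intro continuous_on continuous_on_add C1_on_continuous[OF assms(2)] C1_on_continuous[OF assms(3)]
        C1_on_continuous_derivative[OF assms(2)] C1_on_continuous_derivative[OF assms(3)])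
qed

lemmas C1_on_mult = C1_on_bounded_bilinear[OF bounded_bilinear_mult]
lemmas C1_on_scaleR = C1_on_bounded_bilinear[OF bounded_bilinear_scaleR]
lemmas C1_on_inner = C1_on_bounded_bilinear[OF bounded_bilinear_inner]

lemma C1_on_add:
  assumes "C1_on f S" "C1_on g S"
  shows "C1_on (\<lambda>x. f x + g x) S"
  by (rule C1_onI, rule has_derivative_add[OF C1_on_has_derivative[OF assms(1)] C1_on_has_derivative[OF assms(2)]])
    (auto intro!: continuous_on_add C1_on_continuous_derivative assms)

lemma C1_on_diff:
  assumes "C1_on f S" "C1_on g S"
  shows "C1_on (\<lambda>x. f x - g x) S"
  by (rule C1_onI, rule has_derivative_diff[OF C1_on_has_derivative[OF assms(1)] C1_on_has_derivative[OF assms(2)]])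
    (auto intro!: continuous_on_diff C1_on_continuous_derivative assms)

lemma C1_on_sum:
  assumes "\<And>i. i \<in> I \<Longrightarrow> C1_on (f i) S"
  shows "C1_on (\<lambda>x. \<Sum>i\<in>I. f i x) S"
  using assms by (induction I rule: infinite_finite_induct) (auto intro!: C1_on_add C1_on_const simp del: Ck_on.simps)

lemma C1_on_prod:
  fixes f :: "'i \<Rightarrow> 'a::real_normed_vector \<Rightarrow> 'b::real_normed_field"
  assumes "\<And>i. i \<in> I \<Longrightarrow> C1_on (f i) S"
  shows "C1_on (\<lambda>x. \<Prod>i\<in>I. f i x) S"
  using assms by (induction I rule: infinite_finite_induct) (auto intro!: C1_on_mult C1_on_const simp del: Ck_on.simps)

lemma C1_on_compose_real:
  fixes g :: "real \<Rightarrow> real"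
  assumes "C1_on f S" "\<And>x. x \<in> S \<Longrightarrow> (g has_field_derivative g' (f x)) (at (f x))"
    "continuous_on (f ` S) g'"
  shows "C1_on (\<lambda>x. g (f x)) S"
proof (rule C1_onI)
  show "((\<lambda>x. g (f x)) has_derivative (\<lambda>v. g' (f x) * frechet_derivative f (at x) v)) (at x)" if "x \<in> S" for x
    using has_derivative_compose[OF C1_on_has_derivative[OF assms(1) that]
        assms(2)[OF that, unfolded has_field_derivative_def]] .
  have "continuous_on S (\<lambda>x. g' (f x))"
    using continuous_on_compose2[OF assms(3) C1_on_continuous[OF assms(1)]] by auto
  then show "continuous_on S (\<lambda>x. g' (f x) * frechet_derivative f (at x) v)" for v
    by (intro continuous_on_mult C1_on_continuous_derivative[OF assms(1)])
qed

lemma C1_on_inverse: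
  fixes f :: "'a::real_normed_vector \<Rightarrow> real"
  assumes "C1_on f S" "\<And>x. x \<in> S \<Longrightarrow> f x \<noteq> 0"
  shows "C1_on (\<lambda>x. inverse (f x)) S"
  by (rule C1_on_compose_real[OF assms(1), where g'="\<lambda>t. - inverse (t ^ 2)"])
    (use assms(2) in \<open>auto intro!: derivative_eq_intros continuous_intros simp: power2_eq_square\<close>)

lemma C1_on_sqrt:
  fixes f :: "'a::real_normed_vector \<Rightarrow> real"
  assumes "C1_on f S" "\<And>x. x \<in> S \<Longrightarrow> f x > 0"
  shows "C1_on (\<lambda>x. sqrt (f x)) S"
  by (rule C1_on_compose_real[OF assms(1), where g'="\<lambda>t. inverse (sqrt t) / 2"])
    (use assms(2) in \<open>fastforce intro!: derivative_eq_intros continuous_intros\<close>)+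

lemma C1_on_exp:
  fixes f :: "'a::real_normed_vector \<Rightarrow> real"
  assumes "C1_on f S"
  shows "C1_on (\<lambda>x. exp (f x)) S"
  by (rule C1_on_compose_real[OF assms(1), where g'=exp]) (auto intro!: continuous_intros)

lemma C1_on_partial:
  assumes "Ck_on 2 f S"
  shows "C1_on (\<lambda>x. partial i f x) S"
  using assms unfolding numeral_2_eq_2 Ck_on.simps(2)[of "Suc 0"] partial_def by blast

lemma C2_on_imp_C1_on:
  assumes "Ck_on 2 f S"
  shows "C1_on f S"
proof -
  have "f differentiable (at x)" if "x \<in> S" for x
    using assms that unfolding numeral_2_eq_2 Ck_on.simps(2)[of "Suc 0"] by blast
  moreover have "C1_on (\<lambda>x. frechet_derivative f (at x) v) S" for v
    using assms unfolding numeral_2_eq_2 Ck_on.simps(2)[of "Suc 0"] by blast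
  ultimately show ?thesis
    using C1_on_continuous[of "\<lambda>x. frechet_derivative f (at x) v" S for v]
    by (simp add: Ck_on.simps(2)[of 0] del: Ck_on.simps(2))
qed

lemma C2_onI:
  assumes "\<And>x. x \<in> S \<Longrightarrow> (f has_derivative f' x) (at x)"
    and "open S" "\<And>v. C1_on (\<lambda>x. f' x v) S"
  shows "Ck_on 2 f S"
proof -
  have *: "frechet_derivative f (at x) = f' x" if "x \<in> S" for x
    using frechet_derivative_at[OF assms(1)[OF that]] by simp
  have "C1_on (\<lambda>x. frechet_derivative f (at x) v) S" for v
    by (rule C1_on_cong[OF assms(2) _ assms(3)[of v]]) (simp add: *)
  then show ?thesis
    using assms(1) unfolding numeral_2_eq_2 Ck_on.simps(2)[of "Suc 0"] differentiable_def by blast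
qed

lemma smooth_on_imp_Ck_on: "smooth_on S f \<Longrightarrow> Ck_on k f S"
  by (simp add: smooth_on_def)

section \<open>Partial derivatives and their symmetry\<close>
lemma frechet_derivative_eq_sum_partial:
  fixes f :: "real ^ 'n::finite \<Rightarrow> 'b::real_normed_vector"
  assumes "f differentiable (at x)"
  shows "frechet_derivative f (at x) v = (\<Sum>i\<in>UNIV. v $ i *\<^sub>R partial i f x)"
proof -
  have "linear (frechet_derivative f (at x))"
    by (rule linear_frechet_derivative[OF assms])
  moreover have "v = (\<Sum>i\<in>UNIV. v $ i *\<^sub>R axis i 1)"
    using basis_expansion[of v] by (simp add: scalar_mult_eq_scaleR)
  ultimately have "frechet_derivative f (at x) v = (\<Sum>i\<in>UNIV. frechet_derivative f (at x) (v $ i *\<^sub>R axis i 1))"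
    using linear_sum by metis
  then show ?thesis
    using linear_scale[OF \<open>linear (frechet_derivative f (at x))\<close>] by (simp add: partial_def)
qed

lemma has_real_derivative_along_line:
  assumes "f differentiable (at (p + t *\<^sub>R axis i 1))"
  shows "((\<lambda>t. f (p + t *\<^sub>R axis i (1::real))) has_real_derivative partial i f (p + t *\<^sub>R axis i 1)) (at t)"
proof -
  let ?D = "frechet_derivative f (at (p + t *\<^sub>R axis i 1))"
  have 1: "(f has_derivative ?D) (at (p + t *\<^sub>R axis i 1))"
    using assms frechet_derivative_works by blast
  have "((\<lambda>t. p + t *\<^sub>R axis i (1::real)) has_derivative (\<lambda>s. s *\<^sub>R axis i 1)) (at t)"
    by (auto intro!: derivative_eq_intros)
  from has_derivative_compose[OF this 1]
  have "((\<lambda>t. f (p + t *\<^sub>R axis i (1::real))) has_derivative (\<lambda>s. ?D (s *\<^sub>R axis i 1))) (at t)" .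
  moreover have "?D (s *\<^sub>R axis i 1) = partial i f (p + t *\<^sub>R axis i 1) * s" for s
    using linear_scale[OF linear_frechet_derivative[OF assms]] by (simp add: partial_def)
  ultimately show ?thesis by (simp add: has_field_derivative_def)
qed

text \<open>
  The mean value theorem is applied in direction \<open>i\<close> to the difference of \<open>f\<close> in direction \<open>j\<close>, and then
  in direction \<open>j\<close>. The left-hand side is symmetric in \<open>i\<close> and \<open>j\<close> while the order of differentiation
  on the right is not, so the two instances of this lemma compare the mixed derivatives.
\<close>
lemma second_difference_eq_mixed_partial:
  fixes f :: "real ^ 'n::finite \<Rightarrow> real"
  assumes C2: "Ck_on 2 f (ball p r)" and h: "0 < h" "2 * h < r"
  obtains s t where "0 < s" "s < h" "0 < t" "t < h"
    "f (p + h *\<^sub>R axis i 1 + h *\<^sub>R axis j 1) - f (p + h *\<^sub>R axis i 1) - f (p + h *\<^sub>R axis j 1) + f p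
      = h * h * partial j (partial i f) (p + s *\<^sub>R axis i 1 + t *\<^sub>R axis j 1)"
proof -
  have inball: "p + s *\<^sub>R axis i 1 + t *\<^sub>R axis j 1 \<in> ball p r"
    if "0 \<le> s" "s \<le> h" "0 \<le> t" "t \<le> h" for s t
  proof -
    have "norm (s *\<^sub>R axis i (1::real) + t *\<^sub>R axis j 1) \<le> s + t"
      using that by (intro order.trans[OF norm_triangle_ineq]) simp
    also have "\<dots> < r" using that h by linarith
    finally show ?thesis
      by (metis add.assoc add_diff_cancel_left' dist_commute dist_norm mem_ball)
  qed
  have d1: "f differentiable (at x)" if "x \<in> ball p r" for x
    using C2_on_imp_C1_on[OF C2] that by auto
  have d2: "partial i f differentiable (at x)" if "x \<in> ball p r" for x
    using C1_on_partial[OF C2, of i] that by auto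
  let ?g = "\<lambda>s. f (p + h *\<^sub>R axis j 1 + s *\<^sub>R axis i 1) - f (p + s *\<^sub>R axis i 1)"
  have "\<exists>s. 0 < s \<and> s < h \<and> ?g h - ?g 0 = (h - 0) * (partial i f (p + h *\<^sub>R axis j 1 + s *\<^sub>R axis i 1) - partial i f (p + s *\<^sub>R axis i 1))"
  proof (rule MVT2)
    fix s assume "0 \<le> s" "s \<le> h"
    show "(?g has_real_derivative partial i f (p + h *\<^sub>R axis j 1 + s *\<^sub>R axis i 1) - partial i f (p + s *\<^sub>R axis i 1)) (at s)"
      using inball[of s h] inball[of s 0] \<open>0 \<le> s\<close> \<open>s \<le> h\<close> h
      by (intro DERIV_diff has_real_derivative_along_line d1) (auto simp: add.assoc add.commute add.left_commute)
  qed (use h in auto)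
  then obtain s where s: "0 < s" "s < h"
    "?g h - ?g 0 = h * (partial i f (p + h *\<^sub>R axis j 1 + s *\<^sub>R axis i 1) - partial i f (p + s *\<^sub>R axis i 1))" by auto
  have "\<exists>t. 0 < t \<and> t < h \<and> partial i f (p + s *\<^sub>R axis i 1 + h *\<^sub>R axis j 1) - partial i f (p + s *\<^sub>R axis i 1 + 0 *\<^sub>R axis j 1)
      = (h - 0) * partial j (partial i f) (p + s *\<^sub>R axis i 1 + t *\<^sub>R axis j 1)"
  proof (rule MVT2)
    fix t assume "0 \<le> t" "t \<le> h"
    show "((\<lambda>t. partial i f (p + s *\<^sub>R axis i 1 + t *\<^sub>R axis j 1)) has_real_derivative
        partial j (partial i f) (p + s *\<^sub>R axis i 1 + t *\<^sub>R axis j 1)) (at t)"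
      using inball[of s t] \<open>0 \<le> t\<close> \<open>t \<le> h\<close> s
      by (intro has_real_derivative_along_line d2) auto
  qed (use h in auto)
  then obtain t where t: "0 < t" "t < h" "partial i f (p + s *\<^sub>R axis i 1 + h *\<^sub>R axis j 1) - partial i f (p + s *\<^sub>R axis i 1)
      = h * partial j (partial i f) (p + s *\<^sub>R axis i 1 + t *\<^sub>R axis j 1)" by auto
  have "?g h - ?g 0 = h * (h * partial j (partial i f) (p + s *\<^sub>R axis i 1 + t *\<^sub>R axis j 1))"
    unfolding s(3) t(3)[symmetric] by (simp add: ac_simps)
  then have "f (p + h *\<^sub>R axis i 1 + h *\<^sub>R axis j 1) - f (p + h *\<^sub>R axis i 1) - f (p + h *\<^sub>R axis j 1) + f p
      = h * h * partial j (partial i f) (p + s *\<^sub>R axis i 1 + t *\<^sub>R axis j 1)"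
    by (simp add: algebra_simps)
  then show ?thesis using that s t by blast
qed

text \<open>
  If the mixed derivatives at \<open>p\<close> differed by \<open>2 e\<close>, then on a small ball each would stay within \<open>e\<close> of
  its value at \<open>p\<close>; but by the previous lemma they agree at two points of that ball.
\<close>
lemma partial_commute_real:
  fixes f :: "real ^ 'n::finite \<Rightarrow> real"
  assumes "Ck_on 2 f U" "open U" "p \<in> U"
  shows "partial i (partial j f) p = partial j (partial i f) p"
proof (rule ccontr)
  let ?a = "partial i (partial j f)" and ?b = "partial j (partial i f)"
  assume "?a p \<noteq> ?b p"
  define e where "e = \<bar>?a p - ?b p\<bar> / 2"
  have "e > 0" using \<open>?a p \<noteq> ?b p\<close> by (simp add: e_def)
  have "isCont ?a p" "isCont ?b p"
    using C1_on_continuous_derivative[OF C1_on_partial[OF assms(1)]] assms(2,3)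
    by (auto simp: partial_def[abs_def] continuous_on_eq_continuous_at)
  then have "\<forall>\<^sub>F x in nhds p. dist (?a x) (?a p) < e \<and> dist (?b x) (?b p) < e"
    using \<open>e > 0\<close> by (intro eventually_conj) (auto simp: isCont_def tendsto_at_iff_tendsto_nhds dest: tendstoD)
  then obtain d where d: "d > 0" "\<And>x. dist x p < d \<Longrightarrow> dist (?a x) (?a p) < e \<and> dist (?b x) (?b p) < e"
    by (auto simp: eventually_nhds_metric)
  obtain r0 where r0: "r0 > 0" "ball p r0 \<subseteq> U"
    using assms(2,3) open_contains_ball by blast
  define r where "r = min r0 d"
  have r: "r > 0" "ball p r \<subseteq> U" "r \<le> d" using r0 d by (auto simp: r_def)
  have C2: "Ck_on 2 f (ball p r)"
    using assms(1) r(2) unfolding numeral_2_eq_2 by (rule Ck_on_subset)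
  define h where "h = r / 4"
  have h: "0 < h" "2 * h < r" using r by (auto simp: h_def)
  obtain s t where st: "0 < s" "s < h" "0 < t" "t < h"
    "f (p + h *\<^sub>R axis i 1 + h *\<^sub>R axis j 1) - f (p + h *\<^sub>R axis i 1) - f (p + h *\<^sub>R axis j 1) + f p
      = h * h * ?b (p + s *\<^sub>R axis i 1 + t *\<^sub>R axis j 1)"
    by (rule second_difference_eq_mixed_partial[OF C2 h])
  obtain s' t' where st': "0 < s'" "s' < h" "0 < t'" "t' < h"
    "f (p + h *\<^sub>R axis j 1 + h *\<^sub>R axis i 1) - f (p + h *\<^sub>R axis j 1) - f (p + h *\<^sub>R axis i 1) + f p
      = h * h * ?a (p + s' *\<^sub>R axis j 1 + t' *\<^sub>R axis i 1)"
    by (rule second_difference_eq_mixed_partial[OF C2 h])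
  have near: "dist (p + s *\<^sub>R axis i 1 + t *\<^sub>R axis j (1::real)) p < d"
    if "0 < s" "s < h" "0 < t" "t < h" for s t i j
  proof -
    have "norm (s *\<^sub>R axis i (1::real) + t *\<^sub>R axis j 1) \<le> s + t"
      using that by (intro order.trans[OF norm_triangle_ineq]) simp
    also have "\<dots> < d" using that h r by linarith
    finally show ?thesis by (simp add: dist_norm add.assoc)
  qed
  have "h * h * ?b (p + s *\<^sub>R axis i 1 + t *\<^sub>R axis j 1) = h * h * ?a (p + s' *\<^sub>R axis j 1 + t' *\<^sub>R axis i 1)"
    unfolding st(5)[symmetric] st'(5)[symmetric] by (simp add: ac_simps)
  then have "?b (p + s *\<^sub>R axis i 1 + t *\<^sub>R axis j 1) = ?a (p + s' *\<^sub>R axis j 1 + t' *\<^sub>R axis i 1)"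
    using h by simp
  moreover have "dist (?b (p + s *\<^sub>R axis i 1 + t *\<^sub>R axis j 1)) (?b p) < e"
    using d(2) near st by blast
  moreover have "dist (?a (p + s' *\<^sub>R axis j 1 + t' *\<^sub>R axis i 1)) (?a p) < e"
    using d(2) near st' by blast
  ultimately show False
    by (simp add: e_def dist_real_def abs_if split: if_splits)
qed

lemma partial_inner_right:
  fixes f :: "real ^ 'n::finite \<Rightarrow> 'b::real_inner"
  assumes "f differentiable (at x)"
  shows "partial i (\<lambda>x. f x \<bullet> w) x = partial i f x \<bullet> w"
proof -
  have "(f has_derivative frechet_derivative f (at x)) (at x)"
    using assms frechet_derivative_works by blast
  then have "((\<lambda>x. f x \<bullet> w) has_derivative (\<lambda>v. frechet_derivative f (at x) v \<bullet> w)) (at x)"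
    by (rule has_derivative_inner_left)
  then show ?thesis
    unfolding partial_def using frechet_derivative_at by metis
qed

lemma partial_commute:
  fixes f :: "real ^ 'n::finite \<Rightarrow> 'b::euclidean_space"
  assumes "Ck_on 2 f U" "open U" "p \<in> U"
  shows "partial i (partial j f) p = partial j (partial i f) p"
proof (rule euclidean_eqI)
  fix w :: 'b assume "w \<in> Basis"
  have d: "(f has_derivative frechet_derivative f (at x)) (at x)" if "x \<in> U" for x
    by (rule C1_on_has_derivative[OF C2_on_imp_C1_on[OF assms(1)] that])
  have C2: "Ck_on 2 (\<lambda>x. f x \<bullet> w) U"
  proof (rule C2_onI)
    show "((\<lambda>x. f x \<bullet> w) has_derivative (\<lambda>v. frechet_derivative f (at x) v \<bullet> w)) (at x)" if "x \<in> U" for x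
      using d[OF that] by (rule has_derivative_inner_left)
    show "C1_on (\<lambda>x. frechet_derivative f (at x) v \<bullet> w) U" for v
      using assms(1) by (intro C1_on_inner C1_on_const) (auto simp: numeral_2_eq_2)
  qed fact
  have *: "partial i (partial j (\<lambda>x. f x \<bullet> w)) p = partial i (partial j f) p \<bullet> w" for i j
  proof -
    have 1: "partial j (\<lambda>x. f x \<bullet> w) x = partial j f x \<bullet> w" if "x \<in> U" for x
      by (rule partial_inner_right) (use C2_on_imp_C1_on[OF assms(1)] that in auto)
    have "partial i (partial j (\<lambda>x. f x \<bullet> w)) p = partial i (\<lambda>x. partial j f x \<bullet> w) p"
      unfolding partial_def[of i] by (subst frechet_derivative_cong_open[OF assms(2,3) 1]) auto
    also have "\<dots> = partial i (partial j f) p \<bullet> w"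
      by (rule partial_inner_right) (use C1_on_partial[OF assms(1), of j] assms(3) in auto)
    finally show ?thesis .
  qed
  show "partial i (partial j f) p \<bullet> w = partial j (partial i f) p \<bullet> w"
    using partial_commute_real[OF C2 assms(2,3), of i j] by (simp add: *)
qed

section \<open>Differentiation of determinants and inverse matrices\<close>
lemma matrix_inv_mult:
  fixes A :: "real ^ 'n::finite ^ 'n"
  assumes "det A \<noteq> 0"
  shows "A ** matrix_inv A = mat 1" "matrix_inv A ** A = mat 1"
proof -
  have "\<exists>A'. A ** A' = mat 1 \<and> A' ** A = mat 1"
    using assms by (simp add: invertible_det_nz[symmetric] invertible_def)
  then have "A ** matrix_inv A = mat 1 \<and> matrix_inv A ** A = mat 1"
    unfolding matrix_inv_def by (rule someI_ex)
  then show "A ** matrix_inv A = mat 1" "matrix_inv A ** A = mat 1" by auto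
qed

lemma matrix_inv_unique:
  fixes A :: "real ^ 'n::finite ^ 'n"
  assumes "A ** B = mat 1"
  shows "matrix_inv A = B"
proof -
  have "det A * det B = 1" using assms by (metis det_I det_mul)
  then have "det A \<noteq> 0" by auto
  then have "matrix_inv A = matrix_inv A ** (A ** B)" by (simp add: assms)
  also have "\<dots> = B" using matrix_inv_mult(2)[OF \<open>det A \<noteq> 0\<close>] by (simp add: matrix_mul_assoc)
  finally show ?thesis .
qed

text \<open>
  Cramer's rule. Its use is that it writes the inverse with determinants only, hence as an expression
  whose regularity is that of the entries.
\<close>
lemma matrix_inv_component:
  fixes A :: "real ^ 'n::finite ^ 'n"
  assumes "det A \<noteq> 0"
  shows "matrix_inv A $ i $ j = det (\<chi> k l. if l = i then axis j 1 $ k else A $ k $ l) / det A"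
proof -
  have "A *v (matrix_inv A *v axis j 1) = axis j 1"
    by (simp add: matrix_vector_mul_assoc matrix_inv_mult[OF assms])
  then have "matrix_inv A *v axis j 1 = (\<chi> k. det (\<chi> i l. if l = k then axis j 1 $ i else A $ i $ l) / det A)"
    using cramer[OF assms] by blast
  then have "(matrix_inv A *v axis j 1) $ i = det (\<chi> k l. if l = i then axis j 1 $ k else A $ k $ l) / det A"
    by simp
  moreover have "(matrix_inv A *v axis j 1) $ i = matrix_inv A $ i $ j"
    by (simp add: matrix_vector_mult_basis column_def)
  ultimately show ?thesis by simp
qed

lemma C1_on_det:
  fixes A :: "'a::real_normed_vector \<Rightarrow> real ^ 'n::finite ^ 'n"
  assumes "\<And>i j. C1_on (\<lambda>x. A x $ i $ j) S"
  shows "C1_on (\<lambda>x. det (A x)) S"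
  unfolding det_def by (intro C1_on_sum C1_on_mult C1_on_const C1_on_prod assms)

lemma C1_on_matrix_inv:
  fixes A :: "'a::real_normed_vector \<Rightarrow> real ^ 'n::finite ^ 'n"
  assumes "open S" "\<And>i j. C1_on (\<lambda>x. A x $ i $ j) S" "\<And>x. x \<in> S \<Longrightarrow> det (A x) \<noteq> 0"
  shows "C1_on (\<lambda>x. matrix_inv (A x) $ i $ j) S"
proof (rule C1_on_cong[OF assms(1)])
  show "C1_on (\<lambda>x. det (\<chi> k l. if l = i then axis j 1 $ k else A x $ k $ l) * inverse (det (A x))) S"
  proof (intro C1_on_mult C1_on_inverse C1_on_det assms)
    show "C1_on (\<lambda>x. (\<chi> k l. if l = i then axis j 1 $ k else A x $ k $ l) $ ia $ ja) S" for ia ja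
      using assms(2)[of ia ja] C1_on_const[of "axis j 1 $ ia" S]
      by (cases "ja = i") (simp_all del: Ck_on.simps)
  qed
qed (simp add: matrix_inv_component assms(3) field_simps)

text \<open>
  In the derivative of the sum over permutations, each term loses one factor. A permutation other than
  the identity moves at least two indices, so a vanishing off-diagonal factor remains and only the
  trace survives.
\<close>
lemma has_derivative_det_at_identity:
  fixes B :: "'a::real_normed_vector \<Rightarrow> real ^ 'n::finite ^ 'n"
  assumes "\<And>i j. ((\<lambda>x. B x $ i $ j) has_derivative B' i j) (at x)" "B x = mat 1"
  shows "((\<lambda>x. det (B x)) has_derivative (\<lambda>v. \<Sum>i\<in>UNIV. B' i i v)) (at x)"
proof -
  let ?P = "{p. p permutes (UNIV :: 'n set)}"
  have "((\<lambda>x. \<Sum>p\<in>?P. of_int (sign p) * (\<Prod>i\<in>UNIV. B x $ i $ p i)) has_derivative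
      (\<lambda>v. \<Sum>p\<in>?P. of_int (sign p) * (\<Sum>i\<in>UNIV. B' i (p i) v * (\<Prod>j\<in>UNIV - {i}. B x $ j $ p j)))) (at x)"
    by (intro has_derivative_sum has_derivative_mult_right has_derivative_prod assms(1))
  moreover have "(\<Sum>p\<in>?P. of_int (sign p) * (\<Sum>i\<in>UNIV. B' i (p i) v * (\<Prod>j\<in>UNIV - {i}. B x $ j $ p j)))
      = (\<Sum>i\<in>UNIV. B' i i v)" for v
  proof -
    \<comment> \<open>a permutation other than the identity moves two indices\<close>
    have zero: "(\<Sum>i\<in>UNIV. B' i (p i) v * (\<Prod>j\<in>UNIV - {i}. B x $ j $ p j)) = 0" if p: "p \<in> ?P - {id}" for p
    proof (rule sum.neutral, rule ballI)
      fix i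
      obtain k where k: "p k \<noteq> k" using p by (auto simp: fun_eq_iff)
      have "bij p" using p permutes_bij by blast
      then have "p (p k) \<noteq> p k" using k by (auto dest: bij_is_inj simp: inj_eq)
      then obtain j where "j \<noteq> i" "p j \<noteq> j" using k by metis
      then have "(\<Prod>j\<in>UNIV - {i}. B x $ j $ p j) = 0"
        using assms(2) by (intro prod_zero bexI[of _ j]) (auto simp: mat_def)
      then show "B' i (p i) v * (\<Prod>j\<in>UNIV - {i}. B x $ j $ p j) = 0" by simp
    qed
    have "(\<Sum>p\<in>?P. of_int (sign p) * (\<Sum>i\<in>UNIV. B' i (p i) v * (\<Prod>j\<in>UNIV - {i}. B x $ j $ p j)))
       = (\<Sum>p\<in>{id}. of_int (sign p) * (\<Sum>i\<in>UNIV. B' i (p i) v * (\<Prod>j\<in>UNIV - {i}. B x $ j $ p j)))"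
      using zero by (intro sum.mono_neutral_right) (auto simp: permutes_id)
    also have "\<dots> = (\<Sum>i\<in>UNIV. B' i i v)"
      using assms(2) by (simp add: sign_id mat_def)
    finally show ?thesis .
  qed
  ultimately show ?thesis by (simp add: det_def)
qed

text \<open>
  Jacobi's formula, obtained from the case of the identity by factoring out the matrix at the base point.
\<close>
lemma has_derivative_det:
  fixes A :: "'a::real_normed_vector \<Rightarrow> real ^ 'n::finite ^ 'n"
  assumes "\<And>i j. ((\<lambda>x. A x $ i $ j) has_derivative A' i j) (at x)" "det (A x) \<noteq> 0"
  shows "((\<lambda>x. det (A x)) has_derivative
    (\<lambda>v. det (A x) * (\<Sum>i\<in>UNIV. \<Sum>j\<in>UNIV. matrix_inv (A x) $ i $ j * A' j i v))) (at x)"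
proof -
  let ?I = "matrix_inv (A x)"
  have "((\<lambda>y. (?I ** A y) $ i $ j) has_derivative (\<lambda>v. \<Sum>k\<in>UNIV. ?I $ i $ k * A' k j v)) (at x)" for i j
    by (auto simp: matrix_matrix_mult_def intro!: has_derivative_sum has_derivative_mult_right assms(1))
  then have "((\<lambda>y. det (?I ** A y)) has_derivative (\<lambda>v. \<Sum>i\<in>UNIV. \<Sum>k\<in>UNIV. ?I $ i $ k * A' k i v)) (at x)"
    by (rule has_derivative_det_at_identity) (simp add: matrix_inv_mult[OF assms(2)])
  then have "((\<lambda>y. det (A x) * det (?I ** A y)) has_derivative
      (\<lambda>v. det (A x) * (\<Sum>i\<in>UNIV. \<Sum>k\<in>UNIV. ?I $ i $ k * A' k i v))) (at x)"
    by (rule has_derivative_mult_right)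
  moreover have "det (A x) * det (?I ** A y) = det (A y)" for y
    by (metis det_mul det_I matrix_inv_mult(1)[OF assms(2)] mult.assoc mult_1)
  ultimately show ?thesis by simp
qed

section \<open>Rules for partial derivatives\<close>
lemma C1_on_differentiable: "C1_on f S \<Longrightarrow> x \<in> S \<Longrightarrow> f differentiable (at x)"
  by simp

lemma partial_eqI: "(f has_derivative D) (at u) \<Longrightarrow> partial i f u = D (axis i 1)"
  unfolding partial_def by (simp add: frechet_derivative_at[symmetric])

lemma partial_cong_open:
  assumes "open S" "x \<in> S" "\<And>y. y \<in> S \<Longrightarrow> f y = g y"
  shows "partial i f x = partial i g x"
  unfolding partial_def using frechet_derivative_cong_open[OF assms] by simp

lemma partial_bounded_bilinear:
  assumes "bounded_bilinear bil" "f differentiable (at u)" "g differentiable (at u)"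
  shows "partial i (\<lambda>x. bil (f x) (g x)) u = bil (f u) (partial i g u) + bil (partial i f u) (g u)"
proof -
  have "(f has_derivative frechet_derivative f (at u)) (at u)" "(g has_derivative frechet_derivative g (at u)) (at u)"
    using assms frechet_derivative_works by blast+
  from bounded_bilinear.FDERIV[OF assms(1) this]
  show ?thesis by (subst partial_eqI) (auto simp: partial_def)
qed

lemmas partial_mult = partial_bounded_bilinear[OF bounded_bilinear_mult]
lemmas partial_inner = partial_bounded_bilinear[OF bounded_bilinear_inner]

lemma partial_const [simp]: "partial i (\<lambda>x. c) u = 0"
  by (subst partial_eqI[OF has_derivative_const]) simp

lemma partial_sum:
  assumes "\<And>k. k \<in> K \<Longrightarrow> f k differentiable (at u)"
  shows "partial i (\<lambda>x. \<Sum>k\<in>K. f k x) u = (\<Sum>k\<in>K. partial i (f k) u)"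
proof -
  have "((\<lambda>x. \<Sum>k\<in>K. f k x) has_derivative (\<lambda>v. \<Sum>k\<in>K. frechet_derivative (f k) (at u) v)) (at u)"
    using assms by (intro has_derivative_sum) (simp add: frechet_derivative_works[symmetric])
  then show ?thesis by (subst partial_eqI) (auto simp: partial_def)
qed

lemma continuous_on_partial: "C1_on f S \<Longrightarrow> continuous_on S (partial i f)"
  unfolding partial_def[abs_def] by (rule C1_on_continuous_derivative)

section \<open>Geometry of an immersed patch\<close>

text \<open>
  The determinant does not vanish along the segment from the identity to \<open>A\<close>, since all matrices on
  it are positive definite; so it keeps the sign that it has at the identity.
\<close>
lemma det_pos_if_positive_definite:
  fixes A :: "real ^ 'n::finite ^ 'n"
  assumes pd: "\<And>v. v \<noteq> 0 \<Longrightarrow> v \<bullet> (A *v v) > 0"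
  shows "det A > 0"
proof (rule ccontr)
  assume neg: "\<not> det A > 0"
  let ?M = "\<lambda>t::real. (1 - t) *\<^sub>R mat 1 + t *\<^sub>R A"
  have "continuous_on {0..1} (\<lambda>t. det (?M t))"
    unfolding det_def by (intro continuous_intros)
  then obtain t where t: "0 \<le> t" "t \<le> 1" "det (?M t) = 0"
    using IVT2'[of "\<lambda>t. det (?M t)" 1 0 0] neg by auto
  then obtain v where v: "v \<noteq> 0" "?M t *v v = 0"
    using matrix_left_invertible_ker[of "?M t"] invertible_left_inverse[of "?M t"] invertible_det_nz[of "?M t"]
    by auto
  have "0 = v \<bullet> (?M t *v v)" using v by simp
  also have "\<dots> = (1 - t) * (v \<bullet> v) + t * (v \<bullet> (A *v v))"
    by (simp add: matrix_vector_mult_add_rdistrib inner_add_right scaleR_matrix_vector_assoc[symmetric])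
  also have "\<dots> > 0"
    using pd[OF v(1)] t v(1) by (cases "t = 0") (auto intro!: add_nonneg_pos mult_nonneg_nonneg)
  finally show False by simp
qed

text \<open>
  Two derivatives suffice for everything that follows: the metric and its inverse are then continuously
  differentiable.
\<close>
locale immersed_patch =
  fixes X :: "real ^ 'n::finite \<Rightarrow> real ^ 'k::finite" and U :: "(real ^ 'n) set"
  assumes open_dom: "open U"
    and C2: "Ck_on 2 X U"
    and immersion: "u \<in> U \<Longrightarrow> inj (frechet_derivative X (at u))"
begin

lemma C1: "C1_on X U" by (rule C2_on_imp_C1_on[OF C2])

lemma C1_partial: "C1_on (partial i X) U" by (rule C1_on_partial[OF C2])

lemma metric_positive_definite:
  assumes "u \<in> U" "v \<noteq> 0"
  shows "v \<bullet> (metric X u *v v) > 0"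
proof -
  let ?D = "frechet_derivative X (at u)"
  have D: "?D v = (\<Sum>i\<in>UNIV. v $ i *\<^sub>R partial i X u)"
    by (rule frechet_derivative_eq_sum_partial[OF C1_on_differentiable[OF C1 assms(1)]])
  have "v \<bullet> (metric X u *v v) = ?D v \<bullet> ?D v"
    unfolding D inner_vec_def[of v] matrix_vector_mult_def metric_def inner_sum_left inner_sum_right
    by (auto simp: sum_distrib_left ac_simps intro!: sum.cong inner_commute)
  moreover have "?D v \<noteq> 0"
    using immersion[OF assms(1)] assms(2)
      linear_injective_0[OF linear_frechet_derivative[OF C1_on_differentiable[OF C1 assms(1)]]] by blast
  ultimately show ?thesis by simp
qed

lemma det_metric_pos: "u \<in> U \<Longrightarrow> det (metric X u) > 0"
  by (intro det_pos_if_positive_definite metric_positive_definite)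

lemma metric_ginv:
  assumes "u \<in> U"
  shows "(\<Sum>j\<in>UNIV. (partial i X u \<bullet> partial j X u) * ginv X u j k) = (if i = k then 1 else 0)"
    "(\<Sum>j\<in>UNIV. ginv X u i j * (partial j X u \<bullet> partial k X u)) = (if i = k then 1 else 0)"
proof -
  have "det (metric X u) \<noteq> 0" using det_metric_pos[OF assms] by simp
  note inv = matrix_inv_mult[OF this]
  show "(\<Sum>j\<in>UNIV. (partial i X u \<bullet> partial j X u) * ginv X u j k) = (if i = k then 1 else 0)"
    using arg_cong[OF inv(1), of "\<lambda>A. A $ i $ k"] by (simp add: matrix_matrix_mult_def ginv_def metric_def mat_def)
  show "(\<Sum>j\<in>UNIV. ginv X u i j * (partial j X u \<bullet> partial k X u)) = (if i = k then 1 else 0)"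
    using arg_cong[OF inv(2), of "\<lambda>A. A $ i $ k"] by (simp add: matrix_matrix_mult_def ginv_def metric_def mat_def)
qed

lemma ginv_symmetric:
  assumes "u \<in> U"
  shows "ginv X u i j = ginv X u j i"
proof -
  have "det (metric X u) \<noteq> 0" using det_metric_pos[OF assms] by simp
  have tr: "transpose (metric X u) = metric X u"
    by (simp add: transpose_def metric_def inner_commute)
  have "metric X u ** transpose (matrix_inv (metric X u)) = mat 1"
    by (metis tr \<open>det (metric X u) \<noteq> 0\<close> matrix_inv_mult(2) matrix_transpose_mul transpose_mat)
  then have "matrix_inv (metric X u) = transpose (matrix_inv (metric X u))"
    by (rule matrix_inv_unique)
  then have "matrix_inv (metric X u) $ i $ j = transpose (matrix_inv (metric X u)) $ i $ j" by simp
  then show ?thesis by (simp add: ginv_def transpose_def)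
qed

lemma C1_metric: "C1_on (\<lambda>u. metric X u $ i $ j) U"
  unfolding metric_def using C1_on_inner[OF C1_partial C1_partial] by simp

lemma C1_ginv: "C1_on (\<lambda>u. ginv X u i j) U"
  unfolding ginv_def by (rule C1_on_matrix_inv[OF open_dom C1_metric]) (use det_metric_pos in force)

lemma C1_sqrt_det_metric: "C1_on (\<lambda>u. sqrt (det (metric X u))) U"
  by (intro C1_on_sqrt C1_on_det C1_metric det_metric_pos)

lemma C1_gradient:
  assumes "Ck_on 2 f U"
  shows "C1_on (gradient X f) U"
  unfolding gradient_def[abs_def]
  by (intro C1_on_sum C1_on_scaleR C1_on_mult C1_ginv C1_partial C1_on_partial assms)

lemma inner_gradient_right:
  "u \<in> U \<Longrightarrow> v \<bullet> gradient X f u = (\<Sum>i\<in>UNIV. \<Sum>j\<in>UNIV. ginv X u i j * ((v \<bullet> partial i X u) * partial j f u))"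
  unfolding gradient_def by (simp add: inner_sum_right ac_simps)

text \<open>
  Raising an index and lowering it again. The order of the factors is the one in which the tangential
  projection and the gradient are written out.
\<close>
lemma ginv_contract:
  assumes "u \<in> U"
  shows "(\<Sum>i\<in>UNIV. \<Sum>j\<in>UNIV. ginv X u i j * ((partial k X u \<bullet> partial i X u) * c j)) = c k"
proof -
  have "(\<Sum>i\<in>UNIV. \<Sum>j\<in>UNIV. ginv X u i j * ((partial k X u \<bullet> partial i X u) * c j))
     = (\<Sum>j\<in>UNIV. (\<Sum>i\<in>UNIV. (partial k X u \<bullet> partial i X u) * ginv X u i j) * c j)"
    by (subst sum.swap) (simp add: sum_distrib_left sum_distrib_right ac_simps)
  also have "\<dots> = (\<Sum>j\<in>UNIV. (if k = j then c j else 0))"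
    by (rule sum.cong) (simp_all add: metric_ginv(1)[OF assms])
  finally show ?thesis by simp
qed

lemma partial_inner_gradient:
  assumes "u \<in> U"
  shows "partial k X u \<bullet> gradient X f u = partial k f u"
  using ginv_contract[OF assms, of k "\<lambda>j. partial j f u"] by (simp add: inner_gradient_right[OF assms])

lemma gradient_inner_gradient:
  assumes "u \<in> U"
  shows "gradient X f u \<bullet> gradient X h u = (\<Sum>i\<in>UNIV. \<Sum>j\<in>UNIV. ginv X u i j * (partial i f u * partial j h u))"
  using inner_gradient_right[OF assms, of "gradient X f u" h] partial_inner_gradient[OF assms, of _ f]
  by (simp add: inner_commute)

lemma partial_inner_normal_component:
  assumes "u \<in> U"
  shows "partial k X u \<bullet> normal_component X u v = 0"
  using ginv_contract[OF assms, of k "\<lambda>j. v \<bullet> partial j X u"]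
  unfolding normal_component_def by (simp add: inner_diff_right inner_sum_right inner_commute ac_simps)

text \<open>
  The normal projection is self-adjoint and idempotent.
\<close>
lemma normal_component_inner:
  assumes "u \<in> U"
  shows "normal_component X u v \<bullet> normal_component X u w = normal_component X u v \<bullet> w"
  using partial_inner_normal_component[OF assms, of _ v]
  by (simp add: normal_component_def[of X u w] inner_diff_right inner_sum_right inner_commute)

text \<open>
  Differentiating \<open>\<langle>\<nabla>f, \<partial>\<^sub>jX\<rangle> = \<partial>\<^sub>jf\<close> trades the derivative of the gradient, in which the inverse metric
  would have to be differentiated, for second derivatives of \<open>f\<close> and of \<open>X\<close>.
\<close>
lemma laplacian_eq_contracted_hessian:
  assumes f: "Ck_on 2 f U" and u: "u \<in> U"
  shows "laplacian X f u = (\<Sum>i\<in>UNIV. \<Sum>j\<in>UNIV. ginv X u i j *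
      (partial i (partial j f) u - gradient X f u \<bullet> partial i (partial j X) u))"
proof -
  have "partial i (gradient X f) u \<bullet> partial j X u
      = partial i (partial j f) u - gradient X f u \<bullet> partial i (partial j X) u" for i j
  proof -
    have "partial i (partial j f) u = partial i (\<lambda>x. gradient X f x \<bullet> partial j X x) u"
      by (rule partial_cong_open[OF open_dom u]) (metis partial_inner_gradient inner_commute)
    also have "\<dots> = gradient X f u \<bullet> partial i (partial j X) u + partial i (gradient X f) u \<bullet> partial j X u"
      by (intro partial_inner C1_on_differentiable[OF _ u] C1_gradient f C1_partial)
    finally show ?thesis by simp
  qed
  then show ?thesis by (simp add: laplacian_def divergence_def)
qed

text \<open>
  Jacobi's formula for the metric. Since \<open>\<partial>\<^sub>k\<partial>\<^sub>iX = \<partial>\<^sub>i\<partial>\<^sub>kX\<close>, the two summands of \<open>\<partial>\<^sub>kg\<^sub>i\<^sub>j\<close> contribute equally,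
  which cancels the factor one half from the square root.
\<close>
lemma partial_sqrt_det_metric:
  assumes u: "u \<in> U"
  shows "partial k (\<lambda>u. sqrt (det (metric X u))) u = sqrt (det (metric X u)) *
    (\<Sum>i\<in>UNIV. \<Sum>j\<in>UNIV. ginv X u i j * (partial i (partial k X) u \<bullet> partial j X u))"
proof -
  let ?g = "\<lambda>i j v. frechet_derivative (\<lambda>u. metric X u $ i $ j) (at u) v"
  have pos: "det (metric X u) > 0" by (rule det_metric_pos[OF u])
  have *: "?g i j (axis k 1) = partial i X u \<bullet> partial j (partial k X) u + partial i (partial k X) u \<bullet> partial j X u" for i j
  proof -
    have "?g i j (axis k 1) = partial k (\<lambda>u. partial i X u \<bullet> partial j X u) u"
      by (simp add: partial_def metric_def)
    also have "\<dots> = partial i X u \<bullet> partial k (partial j X) u + partial k (partial i X) u \<bullet> partial j X u"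
      by (intro partial_inner C1_on_differentiable[OF _ u] C1_partial)
    finally show ?thesis by (simp add: partial_commute[OF C2 open_dom u, of k])
  qed
  let ?S = "\<Sum>i\<in>UNIV. \<Sum>j\<in>UNIV. ginv X u i j * (partial i (partial k X) u \<bullet> partial j X u)"
  have "((\<lambda>u. det (metric X u)) has_derivative
      (\<lambda>v. det (metric X u) * (\<Sum>i\<in>UNIV. \<Sum>j\<in>UNIV. matrix_inv (metric X u) $ i $ j * ?g j i v))) (at u)"
    by (intro has_derivative_det C1_on_has_derivative[OF _ u] C1_metric) (use pos in simp)
  then have "((\<lambda>u. sqrt (det (metric X u))) has_derivative
      (\<lambda>v. (det (metric X u) * (\<Sum>i\<in>UNIV. \<Sum>j\<in>UNIV. matrix_inv (metric X u) $ i $ j * ?g j i v)) * (inverse (sqrt (det (metric X u))) / 2))) (at u)"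
    using pos by (auto intro!: derivative_eq_intros simp: field_simps)
  then have "partial k (\<lambda>u. sqrt (det (metric X u))) u =
      (det (metric X u) * (\<Sum>i\<in>UNIV. \<Sum>j\<in>UNIV. ginv X u i j * ?g j i (axis k 1))) * (inverse (sqrt (det (metric X u))) / 2)"
    by (subst partial_eqI) (auto simp: ginv_def)
  also have "(\<Sum>i\<in>UNIV. \<Sum>j\<in>UNIV. ginv X u i j * ?g j i (axis k 1)) =
     (\<Sum>i\<in>UNIV. \<Sum>j\<in>UNIV. ginv X u i j * (partial j X u \<bullet> partial i (partial k X) u)) +
     (\<Sum>i\<in>UNIV. \<Sum>j\<in>UNIV. ginv X u i j * (partial j (partial k X) u \<bullet> partial i X u))"
    unfolding * by (simp add: distrib_left sum.distrib)
  also have "(\<Sum>i\<in>UNIV. \<Sum>j\<in>UNIV. ginv X u i j * (partial j (partial k X) u \<bullet> partial i X u)) = ?S"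
    by (subst sum.swap) (simp add: ginv_symmetric[OF u])
  also have "(\<Sum>i\<in>UNIV. \<Sum>j\<in>UNIV. ginv X u i j * (partial j X u \<bullet> partial i (partial k X) u)) = ?S"
    by (simp add: inner_commute)
  also have "(det (metric X u) * (?S + ?S)) * (inverse (sqrt (det (metric X u))) / 2) = sqrt (det (metric X u)) * ?S"
    using pos real_sqrt_mult_self[of "det (metric X u)"] by (simp add: field_simps)
  finally show ?thesis .
qed

text \<open>
  The components \<open>w\<^sup>k\<close> of the gradient satisfy \<open>\<Sum>\<^sub>k g\<^sub>j\<^sub>k w\<^sup>k = \<partial>\<^sub>jf\<close>. Differentiating this identity and
  contracting with the inverse metric compares the coordinate divergence of \<open>w\<close> with the Laplacian;
  the remainder is precisely the logarithmic derivative of the volume density.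
\<close>
lemma sum_partial_coordinate_gradient:
  assumes f: "Ck_on 2 f U" and u: "u \<in> U"
  shows "(\<Sum>i\<in>UNIV. partial i (\<lambda>u. \<Sum>j\<in>UNIV. ginv X u i j * partial j f u) u) =
     laplacian X f u - (\<Sum>k\<in>UNIV. (\<Sum>j\<in>UNIV. ginv X u k j * partial j f u) *
        (\<Sum>i\<in>UNIV. \<Sum>j\<in>UNIV. ginv X u i j * (partial i (partial k X) u \<bullet> partial j X u)))"
proof -
  let ?G = "ginv X u"
  define w where "w k u = (\<Sum>j\<in>UNIV. ginv X u k j * partial j f u)" for k u
  have C1w: "C1_on (w k) U" for k
    unfolding w_def[abs_def] by (intro C1_on_sum C1_on_mult C1_ginv C1_on_partial f)
  have C1g: "C1_on (\<lambda>u. partial j X u \<bullet> partial k X u) U" for j k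
    by (intro C1_on_inner C1_partial)
  have grad: "gradient X f u = (\<Sum>k\<in>UNIV. w k u *\<^sub>R partial k X u)"
    by (simp add: gradient_def w_def scaleR_sum_left)
  have lower: "(\<Sum>k\<in>UNIV. (partial j X x \<bullet> partial k X x) * w k x) = partial j f x" if "x \<in> U" for j x
    using ginv_contract[OF that, of j "\<lambda>j. partial j f x"]
    by (simp add: w_def sum_distrib_left ac_simps)
  have hess: "partial i (partial j f) u = (\<Sum>k\<in>UNIV. (partial j X u \<bullet> partial k X u) * partial i (w k) u)
      + (\<Sum>k\<in>UNIV. (partial j X u \<bullet> partial i (partial k X) u + partial i (partial j X) u \<bullet> partial k X u) * w k u)" for i j
  proof -
    have "partial i (partial j f) u = partial i (\<lambda>x. \<Sum>k\<in>UNIV. (partial j X x \<bullet> partial k X x) * w k x) u"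
      by (rule partial_cong_open[OF open_dom u]) (simp add: lower)
    also have "\<dots> = (\<Sum>k\<in>UNIV. partial i (\<lambda>x. (partial j X x \<bullet> partial k X x) * w k x) u)"
      by (intro partial_sum C1_on_differentiable[OF _ u] C1_on_mult C1g C1w)
    also have "\<dots> = (\<Sum>k\<in>UNIV. (partial j X u \<bullet> partial k X u) * partial i (w k) u
        + partial i (\<lambda>x. partial j X x \<bullet> partial k X x) u * w k u)"
      by (intro sum.cong refl partial_mult C1_on_differentiable[OF _ u] C1g C1w)
    also have "\<dots> = (\<Sum>k\<in>UNIV. (partial j X u \<bullet> partial k X u) * partial i (w k) u
        + (partial j X u \<bullet> partial i (partial k X) u + partial i (partial j X) u \<bullet> partial k X u) * w k u)"
      by (intro sum.cong refl arg_cong2[where f=plus] arg_cong2[where f=times] partial_inner C1_on_differentiable[OF _ u] C1_partial)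
    finally show ?thesis by (simp add: sum.distrib)
  qed
  have "laplacian X f u = (\<Sum>i\<in>UNIV. \<Sum>j\<in>UNIV. ?G i j *
      (partial i (partial j f) u - (\<Sum>k\<in>UNIV. (partial i (partial j X) u \<bullet> partial k X u) * w k u)))"
  proof -
    have "gradient X f u \<bullet> p = (\<Sum>k\<in>UNIV. (p \<bullet> partial k X u) * w k u)" for p
      unfolding grad inner_sum_left by (simp add: inner_commute[of p] mult.commute)
    then show ?thesis unfolding laplacian_eq_contracted_hessian[OF f u] by simp
  qed
  also have "\<dots> = (\<Sum>i\<in>UNIV. \<Sum>j\<in>UNIV. ?G i j *
      ((\<Sum>k\<in>UNIV. (partial j X u \<bullet> partial k X u) * partial i (w k) u) + (\<Sum>k\<in>UNIV. (partial j X u \<bullet> partial i (partial k X) u) * w k u)))"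
    unfolding hess by (simp add: distrib_right sum.distrib)
  also have "\<dots> = (\<Sum>i\<in>UNIV. \<Sum>j\<in>UNIV. ?G i j * (\<Sum>k\<in>UNIV. (partial j X u \<bullet> partial k X u) * partial i (w k) u))
     + (\<Sum>i\<in>UNIV. \<Sum>j\<in>UNIV. ?G i j * (\<Sum>k\<in>UNIV. (partial j X u \<bullet> partial i (partial k X) u) * w k u))"
    by (simp add: distrib_left sum.distrib)
  also have "(\<Sum>i\<in>UNIV. \<Sum>j\<in>UNIV. ?G i j * (\<Sum>k\<in>UNIV. (partial j X u \<bullet> partial k X u) * partial i (w k) u))
      = (\<Sum>i\<in>UNIV. partial i (w i) u)"
  proof (rule sum.cong[OF refl])
    fix i
    have "(\<Sum>j\<in>UNIV. ?G i j * (\<Sum>k\<in>UNIV. (partial j X u \<bullet> partial k X u) * partial i (w k) u))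
       = (\<Sum>k\<in>UNIV. (\<Sum>j\<in>UNIV. ?G i j * (partial j X u \<bullet> partial k X u)) * partial i (w k) u)"
      by (simp add: sum_distrib_left sum_distrib_right mult.assoc) (rule sum.swap)
    also have "\<dots> = (\<Sum>k\<in>UNIV. if i = k then partial i (w k) u else 0)"
      by (rule sum.cong) (simp_all add: metric_ginv(2)[OF u])
    finally show "(\<Sum>j\<in>UNIV. ?G i j * (\<Sum>k\<in>UNIV. (partial j X u \<bullet> partial k X u) * partial i (w k) u)) = partial i (w i) u"
      by simp
  qed
  also have "(\<Sum>i\<in>UNIV. \<Sum>j\<in>UNIV. ?G i j * (\<Sum>k\<in>UNIV. (partial j X u \<bullet> partial i (partial k X) u) * w k u))
     = (\<Sum>i\<in>UNIV. \<Sum>k\<in>UNIV. \<Sum>j\<in>UNIV. w k u * (?G i j * (partial i (partial k X) u \<bullet> partial j X u)))"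
    by (rule sum.cong[OF refl], subst sum.swap) (simp add: sum_distrib_left inner_commute ac_simps)
  also have "\<dots> = (\<Sum>k\<in>UNIV. w k u * (\<Sum>i\<in>UNIV. \<Sum>j\<in>UNIV. ?G i j * (partial i (partial k X) u \<bullet> partial j X u)))"
    by (subst sum.swap) (simp add: sum_distrib_left)
  finally show ?thesis by (simp add: w_def[abs_def])
qed

end

text \<open>
  The divergence of the tangential field \<open>a \<nabla>b\<close>.
\<close>
definition green_density ::
  "(real ^ 'n::finite \<Rightarrow> real ^ 'k::finite) \<Rightarrow> (real ^ 'n \<Rightarrow> real) \<Rightarrow> (real ^ 'n \<Rightarrow> real) \<Rightarrow> real ^ 'n \<Rightarrow> real" where
  "green_density X a b u = a u * laplacian X b u + gradient X a u \<bullet> gradient X b u"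

context immersed_patch
begin

lemma C1_coordinate_flux:
  assumes a: "C1_on a U" and b: "Ck_on 2 b U"
  shows "C1_on (\<lambda>u. (sqrt (det (metric X u)) * a u) * (\<Sum>j\<in>UNIV. ginv X u i j * partial j b u)) U"
  by (intro C1_on_mult C1_on_sum C1_sqrt_det_metric C1_ginv C1_on_partial a b)

text \<open>
  The classical formula \<open>div V = (det g)\<^sup>-\<^sup>1\<^sup>/\<^sup>2 \<Sum>\<^sub>i \<partial>\<^sub>i ((det g)\<^sup>1\<^sup>/\<^sup>2 V\<^sup>i)\<close> for \<open>V = a \<nabla>b\<close>: the derivative of the
  density is the term that the previous comparison of divergences leaves over.
\<close>
lemma green_density_divergence_form:
  assumes a: "C1_on a U" and b: "Ck_on 2 b U" and u: "u \<in> U"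
  shows "(\<Sum>i\<in>UNIV. partial i (\<lambda>u. (sqrt (det (metric X u)) * a u) * (\<Sum>j\<in>UNIV. ginv X u i j * partial j b u)) u)
     = sqrt (det (metric X u)) * green_density X a b u"
proof -
  let ?s = "\<lambda>u. sqrt (det (metric X u))" and ?w = "\<lambda>i u. \<Sum>j\<in>UNIV. ginv X u i j * partial j b u"
  let ?S = "\<lambda>k. \<Sum>i\<in>UNIV. \<Sum>j\<in>UNIV. ginv X u i j * (partial i (partial k X) u \<bullet> partial j X u)"
  have C1w: "C1_on (?w i) U" for i
    by (intro C1_on_sum C1_on_mult C1_ginv C1_on_partial b)
  have "partial i (\<lambda>u. (?s u * a u) * ?w i u) u
      = ?s u * (a u * partial i (?w i) u + partial i a u * ?w i u + a u * (?w i u * ?S i))" for i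
  proof -
    have "partial i (\<lambda>u. (?s u * a u) * ?w i u) u = (?s u * a u) * partial i (?w i) u + partial i (\<lambda>u. ?s u * a u) u * ?w i u"
      by (intro partial_mult C1_on_differentiable[OF _ u] C1_on_mult C1_sqrt_det_metric a C1w)
    also have "partial i (\<lambda>u. ?s u * a u) u = ?s u * partial i a u + partial i ?s u * a u"
      by (intro partial_mult C1_on_differentiable[OF _ u] C1_sqrt_det_metric a)
    finally show ?thesis by (simp add: partial_sqrt_det_metric[OF u] algebra_simps)
  qed
  then have "(\<Sum>i\<in>UNIV. partial i (\<lambda>u. (?s u * a u) * ?w i u) u)
     = ?s u * (a u * (\<Sum>i\<in>UNIV. partial i (?w i) u) + (\<Sum>i\<in>UNIV. partial i a u * ?w i u) + a u * (\<Sum>i\<in>UNIV. ?w i u * ?S i))"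
    by (simp add: sum.distrib sum_distrib_left distrib_left)
  also have "(\<Sum>i\<in>UNIV. partial i a u * ?w i u) = gradient X a u \<bullet> gradient X b u"
    unfolding gradient_inner_gradient[OF u] by (simp add: sum_distrib_left ac_simps)
  finally show ?thesis
    unfolding sum_partial_coordinate_gradient[OF b u] green_density_def by (simp add: algebra_simps)
qed

lemma mean_curv_vec_orthogonal: "u \<in> U \<Longrightarrow> mean_curv_vec X u \<bullet> partial k X u = 0"
  unfolding mean_curv_vec_def second_ff_def
  by (subst inner_commute) (simp add: inner_sum_right partial_inner_normal_component)

text \<open>
  In codimension one the unit normal and the tangent space span the ambient space, so the mean curvature
  vector, being normal, is a multiple of the unit normal. This also shows that a unit normal and a mean
  curvature as selected by their definitions exist.
\<close>
lemma mean_curv_square: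
  assumes u: "u \<in> U" and codim: "CARD('k) = CARD('n) + 1"
  shows "(mean_curv X u)\<^sup>2 = (norm (mean_curv_vec X u))\<^sup>2"
proof -
  let ?D = "frechet_derivative X (at u)"
  have lin: "linear ?D" by (rule linear_frechet_derivative[OF C1_on_differentiable[OF C1 u]])
  have D: "?D v = (\<Sum>i\<in>UNIV. v $ i *\<^sub>R partial i X u)" for v
    by (rule frechet_derivative_eq_sum_partial[OF C1_on_differentiable[OF C1 u]])
  have dim: "dim (range ?D) = CARD('n)"
    using dim_image_eq[OF lin, of UNIV] immersion[OF u] by (simp add: dim_UNIV)
  obtain y where y: "y \<noteq> 0" "\<And>z. z \<in> span (range ?D) \<Longrightarrow> orthogonal y z"
    using orthogonal_to_subspace_exists[of "range ?D"] dim codim by auto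
  have "y \<bullet> partial i X u = 0" for i
    using y(2)[OF span_base[of "?D (axis i 1)"]] by (simp add: partial_def orthogonal_def)
  then have "\<exists>\<nu>. norm \<nu> = 1 \<and> (\<forall>i. \<nu> \<bullet> partial i X u = 0)"
    using y(1) by (intro exI[of _ "sgn y"]) (simp add: norm_sgn sgn_div_norm)
  then have "norm (unit_normal X u) = 1 \<and> (\<forall>i. unit_normal X u \<bullet> partial i X u = 0)"
    unfolding unit_normal_def by (rule someI_ex)
  then obtain n where n: "n = unit_normal X u" "norm n = 1" "\<And>i. n \<bullet> partial i X u = 0" by blast
  have nD: "n \<bullet> ?D v = 0" for v by (simp add: D inner_sum_right n(3))
  have "n \<notin> span (range ?D)"
  proof
    assume "n \<in> span (range ?D)"
    then have "n \<in> range ?D" using span_eq_iff linear_subspace_image[OF lin subspace_UNIV] by blast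
    then obtain v where "n = ?D v" by blast
    then have "n \<bullet> n = 0" using nD[of v] by simp
    then show False using n(2) by simp
  qed
  then have "dim (insert n (range ?D)) = DIM(real ^ 'k)"
    using dim codim by (simp add: dim_insert)
  then have full: "span (insert n (range ?D)) = UNIV" using dim_eq_full by blast
  let ?H = "mean_curv_vec X u"
  \<comment> \<open>the part of the mean curvature vector orthogonal to the normal; it is orthogonal to everything\<close>
  define z where "z = ?H - (?H \<bullet> n) *\<^sub>R n"
  have zn: "z \<bullet> n = 0" using n(2) by (simp add: z_def inner_diff_left norm_eq_1)
  have zD: "z \<bullet> ?D v = 0" for v
    by (simp add: z_def inner_diff_left D inner_sum_right n(3) mean_curv_vec_orthogonal[OF u])
  have "z \<bullet> w = 0" if "w \<in> span (insert n (range ?D))" for w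
    using that by (induction rule: span_induct_alt) (auto simp: inner_add_right zn zD)
  then have "z \<bullet> z = 0" using full by blast
  then have H: "?H = (?H \<bullet> n) *\<^sub>R n" by (simp add: z_def)
  have "mean_curv X u = - (?H \<bullet> n)"
    unfolding mean_curv_def n(1)[symmetric]
  proof (rule the_equality)
    show "?H = - (- (?H \<bullet> n) *\<^sub>R n)" using H by simp
    fix h assume "?H = - (h *\<^sub>R n)"
    then show "h = - (?H \<bullet> n)" using n(2) by (simp add: norm_eq_1)
  qed
  moreover have "norm ?H = \<bar>?H \<bullet> n\<bar>"
    using arg_cong[OF H, of norm] n(2) by simp
  ultimately show ?thesis by simp
qed

lemma partial_square_norm_position:
  assumes "u \<in> U"
  shows "partial j (\<lambda>u. (norm (X u))\<^sup>2 / 4) u = 1/2 * (X u \<bullet> partial j X u)"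
proof -
  have "((\<lambda>u. (1/4) * (X u \<bullet> X u)) has_derivative (\<lambda>v. (1/4) * (X u \<bullet> frechet_derivative X (at u) v + frechet_derivative X (at u) v \<bullet> X u))) (at u)"
    by (intro has_derivative_mult_right has_derivative_inner C1_on_has_derivative[OF C1 assms])
  from partial_eqI[OF this, of j] show ?thesis
    by (simp add: power2_norm_eq_inner partial_def inner_commute)
qed

lemma C2_square_norm_position: "Ck_on 2 (\<lambda>u. (norm (X u))\<^sup>2 / 4) U"
proof (rule C2_onI[OF _ open_dom])
  show "((\<lambda>u. (norm (X u))\<^sup>2 / 4) has_derivative (\<lambda>v. 1/2 * (X u \<bullet> frechet_derivative X (at u) v))) (at u)" if "u \<in> U" for u
  proof -
    have "((\<lambda>u. (1/4) * (X u \<bullet> X u)) has_derivative (\<lambda>v. (1/4) * (X u \<bullet> frechet_derivative X (at u) v + frechet_derivative X (at u) v \<bullet> X u))) (at u)"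
      by (intro has_derivative_mult_right has_derivative_inner C1_on_has_derivative[OF C1 that])
    then show ?thesis
      by (simp add: power2_norm_eq_inner inner_commute)
  qed
  show "C1_on (\<lambda>u. 1/2 * (X u \<bullet> frechet_derivative X (at u) v)) U" for v
    using C2 by (intro C1_on_mult C1_on_const C1_on_inner C1) (simp add: numeral_2_eq_2)
qed

lemma gradient_square_norm_position:
  assumes "u \<in> U"
  shows "gradient X (\<lambda>u. (norm (X u))\<^sup>2 / 4) u = (1/2) *\<^sub>R (X u - normal_component X u (X u))"
  unfolding gradient_def normal_component_def partial_square_norm_position[OF assms]
  by (simp add: scaleR_sum_right ac_simps)

text \<open>
  The Hessian of \<open>|X|\<^sup>2/4\<close> contributes half the metric, whose trace is the dimension, and half of
  \<open>\<langle>X, \<partial>\<^sub>i\<partial>\<^sub>jX\<rangle>\<close>; subtracting the gradient term removes the tangential part of \<open>X\<close> from the latter, which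
  leaves the second fundamental form.
\<close>
lemma laplacian_square_norm_position:
  assumes u: "u \<in> U"
  shows "laplacian X (\<lambda>u. (norm (X u))\<^sup>2 / 4) u = real CARD('n) / 2 + 1/2 * (normal_component X u (X u) \<bullet> mean_curv_vec X u)"
proof -
  let ?h = "\<lambda>u. (norm (X u))\<^sup>2 / 4" and ?n = "normal_component X u"
  have "partial i (partial j ?h) u = 1/2 * (X u \<bullet> partial i (partial j X) u + partial i X u \<bullet> partial j X u)" for i j
  proof -
    have "partial i (partial j ?h) u = partial i (\<lambda>u. 1/2 * (X u \<bullet> partial j X u)) u"
      by (rule partial_cong_open[OF open_dom u]) (simp add: partial_square_norm_position)
    also have "\<dots> = 1/2 * partial i (\<lambda>u. X u \<bullet> partial j X u) u + partial i (\<lambda>u. 1/2) u * (X u \<bullet> partial j X u)"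
      by (intro partial_mult C1_on_differentiable[OF _ u] C1_on_inner C1_on_const C1 C1_partial)
    also have "partial i (\<lambda>u. X u \<bullet> partial j X u) u = X u \<bullet> partial i (partial j X) u + partial i X u \<bullet> partial j X u"
      by (intro partial_inner C1_on_differentiable[OF _ u] C1 C1_partial)
    finally show ?thesis by simp
  qed
  then have "partial i (partial j ?h) u - gradient X ?h u \<bullet> partial i (partial j X) u
     = 1/2 * (partial i X u \<bullet> partial j X u) + 1/2 * (?n (X u) \<bullet> second_ff X u i j)" for i j
    unfolding second_ff_def normal_component_inner[OF u] gradient_square_norm_position[OF u]
    by (simp add: inner_diff_left algebra_simps)
  then have "laplacian X ?h u = (\<Sum>i\<in>UNIV. \<Sum>j\<in>UNIV. ginv X u i j * (1/2 * (partial i X u \<bullet> partial j X u) + 1/2 * (?n (X u) \<bullet> second_ff X u i j)))"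
    unfolding laplacian_eq_contracted_hessian[OF C2_square_norm_position u] by simp
  also have "\<dots> = 1/2 * (\<Sum>i\<in>UNIV. \<Sum>j\<in>UNIV. ginv X u i j * (partial i X u \<bullet> partial j X u)) +
     1/2 * (\<Sum>i\<in>UNIV. \<Sum>j\<in>UNIV. ginv X u i j * (?n (X u) \<bullet> second_ff X u i j))"
    by (simp add: distrib_left sum.distrib sum_distrib_left)
  also have "(\<Sum>i\<in>UNIV. \<Sum>j\<in>UNIV. ginv X u i j * (partial i X u \<bullet> partial j X u)) = (\<Sum>i\<in>(UNIV::'n set). 1)"
    using metric_ginv(2)[OF u] by (intro sum.cong refl) (simp add: inner_commute)
  also have "(\<Sum>i\<in>UNIV. \<Sum>j\<in>UNIV. ginv X u i j * (?n (X u) \<bullet> second_ff X u i j)) = ?n (X u) \<bullet> mean_curv_vec X u"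
    by (simp add: mean_curv_vec_def inner_sum_right)
  finally show ?thesis by simp
qed

end

section \<open>Independence of the coordinates\<close>
abbreviation jac :: "(real ^ 'n::finite \<Rightarrow> real ^ 'm::finite) \<Rightarrow> real ^ 'n \<Rightarrow> real ^ 'n ^ 'm" where
  "jac f u \<equiv> matrix (frechet_derivative f (at u))"

definition partials :: "(real ^ 'n::finite \<Rightarrow> real) \<Rightarrow> real ^ 'n \<Rightarrow> real ^ 'n" where
  "partials f u = (\<chi> i. partial i f u)"

lemma jac_component: "jac f u $ k $ i = partial i f u $ k"
  by (simp add: matrix_def partial_def)

lemma metric_eq_jac: "metric X u = transpose (jac X u) ** jac X u"
  by (simp add: vec_eq_iff metric_def matrix_matrix_mult_def transpose_def jac_component inner_vec_def)

lemma gradient_eq_jac: "gradient X f u = jac X u *v (matrix_inv (metric X u) *v partials f u)"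
proof -
  have "gradient X f u $ k = (jac X u *v (matrix_inv (metric X u) *v partials f u)) $ k" for k
    by (simp add: gradient_def ginv_def partials_def matrix_vector_mult_def jac_component sum_distrib_left ac_simps)
  then show ?thesis by (simp add: vec_eq_iff)
qed

text \<open>
  In this form the divergence is a trace, and its invariance becomes invariance of the trace under
  conjugation.
\<close>
lemma divergence_eq_jac: "divergence X V u = trace (matrix_inv (metric X u) ** (transpose (jac X u) ** jac V u))"
  by (simp add: divergence_def ginv_def trace_def matrix_matrix_mult_def transpose_def jac_component inner_vec_def mult.commute)

lemma frechet_derivative_reparametrize:
  assumes "open S" "u \<in> S" "\<And>y. y \<in> S \<Longrightarrow> g y = f (\<tau> y)"
    and "\<tau> differentiable (at u)" "f differentiable (at (\<tau> u))"
  shows "frechet_derivative g (at u) = frechet_derivative f (at (\<tau> u)) \<circ> frechet_derivative \<tau> (at u)"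
proof -
  have "frechet_derivative g (at u) = frechet_derivative (f \<circ> \<tau>) (at u)"
    by (rule frechet_derivative_cong_open[OF assms(1,2)]) (simp add: assms(3))
  also have "((f \<circ> \<tau>) has_derivative (frechet_derivative f (at (\<tau> u)) \<circ> frechet_derivative \<tau> (at u))) (at u)"
    using assms(4,5) by (intro diff_chain_at) (simp_all add: frechet_derivative_works[symmetric])
  then have "frechet_derivative (f \<circ> \<tau>) (at u) = frechet_derivative f (at (\<tau> u)) \<circ> frechet_derivative \<tau> (at u)"
    by (simp add: frechet_derivative_at[symmetric])
  finally show ?thesis .
qed

lemma jac_reparametrize:
  assumes "open S" "u \<in> S" "\<And>y. y \<in> S \<Longrightarrow> g y = f (\<tau> y)"
    and "\<tau> differentiable (at u)" "f differentiable (at (\<tau> u))"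
  shows "jac g u = jac f (\<tau> u) ** jac \<tau> u"
  using arg_cong[OF frechet_derivative_reparametrize[where f=f and \<tau>=\<tau>, OF assms], of matrix]
    matrix_compose[OF linear_frechet_derivative[OF assms(4)] linear_frechet_derivative[OF assms(5)]]
  by simp

lemma partials_reparametrize:
  assumes "open S" "u \<in> S" "\<And>y. y \<in> S \<Longrightarrow> g y = f (\<tau> y)"
    and "\<tau> differentiable (at u)" "f differentiable (at (\<tau> u))"
  shows "partials g u = transpose (jac \<tau> u) *v partials f (\<tau> u)"
proof -
  have "partial j g u = frechet_derivative f (at (\<tau> u)) (frechet_derivative \<tau> (at u) (axis j 1))" for j
    by (simp add: partial_def frechet_derivative_reparametrize[where f=f and \<tau>=\<tau>, OF assms])
  then show ?thesis
    by (simp add: vec_eq_iff partials_def frechet_derivative_eq_sum_partial[OF assms(5)]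
        matrix_vector_mult_def transpose_def matrix_def)
qed

text \<open>
  \<open>\<tau>\<close> is a transition between two patches of the same hypersurface. Its Jacobian matrix
  \<open>J\<close> is invertible because both metrics are and they are related by \<open>J\<close>.
\<close>
locale reparametrization =
  X: immersed_patch X V + Y: immersed_patch Y S
  for X :: "real ^ 'n::finite \<Rightarrow> real ^ 'k::finite" and V Y S +
  fixes \<tau> :: "real ^ 'n \<Rightarrow> real ^ 'n"
  assumes change_differentiable: "y \<in> S \<Longrightarrow> \<tau> differentiable (at y)"
    and change_in: "y \<in> S \<Longrightarrow> \<tau> y \<in> V"
    and change: "y \<in> S \<Longrightarrow> Y y = X (\<tau> y)"
begin

lemma jac_change: "u \<in> S \<Longrightarrow> jac Y u = jac X (\<tau> u) ** jac \<tau> u"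
  by (rule jac_reparametrize[where f=X and \<tau>=\<tau>, OF Y.open_dom _ change])
    (auto intro: change_differentiable C1_on_differentiable[OF X.C1] change_in simp del: Ck_on.simps)

lemma metric_change:
  assumes "u \<in> S"
  shows "metric Y u = transpose (jac \<tau> u) ** metric X (\<tau> u) ** jac \<tau> u"
  using jac_change[OF assms] by (simp add: metric_eq_jac matrix_transpose_mul matrix_mul_assoc)

lemma det_metric_change:
  assumes "u \<in> S"
  shows "det (metric Y u) = (det (jac \<tau> u))\<^sup>2 * det (metric X (\<tau> u))"
  by (simp add: metric_change[OF assms] det_mul det_transpose power2_eq_square)

lemma sqrt_det_metric_change:
  assumes "u \<in> S"
  shows "sqrt (det (metric Y u)) = \<bar>det (jac \<tau> u)\<bar> * sqrt (det (metric X (\<tau> u)))"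
  by (simp add: det_metric_change[OF assms] real_sqrt_mult)

lemma det_jac_change_nonzero: "u \<in> S \<Longrightarrow> det (jac \<tau> u) \<noteq> 0"
  using det_metric_change[of u] Y.det_metric_pos[of u] by auto

lemma inverse_metric_change:
  assumes "u \<in> S"
  shows "matrix_inv (metric Y u) =
    matrix_inv (jac \<tau> u) ** matrix_inv (metric X (\<tau> u)) ** transpose (matrix_inv (jac \<tau> u))"
proof (rule matrix_inv_unique)
  let ?J = "jac \<tau> u" and ?g = "metric X (\<tau> u)"
  let ?K = "matrix_inv ?J"
  have det: "det ?g \<noteq> 0" using X.det_metric_pos[OF change_in[OF assms]] by simp
  have "metric Y u ** (?K ** matrix_inv ?g ** transpose ?K)
      = transpose ?J ** ?g ** (?J ** ?K) ** matrix_inv ?g ** transpose ?K"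
    by (simp add: metric_change[OF assms] matrix_mul_assoc)
  also have "\<dots> = transpose ?J ** (?g ** matrix_inv ?g) ** transpose ?K"
    by (simp add: matrix_inv_mult[OF det_jac_change_nonzero[OF assms]] matrix_mul_assoc)
  also have "\<dots> = transpose (?K ** ?J)"
    by (simp add: matrix_inv_mult[OF det] matrix_transpose_mul)
  also have "\<dots> = mat 1"
    by (simp add: matrix_inv_mult[OF det_jac_change_nonzero[OF assms]] transpose_mat)
  finally show "metric Y u ** (?K ** matrix_inv ?g ** transpose ?K) = mat 1" .
qed

lemma gradient_change:
  assumes u: "u \<in> S" and f: "f differentiable (at (\<tau> u))" and h: "\<And>y. y \<in> S \<Longrightarrow> h y = f (\<tau> y)"
  shows "gradient Y h u = gradient X f (\<tau> u)"
proof -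
  let ?J = "jac \<tau> u" and ?g = "metric X (\<tau> u)"
  let ?K = "matrix_inv ?J"
  note inv = matrix_inv_mult[OF det_jac_change_nonzero[OF u]]
  note J = jac_change[OF u]
  have P: "partials h u = transpose ?J *v partials f (\<tau> u)"
    by (rule partials_reparametrize[where f=f and \<tau>=\<tau>, OF Y.open_dom u h change_differentiable[OF u] f])
  have "gradient Y h u = (jac X (\<tau> u) ** (?J ** ?K) ** matrix_inv ?g ** transpose (?J ** ?K)) *v partials f (\<tau> u)"
    unfolding gradient_eq_jac J inverse_metric_change[OF u] P
    by (simp only: matrix_vector_mul_assoc matrix_mul_assoc matrix_transpose_mul)
  then show ?thesis
    by (simp add: inv transpose_mat gradient_eq_jac matrix_vector_mul_assoc)
qed

lemma divergence_change:
  assumes u: "u \<in> S" and Z: "Z differentiable (at (\<tau> u))" and W: "\<And>y. y \<in> S \<Longrightarrow> W y = Z (\<tau> y)"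
  shows "divergence Y W u = divergence X Z (\<tau> u)"
proof -
  let ?J = "jac \<tau> u" and ?g = "metric X (\<tau> u)"
  let ?K = "matrix_inv ?J"
  note inv = matrix_inv_mult[OF det_jac_change_nonzero[OF u]]
  note J = jac_change[OF u]
  have JW: "jac W u = jac Z (\<tau> u) ** ?J"
    by (rule jac_reparametrize[where f=Z and \<tau>=\<tau>, OF Y.open_dom u W change_differentiable[OF u] Z])
  have "divergence Y W u = trace (?K ** (matrix_inv ?g ** transpose (?J ** ?K) ** transpose (jac X (\<tau> u)) ** jac Z (\<tau> u) ** ?J))"
    unfolding divergence_eq_jac J JW inverse_metric_change[OF u]
    by (simp add: matrix_mul_assoc matrix_transpose_mul)
  also have "\<dots> = trace (?K ** (matrix_inv ?g ** transpose (jac X (\<tau> u)) ** jac Z (\<tau> u) ** ?J))"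
    by (simp only: inv(1) transpose_mat matrix_mul_rid)
  also have "\<dots> = trace ((matrix_inv ?g ** transpose (jac X (\<tau> u)) ** jac Z (\<tau> u) ** ?J) ** ?K)"
    by (rule trace_mul_sym)
  also have "\<dots> = trace (matrix_inv ?g ** transpose (jac X (\<tau> u)) ** jac Z (\<tau> u) ** (?J ** ?K))"
    by (simp only: matrix_mul_assoc)
  finally show ?thesis
    by (simp add: inv divergence_eq_jac matrix_mul_assoc)
qed

text \<open>
  Invariance of the Laplacian needs the invariance of the gradient on a whole neighbourhood, since the
  gradient field is differentiated.
\<close>
lemma green_density_change:
  assumes u: "u \<in> S" and a: "a differentiable (at (\<tau> u))" and b: "Ck_on 2 b V"
    and a': "\<And>y. y \<in> S \<Longrightarrow> a' y = a (\<tau> y)" and b': "\<And>y. y \<in> S \<Longrightarrow> b' y = b (\<tau> y)"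
  shows "green_density Y a' b' u = green_density X a b (\<tau> u)"
proof -
  have "gradient Y b' y = gradient X b (\<tau> y)" if "y \<in> S" for y
    by (intro gradient_change that b' C1_on_differentiable[OF C2_on_imp_C1_on[OF b]] change_in)
  moreover have "laplacian Y b' u = laplacian X b (\<tau> u)"
    unfolding laplacian_def
    by (intro divergence_change u C1_on_differentiable[OF X.C1_gradient[OF b]] change_in calculation)
  ultimately show ?thesis
    using gradient_change[OF u a a'] u by (simp add: green_density_def a')
qed

end

section \<open>Green's formula in a patch\<close>

text \<open>
  The difference quotients of \<open>f\<close> in direction \<open>i\<close> have integral zero by translation invariance. By the
  mean value theorem they are bounded by the maximum of the partial derivative, and for increments at
  most one they are supported in a fixed ball, so dominated convergence applies.
\<close>
lemma integral_partial_eq_0: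
  fixes f :: "real ^ 'n::finite \<Rightarrow> real"
  assumes C1: "C1_on f UNIV" and K: "compact K" "\<And>x. x \<notin> K \<Longrightarrow> f x = 0"
  shows "integrable lborel (partial i f)" "(LINT x|lborel. partial i f x) = 0"
proof -
  let ?p = "partial i f"
  have cont: "continuous_on UNIV ?p" "continuous_on UNIV f"
    by (rule continuous_on_partial[OF C1], rule C1_on_continuous[OF C1])
  have p0: "?p x = 0" if "x \<notin> K" for x
  proof -
    have "?p x = partial i (\<lambda>x. 0) x"
      using K that by (intro partial_cong_open[of "- K"]) (auto intro: compact_imp_closed)
    then show ?thesis by simp
  qed
  have int: "integrable lborel g" if "continuous_on UNIV g" "\<And>x. x \<notin> K \<Longrightarrow> g x = 0" for g :: "real ^ 'n \<Rightarrow> real"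
  proof -
    have "integrable lborel (\<lambda>x. indicator K x *\<^sub>R g x)"
      by (rule borel_integrable_compact[OF K(1)]) (rule continuous_on_subset[OF that(1)], simp)
    moreover have "(\<lambda>x. indicator K x *\<^sub>R g x) = g" using that(2) by (force simp: indicator_def)
    ultimately show ?thesis by simp
  qed
  show "integrable lborel ?p" by (rule int[OF cont(1) p0])
  obtain B where B: "\<And>x. \<bar>?p x\<bar> \<le> B" "B \<ge> 0"
  proof -
    have "bounded (?p ` K)"
      by (intro compact_imp_bounded compact_continuous_image K continuous_on_subset[OF cont(1)]) simp
    then obtain B where "\<And>x. x \<in> K \<Longrightarrow> \<bar>?p x\<bar> \<le> B" by (auto simp: bounded_iff)
    then have "\<bar>?p x\<bar> \<le> max B 0" for x using p0[of x] by (cases "x \<in> K") (auto simp: le_max_iff_disj)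
    then show ?thesis by (intro that[of "max B 0"]) auto
  qed
  let ?e = "axis i (1::real)"
  define h where "h n = 1 / real (Suc n)" for n
  have h: "h n > 0" "h n \<le> 1" for n by (auto simp: h_def field_simps)
  have h0: "h \<longlonglongrightarrow> 0" unfolding h_def by (rule LIMSEQ_inverse_real_of_nat[unfolded inverse_eq_divide])
  define q where "q n x = (f (x + h n *\<^sub>R ?e) - f x) / h n" for n x
  obtain R where R: "\<And>x. x \<in> K \<Longrightarrow> norm x \<le> R"
    using compact_imp_bounded[OF K(1)] by (auto simp: bounded_iff)
  let ?C = "cball 0 (R + 1) :: (real ^ 'n) set"
  have deriv: "((\<lambda>t. f (x + t *\<^sub>R ?e)) has_real_derivative ?p (x + t *\<^sub>R ?e)) (at t)" for x t
    by (intro has_real_derivative_along_line C1_on_differentiable[OF C1]) simp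
  have shift: "integrable lborel (\<lambda>x. f (x + c)) \<and> (LINT x|lborel. f (x + c)) = (LINT x|lborel. f x)" for c
  proof -
    have intf: "integrable lborel f" by (rule int[OF cont(2) K(2)])
    have mf: "f \<in> borel_measurable borel" by (rule borel_measurable_continuous_onI[OF cont(2)])
    have 1: "integrable (distr lborel borel ((+) c)) f" "(LINT x|distr lborel borel ((+) c). f x) = (LINT x|lborel. f x)"
      using intf by (simp_all add: lborel_distr_plus)
    have "integrable lborel (\<lambda>x. f (c + x))"
      using 1(1) mf by (subst (asm) integrable_distr_eq) auto
    moreover have "(LINT x|lborel. f (c + x)) = (LINT x|lborel. f x)"
      using 1(2) mf by (subst (asm) integral_distr) auto
    ultimately show ?thesis by (simp add: add.commute)
  qed
  have q0: "(LINT x|lborel. q n x) = 0" for n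
    unfolding q_def using shift[of "h n *\<^sub>R ?e"] int[OF cont(2) K(2)] by simp
  have "(\<lambda>n. LINT x|lborel. q n x) \<longlonglongrightarrow> (LINT x|lborel. ?p x)"
  proof (rule integral_dominated_convergence[where w="\<lambda>x. B * indicator ?C x"])
    show "?p \<in> borel_measurable lborel" using borel_measurable_continuous_onI[OF cont(1)] by simp
    have "continuous_on UNIV (q n)" for n
      unfolding q_def using h(1)[of n]
      by (intro continuous_intros continuous_on_compose2[OF cont(2)]) auto
    then show "q n \<in> borel_measurable lborel" for n
      using borel_measurable_continuous_onI[of "q n"] by simp
    show "integrable lborel (\<lambda>x. B * indicator ?C x)"
      by (intro integrable_mult_right integrable_real_indicator emeasure_lborel_cball_finite) auto
    show "AE x in lborel. (\<lambda>n. q n x) \<longlonglongrightarrow> ?p x"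
    proof (rule AE_I2)
      fix x
      have "((\<lambda>t. (f (x + t *\<^sub>R ?e) - f x) / t) \<longlongrightarrow> ?p x) (at 0)"
        using deriv[of x 0] by (simp add: has_field_derivative_iff)
      moreover have "filterlim h (at 0) sequentially"
        using h0 h(1) by (simp add: filterlim_at eventually_sequentially less_imp_neq[symmetric] order_less_imp_not_eq2)
      ultimately show "(\<lambda>n. q n x) \<longlonglongrightarrow> ?p x"
        unfolding q_def by (rule filterlim_compose)
    qed
    show "AE x in lborel. norm (q n x) \<le> B * indicator ?C x" for n
    proof (rule AE_I2)
      fix x :: "real ^ 'n"
      show "norm (q n x) \<le> B * indicator ?C x"
      proof (cases "x \<in> ?C")
        case True
        have "\<exists>z. 0 < z \<and> z < h n \<and> f (x + h n *\<^sub>R ?e) - f (x + 0 *\<^sub>R ?e) = (h n - 0) * ?p (x + z *\<^sub>R ?e)"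
          by (rule MVT2) (use h deriv in auto)
        then obtain z where "f (x + h n *\<^sub>R ?e) - f x = h n * ?p (x + z *\<^sub>R ?e)" by auto
        then have "q n x = ?p (x + z *\<^sub>R ?e)" using h(1)[of n] by (simp add: q_def)
        then show ?thesis using B True by simp
      next
        case False
        then have "norm x > R + 1" by simp
        moreover have "norm x \<le> norm (x + h n *\<^sub>R ?e) + norm (h n *\<^sub>R ?e)"
          by (metis add_diff_cancel_right' norm_triangle_ineq4)
        ultimately have "x \<notin> K" "x + h n *\<^sub>R ?e \<notin> K"
          using R[of x] R[of "x + h n *\<^sub>R ?e"] h[of n] by auto
        then show ?thesis using K(2) False by (simp add: q_def)
      qed
    qed
  qed
  then show "(LINT x|lborel. ?p x) = 0"
    unfolding q0 by (simp add: LIMSEQ_const_iff)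
qed

lemma C1_on_extend_by_0:
  assumes "C1_on f U" "open U" "closed K" "K \<subseteq> U" "\<And>x. x \<in> U - K \<Longrightarrow> f x = 0"
  shows "C1_on (\<lambda>x. if x \<in> U then f x else 0) UNIV"
proof (rule C1_onI)
  let ?f = "\<lambda>x. if x \<in> U then f x else 0"
  let ?D = "\<lambda>x v. if x \<in> U then frechet_derivative f (at x) v else 0"
  have D0: "frechet_derivative f (at x) v = 0" if "x \<in> U - K" for x v
    using frechet_derivative_cong_open[of "U - K" x f "\<lambda>x. 0"] assms that by (simp add: open_Diff)
  show "(?f has_derivative ?D x) (at x)" for x
  proof (cases "x \<in> U")
    case True
    then show ?thesis
      using has_derivative_transform_within_open[OF C1_on_has_derivative[OF assms(1) True] assms(2) True, of ?f] by simp
  next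
    case False
    then have "x \<in> - K" using assms(4) by auto
    then show ?thesis
      using has_derivative_transform_within_open[of "\<lambda>x. 0" "\<lambda>x. 0" x UNIV "- K" ?f] False assms by (auto simp: open_Compl)
  qed
  show "continuous_on UNIV (\<lambda>x. ?D x v)" for v
  proof -
    have "continuous_on (U \<union> - K) (\<lambda>x. ?D x v)"
    proof (rule continuous_on_open_Un)
      show "continuous_on U (\<lambda>x. ?D x v)"
        using C1_on_continuous_derivative[OF assms(1), of v] by (simp cong: continuous_on_cong)
      have "?D x v = 0" if "x \<in> - K" for x using D0[of x v] that by auto
      then show "continuous_on (- K) (\<lambda>x. ?D x v)"
        by (intro continuous_on_eq[OF continuous_on_const[of _ 0]]) auto
    qed (use assms in auto)
    moreover have "U \<union> - K = UNIV" using assms(4) by auto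
    ultimately show ?thesis by simp
  qed
qed

lemma (in immersed_patch) green_formula_patch:
  assumes a: "C1_on a U" and b: "Ck_on 2 b U"
    and K: "compact K" "K \<subseteq> U" "\<And>u. u \<in> U - K \<Longrightarrow> a u = 0"
  shows "(LINT u|lborel. indicator U u * (sqrt (det (metric X u)) * green_density X a b u)) = 0"
proof -
  let ?w = "\<lambda>i u. (sqrt (det (metric X u)) * a u) * (\<Sum>j\<in>UNIV. ginv X u i j * partial j b u)"
  let ?f = "\<lambda>i u. if u \<in> U then ?w i u else 0"
  have C1f: "C1_on (?f i) UNIV" for i
    by (intro C1_on_extend_by_0[OF C1_coordinate_flux[OF a b] open_dom compact_imp_closed[OF K(1)] K(2)])
      (simp add: K(3))
  have f0: "?f i u = 0" if "u \<notin> K" for i u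
    using K(3)[of u] that by auto
  have eq: "indicator U u * (sqrt (det (metric X u)) * green_density X a b u) = (\<Sum>i\<in>UNIV. partial i (?f i) u)" for u
  proof (cases "u \<in> U")
    case True
    then have "(\<Sum>i\<in>UNIV. partial i (?f i) u) = (\<Sum>i\<in>UNIV. partial i (?w i) u)"
      by (intro sum.cong refl partial_cong_open[OF open_dom]) auto
    then show ?thesis
      using green_density_divergence_form[OF a b True] True by simp
  next
    case False
    have "partial i (?f i) u = partial i (\<lambda>x. 0) u" for i
      using False K f0 by (intro partial_cong_open[of "- K"]) (auto intro: compact_imp_closed)
    then show ?thesis using False by simp
  qed
  show ?thesis
    unfolding eq
    using integral_partial_eq_0[OF C1f K(1) f0]
    by (simp add: Bochner_Integration.integral_sum)
qed

section \<open>Change of variables for nonnegative integrals\<close>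

text \<open>
  Translates absolute integrability with a given integral into a statement on nonnegative integrals;
  as it holds for every value \<open>b\<close>, it also detects infinite ones.
\<close>
lemma set_integral_eq_iff_nn_integral:
  fixes \<phi> :: "'a::euclidean_space \<Rightarrow> real"
  assumes pos: "\<And>x. x \<in> S \<Longrightarrow> 0 \<le> \<phi> x" and m: "(\<lambda>x. indicator S x * \<phi> x) \<in> borel_measurable borel"
  shows "\<phi> absolutely_integrable_on S \<and> integral S \<phi> = b \<longleftrightarrow>
    (\<integral>\<^sup>+x. ennreal (indicator S x * \<phi> x) \<partial>lborel) = ennreal b \<and> 0 \<le> b"
proof (intro iffI conjI; (elim conjE)?)
  assume *: "\<phi> absolutely_integrable_on S" "integral S \<phi> = b"
  then have "(\<phi> has_integral b) S"
    using set_lebesgue_integral_eq_integral(1) by (blast intro: integrable_integral)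
  from nn_integral_has_integral_lebesgue[OF pos this]
  show "(\<integral>\<^sup>+x. ennreal (indicator S x * \<phi> x) \<partial>lborel) = ennreal b" by simp
  show "0 \<le> b"
    using has_integral_nonneg[OF \<open>(\<phi> has_integral b) S\<close> pos] by simp
next
  assume *: "(\<integral>\<^sup>+x. ennreal (indicator S x * \<phi> x) \<partial>lborel) = ennreal b" "0 \<le> b"
  have "((\<lambda>x. indicator S x * \<phi> x) has_integral b) UNIV"
    by (rule nn_integral_has_integral[OF m _ *]) (auto simp: indicator_def pos)
  moreover have "(\<lambda>x. indicator S x * \<phi> x) = (\<lambda>x. if x \<in> S then \<phi> x else 0)" by auto
  ultimately have "(\<phi> has_integral b) S"
    by (simp add: has_integral_restrict_UNIV)
  then show "integral S \<phi> = b" "\<phi> absolutely_integrable_on S"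
    using pos by (auto intro: nonnegative_absolutely_integrable_1 has_integral_integrable integral_unique)
qed

lemma nn_integral_change_of_variables_wellorder:
  fixes g :: "real ^ 'm::{finite, wellorder} \<Rightarrow> real ^ 'm::_" and f :: "real ^ 'm::_ \<Rightarrow> real"
  assumes S: "S \<in> sets borel"
    and der: "\<And>x. x \<in> S \<Longrightarrow> (g has_derivative g' x) (at x within S)"
    and inj: "inj_on g S" and pos: "\<And>y. y \<in> g ` S \<Longrightarrow> 0 \<le> f y"
    and m: "(\<lambda>x. indicator S x * (\<bar>det (matrix (g' x))\<bar> * f (g x))) \<in> borel_measurable borel"
      "(\<lambda>y. indicator (g ` S) y * f y) \<in> borel_measurable borel"
  shows "(\<integral>\<^sup>+x. ennreal (indicator S x * (\<bar>det (matrix (g' x))\<bar> * f (g x))) \<partial>lborel)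
       = (\<integral>\<^sup>+y. ennreal (indicator (g ` S) y * f y) \<partial>lborel)" (is "?L = ?R")
proof -
  \<comment> \<open>the change-of-variables theorem concerns vector-valued functions, so \<open>f\<close> is read as one with values in \<open>real ^ 1\<close>\<close>
  have "(\<lambda>x. \<bar>det (matrix (g' x))\<bar> *\<^sub>R vec (f (g x)) :: real ^ 1) absolutely_integrable_on S \<and>
        integral S (\<lambda>x. \<bar>det (matrix (g' x))\<bar> *\<^sub>R vec (f (g x))) = (vec b :: real ^ 1)
     \<longleftrightarrow> (\<lambda>x. vec (f x) :: real ^ 1) absolutely_integrable_on (g ` S) \<and>
        integral (g ` S) (\<lambda>x. vec (f x)) = (vec b :: real ^ 1)" for b
    using S by (intro has_absolute_integral_change_of_variables der inj) auto
  then have "(\<lambda>x. \<bar>det (matrix (g' x))\<bar> * f (g x)) absolutely_integrable_on S \<and>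
        integral S (\<lambda>x. \<bar>det (matrix (g' x))\<bar> * f (g x)) = b
     \<longleftrightarrow> f absolutely_integrable_on (g ` S) \<and> integral (g ` S) f = b" for b
    by (simp add: absolutely_integrable_on_1_iff integral_on_1_eq)
  then have *: "?L = ennreal b \<and> 0 \<le> b \<longleftrightarrow> ?R = ennreal b \<and> 0 \<le> b" for b
    using set_integral_eq_iff_nn_integral[OF _ m(1), of b] set_integral_eq_iff_nn_integral[OF pos m(2), of b] pos
    by auto
  show ?thesis
  proof (cases ?L rule: ennreal_cases)
    case (real b)
    then show ?thesis using *[of b] by simp
  next
    case top
    then show ?thesis using * by (cases ?R rule: ennreal_cases) auto
  qed
qed

text \<open>
  The change-of-variables theorem for \<open>real ^ 'm\<close> asks for a well-order on the index type, while
  the coordinates of a hypersurface are indexed by an arbitrary finite type. Hence every finite type gets a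
  well-ordered copy, and the coordinates are renamed along the bijection between the two; this
  preserves Lebesgue measure and determinants.
\<close>
datatype 'a well_ordered = Wo (unwo: 'a)

lemma unwo_Wo: "unwo \<circ> Wo = id" "Wo \<circ> unwo = id"
  by auto

lemma bij_Wo: "bij Wo" "bij unwo"
  using unwo_Wo by (metis o_bij)+

instance well_ordered :: (finite) finite
proof
  have "(UNIV :: 'a well_ordered set) = Wo ` UNIV"
    by (rule bij_is_surj[OF bij_Wo(1), symmetric])
  then show "finite (UNIV :: 'a well_ordered set)" by (metis finite finite_imageI)
qed

instantiation well_ordered :: (finite) wellorder
begin

definition enum_index :: "'a well_ordered \<Rightarrow> nat" where
  "enum_index = (SOME f. inj f)"

definition "a \<le> b \<longleftrightarrow> enum_index a \<le> enum_index b"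
definition "a < b \<longleftrightarrow> enum_index a < enum_index b"

lemma inj_enum_index: "inj (enum_index :: 'a well_ordered \<Rightarrow> nat)"
proof -
  have "\<exists>f :: 'a well_ordered \<Rightarrow> nat. inj f"
    using finite_imp_inj_to_nat_seg[of "UNIV :: 'a well_ordered set"] by auto
  then show ?thesis unfolding enum_index_def by (rule someI_ex)
qed

instance
proof
  fix P :: "'a well_ordered \<Rightarrow> bool" and a :: "'a well_ordered"
  assume step: "\<And>x. (\<And>y. y < x \<Longrightarrow> P y) \<Longrightarrow> P x"
  show "P a"
    by (induction a rule: measure_induct_rule[where f=enum_index]) (rule step, simp add: less_well_ordered_def)
qed (use inj_enum_index in \<open>auto simp: less_eq_well_ordered_def less_well_ordered_def inj_eq\<close>)

end

definition reindex :: "('b::finite \<Rightarrow> 'a::finite) \<Rightarrow> real ^ 'a \<Rightarrow> real ^ 'b" where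
  "reindex \<pi> x = (\<chi> i. x $ \<pi> i)"

lemma linear_reindex: "linear (reindex \<pi>)"
  by (rule linearI) (simp_all add: reindex_def vec_eq_iff)

lemma bounded_linear_reindex: "bounded_linear (reindex \<pi>)"
  using linear_linear linear_reindex by blast

lemma reindex_measurable [measurable]: "reindex \<pi> \<in> borel_measurable borel"
  by (intro borel_measurable_continuous_onI linear_continuous_on bounded_linear_reindex)

lemma reindex_reindex: "reindex \<sigma> (reindex \<pi> x) = reindex (\<pi> \<circ> \<sigma>) x"
  by (simp add: reindex_def)

lemma reindex_id [simp]: "reindex id x = x"
  by (simp add: reindex_def)

lemma lborel_distr_reindex:
  fixes \<pi> :: "'b::finite \<Rightarrow> 'a::finite"
  assumes "bij \<pi>"
  shows "distr lborel borel (reindex \<pi>) = lborel"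
proof (rule lborel_eqI[symmetric])
  fix l u :: "real ^ 'b" assume le: "\<And>b. b \<in> Basis \<Longrightarrow> l \<bullet> b \<le> u \<bullet> b"
  have lu: "l $ i \<le> u $ i" for i
  proof -
    have "axis i (1::real) \<in> Basis" by (auto simp: Basis_vec_def)
    from le[OF this] show ?thesis by (simp add: cart_eq_inner_axis)
  qed
  have Basis_prod: "(\<Prod>b\<in>(Basis :: (real ^ 'c::finite) set). f b) = (\<Prod>i\<in>UNIV. f (axis i 1))" for f :: "real ^ 'c \<Rightarrow> real"
    by (simp add: Basis_vec_def axis_eq_axis prod.UNION_disjoint)
  let ?r = "reindex (inv \<pi>) :: real ^ 'b \<Rightarrow> real ^ 'a"
  have "emeasure (distr lborel borel (reindex \<pi>)) (box l u) = emeasure lborel (reindex \<pi> -` box l u)"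
    by (subst emeasure_distr) auto
  also have "reindex \<pi> -` box l u = box (?r l) (?r u)"
    using assms by (auto simp: box_vec_eq_empty mem_box_cart reindex_def bij_is_surj surj_f_inv_f)
      (metis bij_inv_eq_iff)+
  also have "emeasure lborel (box (?r l) (?r u)) = (\<Prod>b\<in>Basis. (?r u - ?r l) \<bullet> b)"
    by (rule emeasure_lborel_box) (auto simp: Basis_vec_def inner_axis reindex_def lu)
  also have "(\<Prod>b\<in>Basis. (?r u - ?r l) \<bullet> b) = (\<Prod>i\<in>UNIV. u $ inv \<pi> i - l $ inv \<pi> i)"
    by (simp add: Basis_prod inner_axis reindex_def)
  also have "\<dots> = (\<Prod>i\<in>UNIV. u $ i - l $ i)"
    using prod.reindex_bij_betw[OF bij_imp_bij_inv[OF assms], of "\<lambda>i. u $ i - l $ i"] by simp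
  also have "\<dots> = (\<Prod>b\<in>Basis. (u - l) \<bullet> b)"
    by (simp add: Basis_prod inner_axis)
  finally show "emeasure (distr lborel borel (reindex \<pi>)) (box l u) = (\<Prod>b\<in>Basis. (u - l) \<bullet> b)" .
qed simp

text \<open>
  Conjugation with \<open>\<pi>\<close> is a sign-preserving bijection between the permutations of the two index types.
\<close>
lemma det_reindex:
  fixes A :: "real ^ 'a::finite ^ 'a" and \<pi> :: "'b::finite \<Rightarrow> 'a"
  assumes "bij \<pi>"
  shows "det (\<chi> i j. A $ \<pi> i $ \<pi> j) = det A"
proof -
  let ?m = "map_permutation (UNIV :: 'b set) \<pi>"
  have inj: "inj \<pi>" and surj: "range \<pi> = UNIV" using assms by (auto simp: bij_is_inj bij_is_surj)
  have m: "?m p = \<pi> \<circ> p \<circ> inv \<pi>" for p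
    by (auto simp: map_permutation_def restrict_id_def surj)
  have "det A = (\<Sum>q\<in>{q. q permutes UNIV}. of_int (sign q) * (\<Prod>i\<in>UNIV. A $ i $ q i))"
    by (simp add: det_def)
  also have "\<dots> = (\<Sum>p\<in>{p. p permutes (UNIV :: 'b set)}. of_int (sign (?m p)) * (\<Prod>i\<in>UNIV. A $ i $ (?m p) i))"
  proof (rule sum.reindex_bij_witness[where i="?m" and j="\<lambda>q. inv \<pi> \<circ> q \<circ> \<pi>"])
    fix q :: "'a \<Rightarrow> 'a" assume "q \<in> {q. q permutes UNIV}"
    then have "bij q" using permutes_bij by blast
    show "?m (inv \<pi> \<circ> q \<circ> \<pi>) = q"
      using assms by (auto simp: m fun_eq_iff bij_is_surj surj_f_inv_f)
    have "bij (inv \<pi> \<circ> q \<circ> \<pi>)"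
      by (intro bij_comp bij_imp_bij_inv assms \<open>bij q\<close>)
    then show "inv \<pi> \<circ> q \<circ> \<pi> \<in> {p. p permutes UNIV}" by (auto intro: bij_imp_permutes)
    show "of_int (sign (?m (inv \<pi> \<circ> q \<circ> \<pi>))) * (\<Prod>i\<in>UNIV. A $ i $ ?m (inv \<pi> \<circ> q \<circ> \<pi>) i)
      = of_int (sign q) * (\<Prod>i\<in>UNIV. A $ i $ q i)"
      using \<open>?m (inv \<pi> \<circ> q \<circ> \<pi>) = q\<close> by simp
  next
    fix p :: "'b \<Rightarrow> 'b" assume "p \<in> {p. p permutes UNIV}"
    then have "p permutes UNIV" by simp
    show "inv \<pi> \<circ> ?m p \<circ> \<pi> = p"
      using inj by (simp add: m fun_eq_iff)
    show "?m p \<in> {q. q permutes UNIV}"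
      using map_permutation_permutes[OF assms \<open>p permutes UNIV\<close>] by simp
  qed
  also have "\<dots> = (\<Sum>p\<in>{p. p permutes (UNIV :: 'b set)}. of_int (sign p) * (\<Prod>i\<in>UNIV. A $ \<pi> i $ \<pi> (p i)))"
  proof (rule sum.cong[OF refl])
    fix p :: "'b \<Rightarrow> 'b" assume "p \<in> {p. p permutes UNIV}"
    then have "sign (?m p) = sign p" using inj by (simp add: sign_map_permutation)
    moreover have "(\<Prod>i\<in>UNIV. A $ i $ (?m p) i) = (\<Prod>i\<in>UNIV. A $ \<pi> i $ (?m p) (\<pi> i))"
      using prod.reindex_bij_betw[OF assms, of "\<lambda>i. A $ i $ (?m p) i"] by simp
    ultimately show "of_int (sign (?m p)) * (\<Prod>i\<in>UNIV. A $ i $ (?m p) i) = of_int (sign p) * (\<Prod>i\<in>UNIV. A $ \<pi> i $ \<pi> (p i))"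
      using inj by (simp add: m)
  qed
  finally show ?thesis by (simp add: det_def)
qed

lemma nn_integral_change_of_variables:
  fixes g :: "real ^ 'n::finite \<Rightarrow> real ^ 'n" and f :: "real ^ 'n \<Rightarrow> real"
  assumes S: "S \<in> sets borel"
    and der: "\<And>x. x \<in> S \<Longrightarrow> (g has_derivative g' x) (at x)"
    and inj: "inj_on g S" and pos: "\<And>y. y \<in> g ` S \<Longrightarrow> 0 \<le> f y"
    and m: "(\<lambda>x. indicator S x * (\<bar>det (matrix (g' x))\<bar> * f (g x))) \<in> borel_measurable borel"
      "(\<lambda>y. indicator (g ` S) y * f y) \<in> borel_measurable borel"
  shows "(\<integral>\<^sup>+x. ennreal (indicator S x * (\<bar>det (matrix (g' x))\<bar> * f (g x))) \<partial>lborel)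
       = (\<integral>\<^sup>+y. ennreal (indicator (g ` S) y * f y) \<partial>lborel)"
proof -
  let ?E = "reindex unwo :: real ^ 'n \<Rightarrow> real ^ 'n well_ordered"
  let ?D = "reindex Wo :: real ^ 'n well_ordered \<Rightarrow> real ^ 'n"
  have DE [simp]: "?D (?E x) = x" and ED [simp]: "?E (?D y) = y" for x y
    by (simp_all add: reindex_reindex unwo_Wo)
  let ?h = "\<lambda>y. ?E (g (?D y))" and ?h' = "\<lambda>y v. ?E (g' (?D y) (?D v))"
  have lin: "bounded_linear ?E" "bounded_linear ?D"
    by (rule bounded_linear_reindex)+
  have mem: "y \<in> ?E ` A \<longleftrightarrow> ?D y \<in> A" for y A
    by (metis DE ED image_iff)
  have img: "?h ` ?E ` S = ?E ` g ` S" by (auto simp: image_image)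
  have ind: "indicator (?E ` A) y = (indicator A (?D y) :: real)" for y A
    using mem[of y A] by (simp add: indicator_def)
  have ES: "?E ` A \<in> sets borel" if "A \<in> sets borel" for A
  proof -
    have "?E ` A = ?D -` A \<inter> space borel" using mem by auto
    then show ?thesis using measurable_sets[OF reindex_measurable that] by simp
  qed
  have det: "det (matrix (?h' y)) = det (matrix (g' (?D y)))" if "y \<in> ?E ` S" for y
  proof -
    have "linear (g' (?D y))" using der mem that by (blast intro: has_derivative_linear)
    have ax: "?D (axis j 1) = axis (unwo j) 1" for j :: "'n well_ordered"
      by (auto simp: vec_eq_iff reindex_def axis_def)
    have "matrix (?h' y) = (\<chi> i j. matrix (g' (?D y)) $ unwo i $ unwo j)"
      by (simp add: matrix_def vec_eq_iff ax) (simp add: reindex_def)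
    then show ?thesis by (simp add: det_reindex bij_Wo)
  qed
  have nn: "(\<integral>\<^sup>+x. F x \<partial>lborel) = (\<integral>\<^sup>+y. F (?D y) \<partial>lborel)" if "F \<in> borel_measurable borel" for F
  proof -
    have "(\<integral>\<^sup>+x. F x \<partial>lborel) = (\<integral>\<^sup>+x. F x \<partial>distr lborel borel ?D)"
      by (simp add: lborel_distr_reindex bij_Wo)
    also have "\<dots> = (\<integral>\<^sup>+y. F (?D y) \<partial>lborel)"
      using that by (subst nn_integral_distr) auto
    finally show ?thesis .
  qed
  have eq1: "indicator (?E ` S) y * (\<bar>det (matrix (?h' y))\<bar> * f (?D (?h y)))
     = indicator S (?D y) * (\<bar>det (matrix (g' (?D y)))\<bar> * f (g (?D y)))" for y
    using det[of y] mem[of y S] by (simp add: indicator_def)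
  have "(\<integral>\<^sup>+y. ennreal (indicator (?E ` S) y * (\<bar>det (matrix (?h' y))\<bar> * f (?D (?h y)))) \<partial>lborel)
      = (\<integral>\<^sup>+y. ennreal (indicator (?h ` ?E ` S) y * f (?D y)) \<partial>lborel)"
  proof (rule nn_integral_change_of_variables_wellorder)
    show "?E ` S \<in> sets borel" by (rule ES[OF S])
    show "(?h has_derivative ?h' y) (at y within ?E ` S)" if "y \<in> ?E ` S" for y
    proof -
      have "(g has_derivative g' (?D y)) (at (?D y))" using der mem that by blast
      moreover have "(?D has_derivative ?D) (at y within ?E ` S)"
        by (rule bounded_linear_imp_has_derivative[OF lin(2)])
      ultimately have "((\<lambda>y. g (?D y)) has_derivative (\<lambda>v. g' (?D y) (?D v))) (at y within ?E ` S)"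
        by (rule has_derivative_compose[rotated])
      then show ?thesis by (rule bounded_linear.has_derivative[OF lin(1)])
    qed
    show "inj_on ?h (?E ` S)"
      using inj by (auto simp: inj_on_def) (metis DE)
    show "0 \<le> f (?D y)" if "y \<in> ?h ` ?E ` S" for y
      using that pos by auto
    show "(\<lambda>y. indicator (?E ` S) y * (\<bar>det (matrix (?h' y))\<bar> * f (?D (?h y)))) \<in> borel_measurable borel"
      unfolding eq1 by (rule measurable_compose[OF reindex_measurable m(1)])
    show "(\<lambda>y. indicator (?h ` ?E ` S) y * f (?D y)) \<in> borel_measurable borel"
      unfolding img ind by (rule measurable_compose[OF reindex_measurable m(2)])
  qed
  then show ?thesis
    unfolding eq1 unfolding img ind using m by (simp add: nn)
qed

section \<open>Charts and the volume measure\<close>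
lemma (in immersed_patch) immersed_patch_subset:
  "open S \<Longrightarrow> S \<subseteq> U \<Longrightarrow> immersed_patch X S"
  using C2 immersion by unfold_locales (auto intro: Ck_on_subset)

abbreviation vol :: "(real ^ 'n::finite \<Rightarrow> real ^ 'k::finite) \<Rightarrow> real ^ 'n \<Rightarrow> real" where
  "vol X u \<equiv> sqrt (det (metric X u))"

locale hypersurface =
  fixes \<A> :: "('n::finite, 'm::{second_countable_topology, t2_space}) chart set"
    and F :: "'m \<Rightarrow> real ^ 'k::finite"
  assumes immersed: "immersed_hypersurface \<A> F"
begin

lemma
  assumes "(U, c) \<in> \<A>"
  shows chart_open_domain: "open U" and chart_open_image: "open (c ` U)"
    and chart_homeomorphism: "homeomorphism U (c ` U) c (inv_into U c)"
  using immersed assms unfolding immersed_hypersurface_def smooth_atlas_def by auto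

lemma
  assumes "(U, c) \<in> \<A>"
  shows chart_continuous: "continuous_on U c" and chart_inverse_continuous: "continuous_on (c ` U) (inv_into U c)"
    and chart_inj: "inj_on c U" and chart_inverse: "u \<in> U \<Longrightarrow> inv_into U c (c u) = u"
  using chart_homeomorphism[OF assms] by (auto simp: homeomorphism_def inj_on_def) metis

lemma chart_cover: "(\<Union>(U, c)\<in>\<A>. c ` U) = UNIV"
  using immersed unfolding immersed_hypersurface_def smooth_atlas_def by auto

lemma obtain_chart:
  obtains U c where "(U, c) \<in> \<A>" "p \<in> c ` U"
proof -
  have "p \<in> (\<Union>(U, c)\<in>\<A>. c ` U)" using chart_cover by simp
  then show ?thesis using that by auto
qed

lemma patch: "(U, c) \<in> \<A> \<Longrightarrow> immersed_patch (F \<circ> c) U"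
  using immersed chart_open_domain[of U c]
  unfolding immersed_hypersurface_def smooth_map_def
  by unfold_locales (auto intro: smooth_on_imp_Ck_on)

definition overlap :: "(real ^ 'n) set \<Rightarrow> (real ^ 'n \<Rightarrow> 'm) \<Rightarrow> (real ^ 'n) set \<Rightarrow> (real ^ 'n \<Rightarrow> 'm) \<Rightarrow> (real ^ 'n) set" where
  "overlap U c V d = U \<inter> c -` (d ` V)"

lemma open_chart_vimage:
  assumes "(U, c) \<in> \<A>" "open B"
  shows "open (U \<inter> c -` B)"
  using chart_continuous[OF assms(1)] chart_open_domain[OF assms(1)] assms(2) continuous_on_open_vimage
  by (metis Int_commute)

lemma open_overlap: "(U, c) \<in> \<A> \<Longrightarrow> (V, d) \<in> \<A> \<Longrightarrow> open (overlap U c V d)"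
  unfolding overlap_def by (intro open_chart_vimage chart_open_image)

lemma C1_transition:
  assumes "(U, c) \<in> \<A>" "(V, d) \<in> \<A>"
  shows "C1_on (inv_into V d \<circ> c) (overlap U c V d)"
  using immersed assms unfolding immersed_hypersurface_def smooth_atlas_def overlap_def
  by (intro smooth_on_imp_Ck_on) auto

lemma transition_reparametrization:
  assumes "(U, c) \<in> \<A>" "(V, d) \<in> \<A>"
  shows "reparametrization (F \<circ> d) V (F \<circ> c) (overlap U c V d) (inv_into V d \<circ> c)"
proof -
  interpret d: immersed_patch "F \<circ> d" V by (rule patch[OF assms(2)])
  interpret c: immersed_patch "F \<circ> c" "overlap U c V d"
    by (rule immersed_patch.immersed_patch_subset[OF patch[OF assms(1)] open_overlap[OF assms]])
      (simp add: overlap_def)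
  show ?thesis
  proof unfold_locales
    fix y assume y: "y \<in> overlap U c V d"
    show "inv_into V d \<circ> c differentiable (at y)"
      by (rule C1_on_differentiable[OF C1_transition[OF assms] y])
    show "(inv_into V d \<circ> c) y \<in> V" "(F \<circ> c) y = (F \<circ> d) ((inv_into V d \<circ> c) y)"
      using y by (auto simp: overlap_def inv_into_into f_inv_into_f)
  qed
qed

lemma chart_vimage_borel:
  assumes "(U, c) \<in> \<A>" "B \<in> sets borel"
  shows "U \<inter> c -` B \<in> sets borel"
proof -
  have U: "U \<in> sets borel" using chart_open_domain[OF assms(1)] by simp
  have "c \<in> borel_measurable (restrict_space borel U)"
    by (rule borel_measurable_continuous_on_restrict[OF chart_continuous[OF assms(1)]])
  from measurable_sets[OF this assms(2)] show ?thesis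
    using U by (simp add: sets_restrict_space_iff space_restrict_space Int_commute)
qed

lemma chart_image_borel:
  assumes "(U, c) \<in> \<A>" "E \<in> sets borel" "E \<subseteq> U"
  shows "c ` E \<in> sets borel"
proof -
  have U: "c ` U \<in> sets borel" using chart_open_image[OF assms(1)] by simp
  have "inv_into U c \<in> borel_measurable (restrict_space borel (c ` U))"
    by (rule borel_measurable_continuous_on_restrict[OF chart_inverse_continuous[OF assms(1)]])
  from measurable_sets[OF this assms(2)] have "inv_into U c -` E \<inter> c ` U \<in> sets borel"
    using U by (simp add: sets_restrict_space_iff space_restrict_space)
  moreover have "inv_into U c -` E \<inter> c ` U = c ` E"
    using assms(3) chart_inverse[OF assms(1)] by auto
  ultimately show ?thesis by simp
qed

lemma vol_measurable:
  assumes "(U, c) \<in> \<A>"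
  shows "(\<lambda>u. indicator U u * vol (F \<circ> c) u) \<in> borel_measurable borel"
proof -
  interpret immersed_patch "F \<circ> c" U by (rule patch[OF assms])
  have "(\<lambda>u. indicator U u *\<^sub>R vol (F \<circ> c) u) \<in> borel_measurable borel"
    using open_dom by (intro borel_measurable_continuous_on_indicator C1_on_continuous[OF C1_sqrt_det_metric]) auto
  then show ?thesis by simp
qed

text \<open>
  The part of the volume measure that is seen by one chart, extended by zero to the whole
  hypersurface. Points outside the domain of the parametrization are sent to a default value, which
  receives no mass from there because the density vanishes.
\<close>
definition chart_measure :: "(real ^ 'n) set \<Rightarrow> (real ^ 'n \<Rightarrow> 'm) \<Rightarrow> 'm measure" where
  "chart_measure U c = distr (density lborel (\<lambda>u. ennreal (indicator U u * vol (F \<circ> c) u))) borel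
     (\<lambda>u. if u \<in> U then c u else undefined)"

lemma chart_extension_measurable:
  assumes "(U, c) \<in> \<A>"
  shows "(\<lambda>u. if u \<in> U then c u else undefined) \<in> borel_measurable borel"
proof (rule measurable_If_restrict_space_iff[THEN iffD2])
  have U: "U \<in> sets borel" using chart_open_domain[OF assms] by simp
  show "{x \<in> space borel. x \<in> U} \<in> sets borel" using U by simp
  show "c \<in> borel_measurable (restrict_space borel {x. x \<in> U}) \<and> (\<lambda>x. undefined) \<in> borel_measurable (restrict_space borel {x. x \<notin> U})"
    using borel_measurable_continuous_on_restrict[OF chart_continuous[OF assms]] by simp
qed

lemma sets_chart_measure [simp]: "sets (chart_measure U c) = sets borel"
  by (simp add: chart_measure_def)

lemma emeasure_chart_measure:
  assumes "(U, c) \<in> \<A>" "B \<in> sets borel"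
  shows "emeasure (chart_measure U c) B = (\<integral>\<^sup>+u\<in>U \<inter> c -` B. ennreal (vol (F \<circ> c) u) \<partial>lborel)"
proof -
  let ?c = "\<lambda>u. if u \<in> U then c u else undefined"
  have "?c -` B \<in> sets borel"
    using measurable_sets[OF chart_extension_measurable[OF assms(1)] assms(2)] by simp
  then have "emeasure (chart_measure U c) B
      = (\<integral>\<^sup>+u. ennreal (indicator U u * vol (F \<circ> c) u) * indicator (?c -` B) u \<partial>lborel)"
    unfolding chart_measure_def using assms chart_extension_measurable[OF assms(1)] vol_measurable[OF assms(1)]
    by (subst emeasure_distr) (auto simp: emeasure_density)
  also have "\<dots> = (\<integral>\<^sup>+u\<in>U \<inter> c -` B. ennreal (vol (F \<circ> c) u) \<partial>lborel)"
    by (intro nn_integral_cong) (auto simp: indicator_def)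
  finally show ?thesis .
qed

text \<open>
  On the overlap of two charts the densities \<open>sqrt (det g)\<close> differ by the Jacobian determinant of the
  transition map, which is the factor in the change-of-variables formula.
\<close>
lemma chart_measure_compatible:
  assumes c: "(U, c) \<in> \<A>" and d: "(V, d) \<in> \<A>" and B: "B \<in> sets borel" "B \<subseteq> c ` U" "B \<subseteq> d ` V"
  shows "emeasure (chart_measure U c) B = emeasure (chart_measure V d) B"
proof -
  let ?S = "overlap U c V d" and ?\<tau> = "inv_into V d \<circ> c"
  interpret reparametrization "F \<circ> d" V "F \<circ> c" ?S ?\<tau> by (rule transition_reparametrization[OF c d])
  define E where "E = U \<inter> c -` B"
  have E: "E \<in> sets borel" unfolding E_def by (rule chart_vimage_borel[OF c B(1)])
  have ES: "E \<subseteq> ?S" using B by (auto simp: E_def overlap_def)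
  have img: "?\<tau> ` E = V \<inter> d -` B"
  proof (intro set_eqI iffI)
    fix v assume "v \<in> ?\<tau> ` E"
    then obtain u where "u \<in> U" "c u \<in> B" "v = inv_into V d (c u)" by (auto simp: E_def)
    then show "v \<in> V \<inter> d -` B" using B(3) by (auto simp: inv_into_into f_inv_into_f subset_eq)
  next
    fix v assume v: "v \<in> V \<inter> d -` B"
    then obtain u where u: "u \<in> U" "d v = c u" using B(2) by auto
    then have "u \<in> E" using v by (auto simp: E_def)
    moreover have "v = ?\<tau> u" using v u chart_inverse[OF d, of v] by auto
    ultimately show "v \<in> ?\<tau> ` E" by blast
  qed
  have inj: "inj_on ?\<tau> E"
  proof (rule inj_onI)
    fix x y assume xy: "x \<in> E" "y \<in> E" "?\<tau> x = ?\<tau> y"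
    then have "c x = c y"
      using B(3) by (metis E_def IntD2 comp_apply f_inv_into_f subsetD vimage_eq)
    then show "x = y" using xy chart_inj[OF c] by (auto simp: E_def inj_on_def)
  qed
  have eq: "indicator E u * (\<bar>det (jac ?\<tau> u)\<bar> * vol (F \<circ> d) (?\<tau> u)) = indicator E u * vol (F \<circ> c) u" for u
    using sqrt_det_metric_change[of u] ES by (auto simp: indicator_def)
  have mE: "(\<lambda>u. indicator E u * vol (F \<circ> c) u) \<in> borel_measurable borel"
  proof -
    have "(\<lambda>u. indicator E u * (indicator U u * vol (F \<circ> c) u)) \<in> borel_measurable borel"
      using vol_measurable[OF c] E by measurable
    moreover have "(\<lambda>u. indicator E u * (indicator U u * vol (F \<circ> c) u)) = (\<lambda>u. indicator E u * vol (F \<circ> c) u)"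
      by (auto simp: E_def indicator_def)
    ultimately show ?thesis by simp
  qed
  have mV: "(\<lambda>v. indicator (V \<inter> d -` B) v * vol (F \<circ> d) v) \<in> borel_measurable borel"
  proof -
    have "(\<lambda>v. indicator (V \<inter> d -` B) v * (indicator V v * vol (F \<circ> d) v)) \<in> borel_measurable borel"
      using vol_measurable[OF d] chart_vimage_borel[OF d B(1)] by measurable
    moreover have "(\<lambda>v. indicator (V \<inter> d -` B) v * (indicator V v * vol (F \<circ> d) v)) = (\<lambda>v. indicator (V \<inter> d -` B) v * vol (F \<circ> d) v)"
      by (auto simp: indicator_def)
    ultimately show ?thesis by simp
  qed
  have "(\<integral>\<^sup>+u. ennreal (indicator E u * (\<bar>det (jac ?\<tau> u)\<bar> * vol (F \<circ> d) (?\<tau> u))) \<partial>lborel)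
      = (\<integral>\<^sup>+v. ennreal (indicator (?\<tau> ` E) v * vol (F \<circ> d) v) \<partial>lborel)"
  proof (rule nn_integral_change_of_variables[OF E _ inj])
    show "(?\<tau> has_derivative frechet_derivative ?\<tau> (at x)) (at x)" if "x \<in> E" for x
      using C1_on_has_derivative[OF C1_transition[OF c d]] ES that by blast
    show "0 \<le> vol (F \<circ> d) v" if "v \<in> ?\<tau> ` E" for v
      using X.det_metric_pos[of v] that img by auto
    show "(\<lambda>u. indicator E u * (\<bar>det (jac ?\<tau> u)\<bar> * vol (F \<circ> d) (?\<tau> u))) \<in> borel_measurable borel"
      unfolding eq by (rule mE)
    show "(\<lambda>v. indicator (?\<tau> ` E) v * vol (F \<circ> d) v) \<in> borel_measurable borel"
      unfolding img by (rule mV)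
  qed
  then have "(\<integral>\<^sup>+u. ennreal (indicator E u * vol (F \<circ> c) u) \<partial>lborel)
      = (\<integral>\<^sup>+v. ennreal (indicator (V \<inter> d -` B) v * vol (F \<circ> d) v) \<partial>lborel)"
    unfolding eq img .
  moreover have "ennreal (indicator S x * r) = ennreal r * indicator S x" for S :: "(real ^ 'n) set" and x r
    by (simp add: indicator_def)
  ultimately show ?thesis
    unfolding emeasure_chart_measure[OF c B(1)] emeasure_chart_measure[OF d B(1)] by (simp add: E_def)
qed

definition is_volume_measure :: "'m measure \<Rightarrow> bool" where
  "is_volume_measure \<sigma> \<longleftrightarrow> sets \<sigma> = sets borel \<and>
     (\<forall>(U, c)\<in>\<A>. \<forall>E\<in>sets borel. E \<subseteq> U \<longrightarrow>
        emeasure \<sigma> (c ` E) = (\<integral>\<^sup>+u\<in>E. ennreal (vol (F \<circ> c) u) \<partial>lborel))"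

lemma is_volume_measure_iff:
  "is_volume_measure \<sigma> \<longleftrightarrow> sets \<sigma> = sets borel \<and>
     (\<forall>(U, c)\<in>\<A>. \<forall>B\<in>sets borel. B \<subseteq> c ` U \<longrightarrow> emeasure \<sigma> B = emeasure (chart_measure U c) B)"
proof -
  have "(\<forall>E\<in>sets borel. E \<subseteq> U \<longrightarrow> emeasure \<sigma> (c ` E) = (\<integral>\<^sup>+u\<in>E. ennreal (vol (F \<circ> c) u) \<partial>lborel))
    \<longleftrightarrow> (\<forall>B\<in>sets borel. B \<subseteq> c ` U \<longrightarrow> emeasure \<sigma> B = emeasure (chart_measure U c) B)" (is "?L \<longleftrightarrow> ?R")
    if "(U, c) \<in> \<A>" for U c
  proof (intro iffI ballI impI)
    fix B assume L: ?L and B: "B \<in> sets borel" "B \<subseteq> c ` U"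
    have "c ` (U \<inter> c -` B) = B" using B(2) by auto
    then show "emeasure \<sigma> B = emeasure (chart_measure U c) B"
      using L[rule_format, OF chart_vimage_borel[OF that B(1)]] emeasure_chart_measure[OF that B(1)] by simp
  next
    fix E assume R: ?R and E: "E \<in> sets borel" "E \<subseteq> U"
    have "U \<inter> c -` (c ` E) = E" using E(2) chart_inj[OF that] by (auto simp: inj_on_def subset_eq) 
    then show "emeasure \<sigma> (c ` E) = (\<integral>\<^sup>+u\<in>E. ennreal (vol (F \<circ> c) u) \<partial>lborel)"
      using R[rule_format, OF chart_image_borel[OF that E]] E(2)
        emeasure_chart_measure[OF that chart_image_borel[OF that E]] by auto
  qed
  then show ?thesis unfolding is_volume_measure_def by fast
qed

lemma is_volume_measureD:
  assumes "is_volume_measure \<sigma>" "(U, c) \<in> \<A>" "B \<in> sets borel" "B \<subseteq> c ` U"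
  shows "emeasure \<sigma> B = emeasure (chart_measure U c) B"
  using assms unfolding is_volume_measure_iff by blast

text \<open>
  By second countability countably many charts cover the hypersurface, and their images can be made
  disjoint.
\<close>
lemma countable_borel_partition:
  obtains U c B where "\<And>n::nat. (U n, c n) \<in> \<A>" "\<And>n. B n \<in> sets borel" "\<And>n. B n \<subseteq> c n ` U n"
    "disjoint_family B" "(\<Union>n. B n) = UNIV"
proof -
  let ?I = "\<lambda>C. snd C ` fst C :: 'm set"
  have open_I: "open S" if "S \<in> ?I ` \<A>" for S using that chart_open_image by auto
  obtain G where G: "G \<subseteq> ?I ` \<A>" "countable G" "\<Union>G = \<Union>(?I ` \<A>)"
    using Lindelof[of "?I ` \<A>"] open_I by auto
  have cover: "\<Union>(?I ` \<A>) = UNIV"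
    using chart_cover by (simp add: case_prod_beta)
  then have "G \<noteq> {}" using G(3) by auto
  then have rng: "range (from_nat_into G) = G" using G(2) by (rule range_from_nat_into)
  have "\<forall>n. \<exists>C. C \<in> \<A> \<and> ?I C = from_nat_into G n"
  proof
    fix n
    have "from_nat_into G n \<in> ?I ` \<A>" using rng G(1) by blast
    then show "\<exists>C. C \<in> \<A> \<and> ?I C = from_nat_into G n" by (elim imageE) (rule exI, simp)
  qed
  then obtain C where C: "\<And>n. C n \<in> \<A>" "\<And>n. ?I (C n) = from_nat_into G n" by metis
  let ?B = "disjointed (\<lambda>n. ?I (C n))"
  have "(\<Union>n. ?I (C n)) = UNIV" unfolding C(2) using rng G(3) cover by simp
  then have "(\<Union>n. ?B n) = UNIV" by (simp add: UN_disjointed_eq)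
  moreover have "?B n \<in> sets borel" for n
  proof -
    have "open (?I (C n))" for n
      using C(1) open_I by blast
    then show ?thesis unfolding disjointed_def by (intro sets.Diff sets.finite_UN borel_open) auto
  qed
  moreover have "(fst (C n), snd (C n)) \<in> \<A>" for n using C(1) by simp
  ultimately show ?thesis
    using that disjointed_subset[of "\<lambda>n. ?I (C n)"] disjoint_family_disjointed[of "\<lambda>n. ?I (C n)"] by meson
qed

text \<open>
  The chart measures are glued along a countable Borel partition into pieces of charts. Compatibility
  on overlaps shows that the result agrees with every chart measure, and countable additivity over the
  same partition forces uniqueness.
\<close>
lemma ex1_volume_measure: "\<exists>!\<sigma>. is_volume_measure \<sigma>"
proof -
  obtain U c B where ch: "\<And>n::nat. (U n, c n) \<in> \<A>" and B: "\<And>n. B n \<in> sets borel" "\<And>n. B n \<subseteq> c n ` U n"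
    "disjoint_family B" "(\<Union>n. B n) = UNIV"
    by (rule countable_borel_partition) blast
  define \<mu> where "\<mu> E = (\<integral>\<^sup>+n. emeasure (chart_measure (U n) (c n)) (E \<inter> B n) \<partial>count_space UNIV)" for E
  \<comment> \<open>every Borel measure on the hypersurface is determined by its values inside the pieces\<close>
  have split: "emeasure M E = (\<integral>\<^sup>+n. emeasure M (E \<inter> B n) \<partial>count_space UNIV)"
    if "sets M = sets borel" "E \<in> sets borel" for M E
  proof -
    have "E = (\<Union>n. E \<inter> B n)" using B(4) by blast
    then have "emeasure M E = emeasure M (\<Union>n. E \<inter> B n)" by simp
    also have "\<dots> = (\<Sum>n. emeasure M (E \<inter> B n))"
    proof (rule suminf_emeasure[symmetric])
      show "disjoint_family (\<lambda>n. E \<inter> B n)" using B(3) unfolding disjoint_family_on_def by blast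
    qed (use that B(1) in auto)
    finally show ?thesis by (simp add: nn_integral_count_space_nat)
  qed
  define \<sigma> where "\<sigma> = measure_of UNIV (sets borel) \<mu>"
  have sets: "sets \<sigma> = sets borel"
    unfolding \<sigma>_def by (metis sets.sets_measure_of_eq space_borel)
  have emeasure: "emeasure \<sigma> E = \<mu> E" if "E \<in> sets borel" for E
  proof (rule emeasure_measure_of[OF \<sigma>_def])
    show "positive (sets \<sigma>) \<mu>" by (simp add: positive_def \<mu>_def)
    show "countably_additive (sets \<sigma>) \<mu>"
    proof (rule countably_additiveI)
      fix A :: "nat \<Rightarrow> 'm set" assume A: "range A \<subseteq> sets \<sigma>" "disjoint_family A"
      have "(\<Sum>i. \<mu> (A i)) = (\<integral>\<^sup>+n. (\<Sum>i. emeasure (chart_measure (U n) (c n)) (A i \<inter> B n)) \<partial>count_space UNIV)"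
        unfolding \<mu>_def by (subst nn_integral_suminf) auto
      also have "\<dots> = (\<integral>\<^sup>+n. emeasure (chart_measure (U n) (c n)) (\<Union>i. A i \<inter> B n) \<partial>count_space UNIV)"
      proof (intro nn_integral_cong suminf_emeasure)
        show "disjoint_family (\<lambda>i. A i \<inter> B n)" for n
          using A(2) unfolding disjoint_family_on_def by blast
      qed (use A(1) B(1) sets in auto)
      finally show "(\<Sum>i. \<mu> (A i)) = \<mu> (\<Union>i. A i)" by (simp add: \<mu>_def)
    qed
  qed (use that sets in auto)
  have "is_volume_measure \<sigma>"
    unfolding is_volume_measure_iff
  proof (intro conjI sets ballI, clarify)
    fix V d E assume d: "(V, d) \<in> \<A>" and E: "E \<in> sets borel" "E \<subseteq> d ` V"
    have "emeasure \<sigma> E = (\<integral>\<^sup>+n. emeasure (chart_measure (U n) (c n)) (E \<inter> B n) \<partial>count_space UNIV)"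
      by (simp add: emeasure[OF E(1)] \<mu>_def)
    also have "\<dots> = (\<integral>\<^sup>+n. emeasure (chart_measure V d) (E \<inter> B n) \<partial>count_space UNIV)"
      using B E by (intro nn_integral_cong chart_measure_compatible ch d) auto
    also have "\<dots> = emeasure (chart_measure V d) E"
      by (rule split[symmetric]) (use E in auto)
    finally show "emeasure \<sigma> E = emeasure (chart_measure V d) E" .
  qed
  moreover have "\<sigma>' = \<sigma>" if "is_volume_measure \<sigma>'" for \<sigma>'
  proof (rule measure_eqI)
    show s: "sets \<sigma>' = sets \<sigma>" using that sets by (simp add: is_volume_measure_def)
    fix E assume "E \<in> sets \<sigma>'"
    then have E: "E \<in> sets borel" using s sets by simp
    have "emeasure \<sigma>' E = (\<integral>\<^sup>+n. emeasure \<sigma>' (E \<inter> B n) \<partial>count_space UNIV)"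
      by (rule split) (use s sets E in auto)
    also have "\<dots> = \<mu> E"
      unfolding \<mu>_def using B E by (intro nn_integral_cong is_volume_measureD[OF that ch]) auto
    finally show "emeasure \<sigma>' E = emeasure \<sigma> E" by (simp add: emeasure[OF E])
  qed
  ultimately show ?thesis by blast
qed

abbreviation \<sigma> :: "'m measure" where "\<sigma> \<equiv> volume_measure \<A> F"

lemma is_volume_measure: "is_volume_measure \<sigma>"
  using theI'[OF ex1_volume_measure] unfolding volume_measure_def is_volume_measure_def by simp

lemma sets_volume_measure [simp]: "sets \<sigma> = sets borel"
  using is_volume_measure by (simp add: is_volume_measure_iff)

lemma space_volume_measure [simp]: "space \<sigma> = UNIV"
  using sets_eq_imp_space_eq[OF sets_volume_measure] by simp

lemma measurable_volume_measure [simp]: "measurable \<sigma> N = measurable borel N"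
  by (rule measurable_cong_sets) simp_all

text \<open>
  Equality of measures, and not only of their values on subsets of a chart, is what transports
  Bochner integrals to coordinates.
\<close>
lemma density_volume_measure:
  assumes "(U, c) \<in> \<A>"
  shows "density \<sigma> (\<lambda>p. ennreal (indicator (c ` U) p)) = chart_measure U c"
proof (rule measure_eqI)
  fix B assume "B \<in> sets (density \<sigma> (\<lambda>p. ennreal (indicator (c ` U) p)))"
  then have B: "B \<in> sets borel" by simp
  have cU: "c ` U \<in> sets borel" using chart_open_image[OF assms] by simp
  have "emeasure (density \<sigma> (\<lambda>p. ennreal (indicator (c ` U) p))) B = (\<integral>\<^sup>+p. ennreal (indicator (c ` U) p) * indicator B p \<partial>\<sigma>)"
    using B cU by (intro emeasure_density) auto
  also have "\<dots> = (\<integral>\<^sup>+p. indicator (c ` U \<inter> B) p \<partial>\<sigma>)"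
    by (intro nn_integral_cong) (auto simp: indicator_def)
  also have "\<dots> = emeasure \<sigma> (c ` U \<inter> B)"
    using B cU by (intro nn_integral_indicator) auto
  also have "\<dots> = emeasure (chart_measure U c) (c ` U \<inter> B)"
    using B cU by (intro is_volume_measureD[OF is_volume_measure assms]) auto
  also have "\<dots> = emeasure (chart_measure U c) B"
  proof -
    have "U \<inter> c -` (c ` U \<inter> B) = U \<inter> c -` B" by auto
    then show ?thesis using emeasure_chart_measure[OF assms] B cU by simp
  qed
  finally show "emeasure (density \<sigma> (\<lambda>p. ennreal (indicator (c ` U) p))) B = emeasure (chart_measure U c) B" .
qed simp

lemma integral_volume_measure_chart:
  fixes f :: "'m \<Rightarrow> real"
  assumes c: "(U, c) \<in> \<A>" and f: "f \<in> borel_measurable borel" and f0: "\<And>p. p \<notin> c ` U \<Longrightarrow> f p = 0"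
  shows "integrable \<sigma> f \<longleftrightarrow> integrable lborel (\<lambda>u. indicator U u * (vol (F \<circ> c) u * f (c u)))"
    and "(LINT p|\<sigma>. f p) = (LINT u|lborel. indicator U u * (vol (F \<circ> c) u * f (c u)))"
proof -
  let ?c = "\<lambda>u. if u \<in> U then c u else undefined"
  interpret immersed_patch "F \<circ> c" U by (rule patch[OF c])
  have cU: "(\<lambda>p. indicator (c ` U) p :: real) \<in> borel_measurable borel" using chart_open_image[OF c] by simp
  have f_eq: "f = (\<lambda>p. indicator (c ` U) p *\<^sub>R f p)" using f0 by (force simp: indicator_def)
  have fc: "(\<lambda>u. f (?c u)) \<in> borel_measurable borel"
    using measurable_compose[OF chart_extension_measurable[OF c] f] by simp
  have nonneg: "0 \<le> indicator U u * vol (F \<circ> c) u" for u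
    using det_metric_pos[of u] by (cases "u \<in> U") (auto simp: less_imp_le)
  have eq: "(\<lambda>u. (indicator U u * vol (F \<circ> c) u) *\<^sub>R f (?c u)) = (\<lambda>u. indicator U u * (vol (F \<circ> c) u * f (c u)))"
    by (auto simp: indicator_def)
  have "integrable \<sigma> f \<longleftrightarrow> integrable (chart_measure U c) f"
    using f cU by (subst f_eq, subst density_volume_measure[OF c, symmetric], subst integrable_density) auto
  also have "\<dots> \<longleftrightarrow> integrable (density lborel (\<lambda>u. ennreal (indicator U u * vol (F \<circ> c) u))) (\<lambda>u. f (?c u))"
    unfolding chart_measure_def using f chart_extension_measurable[OF c] by (intro integrable_distr_eq) auto
  also have "\<dots> \<longleftrightarrow> integrable lborel (\<lambda>u. (indicator U u * vol (F \<circ> c) u) *\<^sub>R f (?c u))"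
    using fc vol_measurable[OF c] nonneg by (intro integrable_density) auto
  finally show "integrable \<sigma> f \<longleftrightarrow> integrable lborel (\<lambda>u. indicator U u * (vol (F \<circ> c) u * f (c u)))"
    unfolding eq .
  have "(LINT p|\<sigma>. f p) = (LINT p|chart_measure U c. f p)"
    using f cU by (subst f_eq, subst density_volume_measure[OF c, symmetric], subst integral_density) auto
  also have "\<dots> = (LINT u|density lborel (\<lambda>u. ennreal (indicator U u * vol (F \<circ> c) u)). f (?c u))"
    unfolding chart_measure_def using f chart_extension_measurable[OF c] by (intro integral_distr) auto
  also have "\<dots> = (LINT u|lborel. (indicator U u * vol (F \<circ> c) u) *\<^sub>R f (?c u))"
    using fc vol_measurable[OF c] nonneg by (intro integral_density) auto
  finally show "(LINT p|\<sigma>. f p) = (LINT u|lborel. indicator U u * (vol (F \<circ> c) u * f (c u)))"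
    unfolding eq .
qed

end

section \<open>Weighted Green densities\<close>
lemma green_density_eq_0:
  assumes "open S" "u \<in> S" "\<And>y. y \<in> S \<Longrightarrow> a y = 0"
  shows "green_density X a b u = 0"
proof -
  have "partial j a u = 0" for j
    using partial_cong_open[of S u a "\<lambda>y. 0"] assms by simp
  then show ?thesis using assms by (simp add: green_density_def gradient_def)
qed

lemma partial_add:
  assumes "f differentiable (at u)" "g differentiable (at u)"
  shows "partial i (\<lambda>x. f x + g x) u = partial i f u + partial i g u"
proof -
  have "((\<lambda>x. f x + g x) has_derivative (\<lambda>v. frechet_derivative f (at u) v + frechet_derivative g (at u) v)) (at u)"
    using assms by (intro has_derivative_add) (simp_all add: frechet_derivative_works[symmetric])
  then show ?thesis by (subst partial_eqI) (auto simp: partial_def)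
qed

lemma gradient_add:
  assumes "f differentiable (at u)" "g differentiable (at u)"
  shows "gradient X (\<lambda>x. f x + g x) u = gradient X f u + gradient X g u"
  by (simp add: gradient_def partial_add[OF assms] distrib_left scaleR_add_left sum.distrib)

lemma gradient_mult:
  assumes "f differentiable (at u)" "g differentiable (at u)"
  shows "gradient X (\<lambda>x. f x * g x) u = f u *\<^sub>R gradient X g u + g u *\<^sub>R gradient X f u"
  by (simp add: gradient_def partial_mult[OF assms] distrib_left scaleR_add_left sum.distrib scaleR_sum_right ac_simps)

lemma gradient_exp:
  fixes h :: "real ^ 'n::finite \<Rightarrow> real"
  assumes "h differentiable (at u)"
  shows "gradient X (\<lambda>x. exp (h x)) u = exp (h u) *\<^sub>R gradient X h u"
proof -
  have "((\<lambda>x. exp (h x)) has_derivative (\<lambda>v. exp (h u) * frechet_derivative h (at u) v)) (at u)"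
    using assms by (auto intro!: derivative_eq_intros simp: frechet_derivative_works)
  then have "partial j (\<lambda>x. exp (h x)) u = exp (h u) * partial j h u" for j
    by (subst partial_eqI) (auto simp: partial_def)
  then show ?thesis by (simp add: gradient_def scaleR_sum_right ac_simps)
qed

context immersed_patch
begin

lemma continuous_green_density:
  assumes a: "C1_on a U" and b: "Ck_on 2 b U"
  shows "continuous_on U (green_density X a b)"
proof -
  note cont = C1_on_continuous[OF C1_ginv] C1_on_continuous[OF C1_partial] C1_on_continuous[OF a]
    continuous_on_partial[OF a] continuous_on_partial[OF C1_gradient[OF b]] C1_on_continuous[OF C1_gradient[OF b]]
  have "continuous_on U (gradient X a)"
    unfolding gradient_def[abs_def] by (intro continuous_intros cont)
  moreover have "continuous_on U (laplacian X b)"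
    unfolding laplacian_def[abs_def] divergence_def by (intro continuous_intros cont)
  ultimately show ?thesis
    unfolding green_density_def[abs_def] by (intro continuous_intros cont)
qed

lemma gradient_square_norm_position_inner:
  assumes "u \<in> U"
  shows "gradient X (\<lambda>u. (norm (X u))\<^sup>2 / 4) u \<bullet> gradient X f u = 1/2 * (X u \<bullet> gradient X f u)"
proof -
  have "normal_component X u (X u) \<bullet> gradient X f u = 0"
    using partial_inner_normal_component[OF assms, of _ "X u"]
    by (simp add: inner_gradient_right[OF assms] inner_commute[of "normal_component X u (X u)"])
  then show ?thesis
    by (simp add: gradient_square_norm_position[OF assms] inner_diff_left)
qed

text \<open>
  The weight turns the Laplacian into the drift Laplacian \<open>\<Delta>f + \<langle>X, \<nabla>f\<rangle>/2\<close>, because the gradient of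
  \<open>|X|\<^sup>2/4\<close> is half the tangential part of \<open>X\<close>.
\<close>
lemma green_density_drift_laplacian:
  assumes f: "Ck_on 2 f U" and u: "u \<in> U"
  shows "green_density X (\<lambda>u. f u * exp ((norm (X u))\<^sup>2 / 4)) f u =
    (f u * (laplacian X f u + 1/2 * (X u \<bullet> gradient X f u)) + (norm (gradient X f u))\<^sup>2) * exp ((norm (X u))\<^sup>2 / 4)"
proof -
  let ?h = "\<lambda>u. (norm (X u))\<^sup>2 / 4"
  have h: "C1_on ?h U" by (rule C2_on_imp_C1_on[OF C2_square_norm_position])
  have "gradient X (\<lambda>u. f u * exp (?h u)) u = (f u * exp (?h u)) *\<^sub>R gradient X ?h u + exp (?h u) *\<^sub>R gradient X f u"
    using gradient_mult[of f u "\<lambda>u. exp (?h u)" X] gradient_exp[of ?h u X]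
      C1_on_differentiable[OF h u] C1_on_differentiable[OF C1_on_exp[OF h] u] C1_on_differentiable[OF C2_on_imp_C1_on[OF f] u]
    by simp
  then show ?thesis
    by (simp add: green_density_def inner_add_left gradient_square_norm_position_inner[OF u]
        power2_norm_eq_inner[of "gradient X f u"] algebra_simps)
qed

text \<open>
  The terms \<open>2 f \<langle>\<nabla>f, \<nabla>h\<rangle> + f\<^sup>2 |\<nabla>h|\<^sup>2\<close> are written as \<open>|\<nabla>f + f \<nabla>h|\<^sup>2 - |\<nabla>f|\<^sup>2\<close>: the negative term is the
  one that cancels against the stability form.
\<close>
lemma green_density_square_norm_position:
  assumes f: "Ck_on 2 f U" and u: "u \<in> U"
  shows "green_density X (\<lambda>u. (f u)\<^sup>2 * exp ((norm (X u))\<^sup>2 / 4)) (\<lambda>u. (norm (X u))\<^sup>2 / 4) u =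
    ((norm (gradient X f u + f u *\<^sub>R gradient X (\<lambda>u. (norm (X u))\<^sup>2 / 4) u))\<^sup>2 - (norm (gradient X f u))\<^sup>2
      + (f u)\<^sup>2 * (real CARD('n) / 2 + 1/2 * (normal_component X u (X u) \<bullet> mean_curv_vec X u))) * exp ((norm (X u))\<^sup>2 / 4)"
proof -
  let ?h = "\<lambda>u. (norm (X u))\<^sup>2 / 4"
  have h: "C1_on ?h U" by (rule C2_on_imp_C1_on[OF C2_square_norm_position])
  have f1: "C1_on f U" by (rule C2_on_imp_C1_on[OF f])
  have "gradient X (\<lambda>u. (f u * f u) * exp (?h u)) u
     = (f u * f u * exp (?h u)) *\<^sub>R gradient X ?h u + (2 * f u * exp (?h u)) *\<^sub>R gradient X f u"
    using gradient_mult[of "\<lambda>u. f u * f u" u "\<lambda>u. exp (?h u)" X] gradient_mult[of f u f X] gradient_exp[of ?h u X]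
      C1_on_differentiable[OF h u] C1_on_differentiable[OF C1_on_exp[OF h] u] C1_on_differentiable[OF f1 u]
      C1_on_differentiable[OF C1_on_mult[OF f1 f1] u]
    by (simp add: algebra_simps scaleR_2[symmetric])
  then show ?thesis
    by (simp add: green_density_def laplacian_square_norm_position[OF u] power2_eq_square[of "f _"]
        power2_norm_eq_inner[of "gradient X f u"] power2_norm_eq_inner[of "gradient X f u + _"]
        inner_add_left inner_add_right inner_commute algebra_simps)
qed

end

section \<open>Green's formula on the hypersurface\<close>

text \<open>
  Cutting up the function \<open>a\<close> of Green's formula only takes cut-off functions with one continuous
  derivative. They are obtained by composing this function with itself: \<open>1 - pos_square t\<close> is \<open>1\<close> for
  \<open>t \<le> 0\<close> and at most \<open>0\<close> for \<open>t \<ge> 1\<close>, so one more application gives a function of \<open>t\<close> that is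
  constantly \<open>1\<close> and then constantly \<open>0\<close>.
\<close>
definition pos_square :: "real \<Rightarrow> real" where "pos_square t = (max 0 t)\<^sup>2"

lemma pos_square_has_derivative: "(pos_square has_field_derivative 2 * max 0 t) (at t)"
proof (cases "t = 0")
  case True
  have "((\<lambda>h. (pos_square (0 + h) - pos_square 0) / h) \<longlongrightarrow> 0) (at 0)"
  proof (rule Lim_null_comparison)
    show "\<forall>\<^sub>F h in at 0. norm ((pos_square (0 + h) - pos_square 0) / h) \<le> \<bar>h\<bar>"
      by (auto simp: pos_square_def max_def power2_eq_square intro!: always_eventually)
    show "((\<lambda>h. \<bar>h\<bar>) \<longlongrightarrow> 0) (at (0::real))" by (auto intro!: tendsto_eq_intros)
  qed
  then show ?thesis using True by (simp add: DERIV_def)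
next
  case False
  show ?thesis
  proof (cases "t > 0")
    case True
    have "((\<lambda>t. t\<^sup>2) has_field_derivative 2 * max 0 t) (at t)"
      using True by (auto intro!: derivative_eq_intros)
    then show ?thesis
      by (rule has_field_derivative_transform_within_open[of _ _ _ "{0<..}"]) (use True in \<open>auto simp: pos_square_def\<close>)
  next
    case neg: False
    have "((\<lambda>t. 0) has_field_derivative 2 * max 0 t) (at t)"
      using neg by (auto intro!: derivative_eq_intros)
    then show ?thesis
      by (rule has_field_derivative_transform_within_open[of _ _ _ "{..<0}"]) (use neg False in \<open>auto simp: pos_square_def\<close>)
  qed
qed

lemma C1_on_pos_square: "C1_on f S \<Longrightarrow> C1_on (\<lambda>x. pos_square (f x)) S"
  by (erule C1_on_compose_real[where g'="\<lambda>t. 2 * max 0 t"]) (auto intro!: pos_square_has_derivative continuous_intros)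

text \<open>
  The argument of the inner function is \<open>0\<close> on the sphere of radius \<open>r\<close> and \<open>1\<close> on that of radius \<open>2 r\<close>.
\<close>
definition plateau :: "'a::real_inner \<Rightarrow> real \<Rightarrow> 'a \<Rightarrow> real" where
  "plateau z r x = pos_square (1 - pos_square (((x - z) \<bullet> (x - z) - r\<^sup>2) / (3 * r\<^sup>2)))"

lemma plateau_eq_1:
  assumes "x \<in> ball z r"
  shows "plateau z r x = 1"
proof -
  have "(x - z) \<bullet> (x - z) \<le> r\<^sup>2"
    using assms by (simp add: dist_norm norm_minus_commute power2_norm_eq_inner[symmetric] power_mono)
  then have "((x - z) \<bullet> (x - z) - r\<^sup>2) / (3 * r\<^sup>2) \<le> 0"
    by (simp add: divide_nonpos_nonneg)
  then show ?thesis by (simp add: plateau_def pos_square_def)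
qed

lemma plateau_eq_0:
  assumes "x \<notin> cball z (2 * r)" "r > 0"
  shows "plateau z r x = 0"
proof -
  have "(2 * r)\<^sup>2 \<le> (norm (x - z))\<^sup>2"
    using assms by (intro power_mono) (auto simp: dist_norm norm_minus_commute)
  then have "4 * r\<^sup>2 \<le> (x - z) \<bullet> (x - z)" by (simp add: power2_norm_eq_inner power_mult_distrib)
  then have "1 \<le> ((x - z) \<bullet> (x - z) - r\<^sup>2) / (3 * r\<^sup>2)" using assms(2) by (simp add: field_simps)
  then have "1 \<le> pos_square (((x - z) \<bullet> (x - z) - r\<^sup>2) / (3 * r\<^sup>2))"
    by (simp add: pos_square_def)
  then show ?thesis by (simp add: plateau_def pos_square_def)
qed

lemma C1_on_plateau:
  assumes "C1_on f S"
  shows "C1_on (\<lambda>x. plateau z r (f x)) S"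
  unfolding plateau_def divide_inverse
  by (intro C1_on_pos_square C1_on_diff C1_on_const C1_on_mult C1_on_inner assms)

lemma C1_on_Un:
  assumes "C1_on f S" "C1_on f T" "open S" "open T"
  shows "C1_on f (S \<union> T)"
  using assms by (auto intro: continuous_on_open_Un)

context hypersurface
begin

text \<open>
  Regularity of finite order, since the cut-off functions are only once differentiable.
\<close>
definition Ck_map :: "nat \<Rightarrow> ('m \<Rightarrow> real) \<Rightarrow> bool" where
  "Ck_map k f \<longleftrightarrow> (\<forall>(U, c)\<in>\<A>. Ck_on k (f \<circ> c) U)"

lemma Ck_mapD: "Ck_map k f \<Longrightarrow> (U, c) \<in> \<A> \<Longrightarrow> Ck_on k (\<lambda>u. f (c u)) U"
  by (auto simp: Ck_map_def o_def)

lemma Ck_mapI: "(\<And>U c. (U, c) \<in> \<A> \<Longrightarrow> Ck_on k (\<lambda>u. f (c u)) U) \<Longrightarrow> Ck_map k f"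
  by (auto simp: Ck_map_def o_def)

lemma obtain_param_at:
  obtains V where "(V, param_at \<A> p) \<in> \<A>" "coord_at \<A> p \<in> V" "param_at \<A> p (coord_at \<A> p) = p"
proof -
  obtain U c where "(U, c) \<in> \<A>" "p \<in> c ` U" by (rule obtain_chart)
  then have "\<exists>C. C \<in> \<A> \<and> p \<in> snd C ` fst C" by (intro exI[of _ "(U, c)"]) simp
  note some = someI_ex[OF this]
  obtain V d where *: "(SOME C. C \<in> \<A> \<and> p \<in> snd C ` fst C) = (V, d)"
    by (rule prod.exhaust)
  with some have "(V, d) \<in> \<A>" "p \<in> d ` V" by auto
  then show ?thesis
    using * by (intro that[of V]) (simp_all add: param_at_def coord_at_def inv_into_into f_inv_into_f)
qed

definition green :: "('m \<Rightarrow> real) \<Rightarrow> ('m \<Rightarrow> real) \<Rightarrow> 'm \<Rightarrow> real" where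
  "green a b p = green_density (F \<circ> param_at \<A> p) (a \<circ> param_at \<A> p) (b \<circ> param_at \<A> p) (coord_at \<A> p)"

lemma green_chart:
  assumes a: "Ck_map (Suc 0) a" and b: "Ck_map 2 b" and c: "(U, c) \<in> \<A>" and u: "u \<in> U"
  shows "green a b (c u) = green_density (F \<circ> c) (a \<circ> c) (b \<circ> c) u"
proof -
  define p where "p = c u"
  define d where "d = param_at \<A> p"
  obtain V where V: "(V, d) \<in> \<A>" "coord_at \<A> p \<in> V" "d (coord_at \<A> p) = p"
    using obtain_param_at[of p] unfolding d_def by blast
  interpret reparametrization "F \<circ> d" V "F \<circ> c" "overlap U c V d" "inv_into V d \<circ> c"
    by (rule transition_reparametrization[OF c V(1)])
  have uS: "u \<in> overlap U c V d"
    unfolding overlap_def using u V by (metis IntI image_eqI vimageI p_def)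
  have coord: "(inv_into V d \<circ> c) u = coord_at \<A> p"
    using chart_inverse[OF V(1,2)] V(3) by (simp add: p_def)
  have eq: "d ((inv_into V d \<circ> c) y) = c y" if "y \<in> overlap U c V d" for y
    using that by (auto simp: overlap_def f_inv_into_f)
  have "green_density (F \<circ> c) (a \<circ> c) (b \<circ> c) u = green_density (F \<circ> d) (a \<circ> d) (b \<circ> d) ((inv_into V d \<circ> c) u)"
  proof (rule green_density_change[OF uS])
    show "a \<circ> d differentiable (at ((inv_into V d \<circ> c) u))"
      using C1_on_differentiable[OF Ck_mapD[OF a V(1)] V(2)] unfolding coord by (simp add: o_def)
    show "Ck_on 2 (b \<circ> d) V" using Ck_mapD[OF b V(1)] by (simp add: o_def)
  qed (use eq in simp_all)
  then show ?thesis
    unfolding p_def[symmetric] green_def d_def[symmetric] by (simp only: coord)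
qed

lemma green_eq_0:
  assumes "closed K" "\<And>q. q \<notin> K \<Longrightarrow> a q = 0" "p \<notin> K"
  shows "green a b p = 0"
proof -
  obtain V where V: "(V, param_at \<A> p) \<in> \<A>" "coord_at \<A> p \<in> V" "param_at \<A> p (coord_at \<A> p) = p"
    by (rule obtain_param_at)
  show ?thesis
    unfolding green_def
    by (rule green_density_eq_0[OF open_chart_vimage[OF V(1), of "- K"]]) (use assms V in auto)
qed

text \<open>
  The support of the integrand is a compact subset of the chart, so that in coordinates everything
  is continuous with compact support.
\<close>
lemma green_formula_in_chart:
  assumes a: "Ck_map (Suc 0) a" and b: "Ck_map 2 b" and c: "(U, c) \<in> \<A>"
    and K: "compact K" "K \<subseteq> c ` U" "\<And>p. p \<notin> K \<Longrightarrow> a p = 0"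
  shows "integrable \<sigma> (green a b) \<and> (LINT p|\<sigma>. green a b p) = 0"
proof -
  interpret immersed_patch "F \<circ> c" U by (rule patch[OF c])
  define g where "g = green_density (F \<circ> c) (a \<circ> c) (b \<circ> c)"
  have aC: "C1_on (a \<circ> c) U" and bC: "Ck_on 2 (b \<circ> c) U"
    using Ck_mapD[OF a c] Ck_mapD[OF b c] by (simp_all only: o_def)
  have contg: "continuous_on U g"
    unfolding g_def by (rule continuous_green_density[OF aC bC])
  have green_c: "green a b (c u) = g u" if "u \<in> U" for u
    unfolding g_def by (rule green_chart[OF a b c that])
  have closed: "closed K" by (rule compact_imp_closed[OF K(1)])
  have green0: "green a b p = 0" if "p \<notin> K" for p by (rule green_eq_0[OF closed K(3) that])
  define K' where "K' = inv_into U c ` K"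
  have K': "compact K'" "K' \<subseteq> U"
    unfolding K'_def using K chart_inverse_continuous[OF c]
    by (auto intro: compact_continuous_image continuous_on_subset inv_into_into)
  have cK: "c u \<in> K \<Longrightarrow> u \<in> K'" if "u \<in> U" for u
    unfolding K'_def using chart_inverse[OF c that] by (metis image_eqI)
  have g0: "g u = 0" if "u \<in> U - K'" for u
    using green_c[of u] green0[of "c u"] cK[of u] that by auto
  have meas: "green a b \<in> borel_measurable borel"
  proof -
    have "continuous_on (c ` U) (\<lambda>p. g (inv_into U c p))"
      by (rule continuous_on_compose2[OF contg chart_inverse_continuous[OF c]]) (auto intro: inv_into_into)
    then have "(\<lambda>p. if p \<in> c ` U then g (inv_into U c p) else 0) \<in> borel_measurable borel"
      using chart_open_image[OF c] by (intro borel_measurable_continuous_on_if) auto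
    moreover have "(\<lambda>p. if p \<in> c ` U then g (inv_into U c p) else 0) = green a b"
      using K(2) green0 green_c chart_inverse[OF c] by (auto simp: fun_eq_iff)
    ultimately show ?thesis by simp
  qed
  have outside: "green a b p = 0" if "p \<notin> c ` U" for p
    using that K(2) green0 by auto
  have eq: "(\<lambda>u. indicator U u * (vol (F \<circ> c) u * green a b (c u))) = (\<lambda>u. indicator U u * (vol (F \<circ> c) u * g u))"
    by (auto simp: indicator_def green_c)
  have eq': "(\<lambda>u. indicator U u * (vol (F \<circ> c) u * g u)) = (\<lambda>u. indicator K' u *\<^sub>R (vol (F \<circ> c) u * g u))"
  proof
    fix u
    show "indicator U u * (vol (F \<circ> c) u * g u) = indicator K' u *\<^sub>R (vol (F \<circ> c) u * g u)"
      using g0[of u] K'(2) by (cases "u \<in> K'"; cases "u \<in> U") auto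
  qed
  have "integrable lborel (\<lambda>u. indicator K' u *\<^sub>R (vol (F \<circ> c) u * g u))"
    using K' contg C1_on_continuous[OF C1_sqrt_det_metric]
    by (intro borel_integrable_compact continuous_on_mult) (auto intro: continuous_on_subset)
  then have "integrable \<sigma> (green a b)"
    using integral_volume_measure_chart(1)[OF c meas outside] unfolding eq eq' by blast
  moreover have "(LINT p|\<sigma>. green a b p) = (LINT u|lborel. indicator U u * (vol (F \<circ> c) u * g u))"
    using integral_volume_measure_chart(2)[OF c meas outside] unfolding eq .
  moreover have "\<dots> = 0"
    unfolding g_def
    by (rule green_formula_patch[OF aC bC K']) (use cK K(3) in auto)
  ultimately show ?thesis by simp
qed

text \<open>
  The extension by zero is continuously differentiable in every chart, because the compact set
  \<open>K\<close> is closed in a Hausdorff space: the chart domain and the complement of \<open>K\<close> are two open sets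
  that cover the hypersurface.
\<close>
lemma obtain_bump:
  obtains S K U c \<beta> where "(U, c) \<in> \<A>" "open S" "p \<in> S" "compact K" "K \<subseteq> c ` U"
    "Ck_map (Suc 0) \<beta>" "\<And>q. q \<in> S \<Longrightarrow> \<beta> q = 1" "\<And>q. q \<notin> K \<Longrightarrow> \<beta> q = 0"
proof -
  obtain U c where c: "(U, c) \<in> \<A>" "p \<in> c ` U" by (rule obtain_chart)
  define z where "z = inv_into U c p"
  have z: "z \<in> U" "c z = p" using c(2) by (auto simp: z_def inv_into_into f_inv_into_f)
  obtain e where e: "e > 0" "cball z e \<subseteq> U"
    using open_contains_cball chart_open_domain[OF c(1)] z(1) by blast
  define r where "r = e / 2"
  have r: "r > 0" "cball z (2 * r) \<subseteq> U" "ball z r \<subseteq> U"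
    using e ball_subset_cball[of z r] subset_cball[of r "2 * r" z] by (auto simp: r_def)
  define K where "K = c ` cball z (2 * r)"
  define \<beta> where "\<beta> q = (if q \<in> c ` U then plateau z r (inv_into U c q) else 0)" for q
  have K: "compact K" "K \<subseteq> c ` U"
    unfolding K_def using r(2) by (auto intro: compact_continuous_image continuous_on_subset[OF chart_continuous[OF c(1)]])
  have \<beta>0: "\<beta> q = 0" if "q \<notin> K" for q
    using that r(1) plateau_eq_0[of "inv_into U c q" z r] unfolding \<beta>_def K_def
    by (metis f_inv_into_f image_eqI)
  have "Ck_map (Suc 0) \<beta>"
  proof (rule Ck_mapI)
    fix V d assume d: "(V, d) \<in> \<A>"
    have o1: "open (overlap V d U c)" by (rule open_overlap[OF d c(1)])
    have o2: "open (V \<inter> d -` (- K))"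
      using open_chart_vimage[OF d] compact_imp_closed[OF K(1)] by blast
    have "C1_on (\<lambda>v. \<beta> (d v)) (overlap V d U c)"
      by (rule C1_on_cong[OF o1 _ C1_on_plateau[OF C1_transition[OF d c(1)], of z r]])
        (auto simp: \<beta>_def overlap_def)
    moreover have "C1_on (\<lambda>v. \<beta> (d v)) (V \<inter> d -` (- K))"
      by (rule C1_on_cong[OF o2 _ C1_on_const[of 0]]) (simp add: \<beta>0)
    ultimately have "C1_on (\<lambda>v. \<beta> (d v)) (overlap V d U c \<union> V \<inter> d -` (- K))"
      using o1 o2 by (rule C1_on_Un)
    moreover have "overlap V d U c \<union> V \<inter> d -` (- K) = V"
      using K(2) by (auto simp: overlap_def)
    ultimately show "C1_on (\<lambda>v. \<beta> (d v)) V" by simp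
  qed
  moreover have "open (c ` ball z r)"
  proof -
    have "c ` ball z r = c ` U \<inter> inv_into U c -` ball z r"
      using r(3) chart_inverse[OF c(1)] by (auto simp: image_iff)
    moreover have "open (c ` U \<inter> inv_into U c -` ball z r)"
      using continuous_on_open_vimage[OF chart_open_image[OF c(1)]] chart_inverse_continuous[OF c(1)]
      by (metis Int_commute open_ball)
    ultimately show ?thesis by simp
  qed
  moreover have "\<beta> q = 1" if "q \<in> c ` ball z r" for q
  proof -
    obtain x where x: "x \<in> ball z r" "q = c x" using \<open>q \<in> c ` ball z r\<close> by blast
    then have "x \<in> U" using r(3) by blast
    then show ?thesis using x chart_inverse[OF c(1), of x] by (simp add: \<beta>_def plateau_eq_1)
  qed
  moreover have "p \<in> c ` ball z r" using z r(1) by auto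
  ultimately show ?thesis using that[OF c(1)] K \<beta>0 by blast
qed

lemma green_add:
  assumes "Ck_map (Suc 0) a" "Ck_map (Suc 0) a'"
  shows "green (\<lambda>p. a p + a' p) b p = green a b p + green a' b p"
proof -
  obtain V where V: "(V, param_at \<A> p) \<in> \<A>" "coord_at \<A> p \<in> V"
    by (rule obtain_param_at) 
  show ?thesis
    using gradient_add[where X="F \<circ> param_at \<A> p", OF C1_on_differentiable[OF Ck_mapD[OF assms(1) V(1)] V(2)]
        C1_on_differentiable[OF Ck_mapD[OF assms(2) V(1)] V(2)]]
    by (simp add: green_def green_density_def o_def inner_add_left algebra_simps)
qed

text \<open>
  Induction on the number of cut-off functions that are needed to cover the support. For one of
  them, \<open>\<beta>\<close>, the function \<open>a \<beta>\<close> lives in a single chart, while \<open>a (1 - \<beta>)\<close> vanishes where \<open>\<beta> = 1\<close> and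
  so needs one cut-off function less. Thus no quotients, as in a partition of unity, occur.
\<close>
lemma green_formula:
  assumes a: "Ck_map (Suc 0) a" and b: "Ck_map 2 b" and K: "compact K" "\<And>p. p \<notin> K \<Longrightarrow> a p = 0"
  shows "integrable \<sigma> (green a b) \<and> (LINT p|\<sigma>. green a b p) = 0"
proof -
  define good where "good S \<beta> \<longleftrightarrow> open S \<and> Ck_map (Suc 0) \<beta> \<and> (\<forall>q\<in>S. \<beta> q = 1) \<and>
     (\<exists>U c L. (U, c) \<in> \<A> \<and> compact L \<and> L \<subseteq> c ` U \<and> (\<forall>q. q \<notin> L \<longrightarrow> \<beta> q = 0))" for S \<beta>
  have "\<exists>S \<beta>. p \<in> S \<and> good S \<beta>" for p
    by (rule obtain_bump[of p]) (unfold good_def, blast)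
  then obtain S \<beta> where S: "\<And>p. p \<in> S p" "\<And>p. good (S p) (\<beta> p)" by metis
  have induct: "integrable \<sigma> (green a b) \<and> (LINT p|\<sigma>. green a b p) = 0"
    if "finite D" "compact K" "K \<subseteq> (\<Union>x\<in>D. S x)" "Ck_map (Suc 0) a" "\<And>p. p \<notin> K \<Longrightarrow> a p = 0" for D K a
    using that
  proof (induction D arbitrary: K a rule: finite_induct)
    case empty
    then have "green a b p = 0" for p using green_eq_0[of "{}" a p b] by simp
    then show ?case by simp
  next
    case (insert x D)
    obtain U c L where L: "(U, c) \<in> \<A>" "compact L" "L \<subseteq> c ` U" "\<And>q. q \<notin> L \<Longrightarrow> \<beta> x q = 0"
      using S(2)[of x] unfolding good_def by blast
    have \<beta>: "Ck_map (Suc 0) (\<beta> x)" "open (S x)" "\<And>q. q \<in> S x \<Longrightarrow> \<beta> x q = 1"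
      using S(2)[of x] unfolding good_def by auto
    let ?a1 = "\<lambda>p. a p * \<beta> x p" and ?a2 = "\<lambda>p. a p * (1 - \<beta> x p)"
    have a1: "Ck_map (Suc 0) ?a1"
      by (intro Ck_mapI C1_on_mult Ck_mapD[OF insert.prems(3)] Ck_mapD[OF \<beta>(1)])
    have a2: "Ck_map (Suc 0) ?a2"
      by (intro Ck_mapI C1_on_mult C1_on_diff C1_on_const Ck_mapD[OF insert.prems(3)] Ck_mapD[OF \<beta>(1)])
    have "integrable \<sigma> (green ?a1 b) \<and> (LINT p|\<sigma>. green ?a1 b p) = 0"
    proof (rule green_formula_in_chart[OF a1 b L(1-3)])
      show "?a1 p = 0" if "p \<notin> L" for p using L(4)[OF that] by simp
    qed
    moreover have "integrable \<sigma> (green ?a2 b) \<and> (LINT p|\<sigma>. green ?a2 b p) = 0"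
    proof (rule insert.IH[OF _ _ a2])
      show "compact (K - S x)" using insert.prems(1) \<beta>(2) by (rule compact_diff)
      show "K - S x \<subseteq> (\<Union>x\<in>D. S x)" using insert.prems(2) by auto
      show "?a2 p = 0" if "p \<notin> K - S x" for p
        using that insert.prems(4)[of p] \<beta>(3)[of p] by auto
    qed
    moreover have "green a b = (\<lambda>p. green ?a1 b p + green ?a2 b p)"
      using green_add[OF a1 a2, of b] by (simp add: fun_eq_iff algebra_simps)
    ultimately show ?case by simp
  qed
  have "open B" if "B \<in> range S" for B
    using S(2) that by (auto simp: good_def)
  moreover have "K \<subseteq> \<Union>(range S)"
    using S(1) by auto
  ultimately obtain \<D> where "\<D> \<subseteq> range S" "finite \<D>" "K \<subseteq> \<Union>\<D>"
    using compactE[OF K(1)] by metis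
  then obtain D where "finite D" "K \<subseteq> (\<Union>x\<in>D. S x)"
    by (metis finite_subset_image)
  then show ?thesis using induct K a by blast
qed

section \<open>Stability\<close>
lemma Ck_map_smooth: "smooth_map \<A> \<phi> \<Longrightarrow> Ck_map k \<phi>"
  unfolding smooth_map_def Ck_map_def using smooth_on_imp_Ck_on by fast

lemma Ck_map_2_imp_1: "Ck_map 2 \<phi> \<Longrightarrow> Ck_map (Suc 0) \<phi>"
  by (rule Ck_mapI, rule C2_on_imp_C1_on, erule (1) Ck_mapD)

lemma C2_square_norm: "Ck_map 2 (\<lambda>p. (norm (F p))\<^sup>2 / 4)"
  using immersed_patch.C2_square_norm_position[OF patch] by (intro Ck_mapI) simp

lemma green_drift_laplacian:
  assumes "smooth_map \<A> \<phi>"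
  shows "green (\<lambda>p. \<phi> p * exp ((norm (F p))\<^sup>2 / 4)) \<phi> p =
    \<phi> p * L_op \<A> F \<phi> p * exp ((norm (F p))\<^sup>2 / 4)
    + ((norm (grad \<A> F \<phi> p))\<^sup>2 - (A_norm2 \<A> F p - 1/2) * (\<phi> p)\<^sup>2) * exp ((norm (F p))\<^sup>2 / 4)"
proof -
  obtain V where V: "(V, param_at \<A> p) \<in> \<A>" "coord_at \<A> p \<in> V" "param_at \<A> p (coord_at \<A> p) = p"
    by (rule obtain_param_at)
  interpret immersed_patch "F \<circ> param_at \<A> p" V by (rule patch[OF V(1)])
  have f: "Ck_on 2 (\<phi> \<circ> param_at \<A> p) V"
    using Ck_mapD[OF Ck_map_smooth[OF assms] V(1)] by (simp add: o_def)
  have "green (\<lambda>p. \<phi> p * exp ((norm (F p))\<^sup>2 / 4)) \<phi> p =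
    (\<phi> p * (Laplace \<A> F \<phi> p + 1/2 * (F p \<bullet> grad \<A> F \<phi> p)) + (norm (grad \<A> F \<phi> p))\<^sup>2) * exp ((norm (F p))\<^sup>2 / 4)"
    using green_density_drift_laplacian[OF f V(2)] V(3)
    by (simp add: green_def Laplace_def grad_def o_def)
  then show ?thesis
    by (simp add: L_op_def power2_eq_square[of "\<phi> p"] algebra_simps)
qed

text \<open>
  The scalar curvature bound enters here. On a self-expander it reads
  \<open>|A|\<^sup>2 - 1/2 \<le> n/2 + |x\<^sup>\<bottom>|\<^sup>2/4\<close>, and the right-hand side is the Laplacian of \<open>|x|\<^sup>2/4\<close>.
\<close>
lemma stability_integrand_bound:
  assumes codim: "CARD('k) = CARD('n) + 1" and se: "self_expander \<A> F" 
    and scal: "Scal \<A> F p \<ge> - (real CARD('n) + 1) / 2" and \<phi>: "smooth_map \<A> \<phi>"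
  shows "0 \<le> ((norm (grad \<A> F \<phi> p))\<^sup>2 - (A_norm2 \<A> F p - 1/2) * (\<phi> p)\<^sup>2) * exp ((norm (F p))\<^sup>2 / 4)
    + green (\<lambda>p. (\<phi> p)\<^sup>2 * exp ((norm (F p))\<^sup>2 / 4)) (\<lambda>p. (norm (F p))\<^sup>2 / 4) p"
proof -
  obtain V where V: "(V, param_at \<A> p) \<in> \<A>" "coord_at \<A> p \<in> V" "param_at \<A> p (coord_at \<A> p) = p"
    by (rule obtain_param_at)
  interpret immersed_patch "F \<circ> param_at \<A> p" V by (rule patch[OF V(1)])
  have f: "Ck_on 2 (\<phi> \<circ> param_at \<A> p) V"
    using Ck_mapD[OF Ck_map_smooth[OF \<phi>] V(1)] by (simp add: o_def)
  let ?N = "position_normal \<A> F p" and ?E = "exp ((norm (F p))\<^sup>2 / 4)"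
  have H: "H_vec \<A> F p = (1/2) *\<^sub>R ?N" using se by (simp add: self_expander_def)
  have "(mean_curv (F \<circ> param_at \<A> p) (coord_at \<A> p))\<^sup>2 = (norm (H_vec \<A> F p))\<^sup>2"
    unfolding H_vec_def by (rule mean_curv_square[OF V(2) codim])
  then have "(mean_curv (F \<circ> param_at \<A> p) (coord_at \<A> p))\<^sup>2 = (norm ?N)\<^sup>2 / 4"
    by (simp add: H power_divide)
  then have A: "A_norm2 \<A> F p - 1/2 \<le> real CARD('n) / 2 + (norm ?N)\<^sup>2 / 4"
    using scal by (simp add: Scal_def scal_curv_def A_norm2_def field_simps)
  define w where "w = grad \<A> F \<phi> p + \<phi> p *\<^sub>R gradient (F \<circ> param_at \<A> p) (\<lambda>u. (norm ((F \<circ> param_at \<A> p) u))\<^sup>2 / 4) (coord_at \<A> p)"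
  have "green (\<lambda>p. (\<phi> p)\<^sup>2 * exp ((norm (F p))\<^sup>2 / 4)) (\<lambda>p. (norm (F p))\<^sup>2 / 4) p =
    ((norm w)\<^sup>2 - (norm (grad \<A> F \<phi> p))\<^sup>2
      + (\<phi> p)\<^sup>2 * (real CARD('n) / 2 + 1/2 * (?N \<bullet> H_vec \<A> F p))) * ?E"
    using green_density_square_norm_position[OF f V(2)] V(3)
    by (simp add: green_def grad_def o_def position_normal_def H_vec_def w_def)
  then have "((norm (grad \<A> F \<phi> p))\<^sup>2 - (A_norm2 \<A> F p - 1/2) * (\<phi> p)\<^sup>2) * ?E
    + green (\<lambda>p. (\<phi> p)\<^sup>2 * exp ((norm (F p))\<^sup>2 / 4)) (\<lambda>p. (norm (F p))\<^sup>2 / 4) p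
    = ((norm w)\<^sup>2 + (real CARD('n) / 2 + (norm ?N)\<^sup>2 / 4 - (A_norm2 \<A> F p - 1/2)) * (\<phi> p)\<^sup>2) * ?E"
    by (simp add: H power2_norm_eq_inner[of ?N] algebra_simps)
  also have "\<dots> \<ge> 0"
    using A by (intro mult_nonneg_nonneg add_nonneg_nonneg) auto
  finally show ?thesis .
qed

end

theorem corollary1p1:
  fixes \<A> :: "('n::finite, 'm::{second_countable_topology, t2_space}) chart set"
    and F :: "'m \<Rightarrow> real ^ 'k::finite"
  assumes "immersed_hypersurface \<A> F"
    and "complete_hypersurface F"
    and "self_expander \<A> F"
    and "\<And>p. Scal \<A> F p \<ge> - (real CARD('n) + 1) / 2"
  shows "L_stable \<A> F"
  unfolding L_stable_def
proof (intro allI impI)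
  fix \<phi> assume "smooth_compact_support \<A> \<phi>"
  then have \<phi>: "smooth_map \<A> \<phi>" and K: "compact (closure {p. \<phi> p \<noteq> 0})"
    by (auto simp: smooth_compact_support_def)
  interpret hypersurface \<A> F by unfold_locales fact
  have supp: "\<phi> p = 0" if "p \<notin> closure {p. \<phi> p \<noteq> 0}" for p
    using that closure_subset[of "{p. \<phi> p \<noteq> 0}"] by auto
  let ?E = "\<lambda>p. exp ((norm (F p))\<^sup>2 / 4)"
  let ?I = "\<lambda>p. \<phi> p * L_op \<A> F \<phi> p * ?E p"
  let ?J = "\<lambda>p. ((norm (grad \<A> F \<phi> p))\<^sup>2 - (A_norm2 \<A> F p - 1/2) * (\<phi> p)\<^sup>2) * ?E p"
  let ?G = "green (\<lambda>p. \<phi> p * ?E p) \<phi>"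
  let ?G' = "green (\<lambda>p. (\<phi> p)\<^sup>2 * ?E p) (\<lambda>p. (norm (F p))\<^sup>2 / 4)"
  have E1: "Ck_map (Suc 0) ?E"
    by (intro Ck_mapI C1_on_exp Ck_mapD[OF Ck_map_2_imp_1[OF C2_square_norm]])
  have 1: "Ck_map (Suc 0) (\<lambda>p. \<phi> p * ?E p)"
    by (intro Ck_mapI C1_on_mult Ck_mapD[OF E1] Ck_mapD[OF Ck_map_smooth[OF \<phi>]])
  have 2: "Ck_map (Suc 0) (\<lambda>p. (\<phi> p)\<^sup>2 * ?E p)"
    unfolding power2_eq_square[of "\<phi> _"]
    by (intro Ck_mapI C1_on_mult Ck_mapD[OF E1] Ck_mapD[OF Ck_map_smooth[OF \<phi>]])
  have G: "integrable \<sigma> ?G \<and> (LINT p|\<sigma>. ?G p) = 0"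
    by (rule green_formula[OF 1 Ck_map_smooth[OF \<phi>] K]) (drule supp, simp)
  have G': "integrable \<sigma> ?G' \<and> (LINT p|\<sigma>. ?G' p) = 0"
    by (rule green_formula[OF 2 C2_square_norm K]) (drule supp, simp)
  have sum: "?G = (\<lambda>p. ?I p + ?J p)"
    using green_drift_laplacian[OF \<phi>] by (simp add: fun_eq_iff)
  \<comment> \<open>\<open>?I\<close> and \<open>?J\<close> add up to the integrable function \<open>?G\<close>, so they are integrable or not together;
    in the second case both integrals are \<open>0\<close> by convention\<close>
  have "- (LINT p|\<sigma>. ?I p) = (LINT p|\<sigma>. ?J p)"
  proof (cases "integrable \<sigma> ?I")
    case True
    have "(LINT p|\<sigma>. ?J p) = (LINT p|\<sigma>. ?G p - ?I p)" by (simp add: sum)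
    also have "\<dots> = (LINT p|\<sigma>. ?G p) - (LINT p|\<sigma>. ?I p)"
      using True G by (intro Bochner_Integration.integral_diff) auto
    finally show ?thesis using G by simp
  next
    case False
    have "\<not> integrable \<sigma> ?J"
    proof
      assume "integrable \<sigma> ?J"
      then have "integrable \<sigma> (\<lambda>p. ?G p - ?J p)" using G by (intro Bochner_Integration.integrable_diff) auto
      then show False using False by (simp add: sum)
    qed
    then show ?thesis using False by (simp add: not_integrable_integral_eq)
  qed
  moreover have "0 \<le> (LINT p|\<sigma>. ?J p)"
  proof (cases "integrable \<sigma> ?J")
    case True
    have "CARD('k) = CARD('n) + 1" using assms(1) by (simp add: immersed_hypersurface_def)
    then have "0 \<le> ?J p + ?G' p" for p
      using stability_integrand_bound assms(3,4) \<phi> by blast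
    then have "0 \<le> (LINT p|\<sigma>. ?J p + ?G' p)" by (intro integral_nonneg_AE AE_I2)
    also have "\<dots> = (LINT p|\<sigma>. ?J p) + (LINT p|\<sigma>. ?G' p)"
      using True G' by (intro Bochner_Integration.integral_add) auto
    finally show ?thesis using G' by simp
  qed (simp add: not_integrable_integral_eq)
  ultimately show "- (LINT p|\<sigma>. ?I p) = stability_form \<A> F \<phi> \<and> 0 \<le> stability_form \<A> F \<phi>"
    by (simp add: stability_form_def)
qed

end
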